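(* Let $d,e$ be coprime integers with $1\le e<d$, and let $G\subseteq\mathrm{Aut}(X_{d,e})$ be an algebraic group acting on the affine toric surface $X_{d,e}=\mathbb{A}^2/G_{d,e}$. (a) If $e^2\not\equiv 1\mod d$ then $G$ is conjugate in the group $\mathrm{Aut}(X_{d,e})$ to a subgroup of one of the groups $\mathcal{N}_{d,e}^+/G_{d,e}$ and $\mathcal{N}_{d,e}^-/G_{d,e}$. (b) If $e^2\equiv 1\mod d$ and $e>1$ then $G$ is conjugate in $\mathrm{Aut}(X_{d,e})$ to a subgroup of one of the groups $\mathcal{N}_{d,e}^+/G_{d,e}$ and $N(\mathbb{T})/G_{d,e}$. (c) If $e=1$ then $G$ is conjugate in $\mathrm{Aut}(X_{d,e})$ to a subgroup of one of the groups $\mathcal{N}_{d,e}^+/G_{d,e}$ and $\mathrm{GL}(2,\mathbb{C})/G_{d,e}$.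
   Context: The base field is $\mathbb{C}$, and $\mathbb{A}^2$ has coordinates $(x,y)$. Let $\zeta=\exp(2\pi i/d)$; $G_{d,e}=\langle g\rangle\subseteq \mathrm{GL}(2,\mathbb{C})$ with $g:(x,y)\mapsto(\zeta^e x,\zeta y)$; $X_{d,e}=\mathrm{Spec}\,\mathbb{C}[x,y]^{G_{d,e}}$. $\mathrm{Jonq}^+(\mathbb{A}^2)$ is the group of transformations $(x,y)\mapsto(\alpha x+f(y),\beta y)$ and $\mathrm{Jonq}^-(\mathbb{A}^2)$ is the group of transformations $(x,y)\mapsto(\alpha x,\beta y+f(x))$, where $\alpha,\beta\in\mathbb{C}^\times$ and $f\in\mathbb{C}[t]$. $\mathcal{N}_{d,e}$ is the normalizer of $G_{d,e}$ in $\mathrm{Aut}(\mathbb{A}^2)$ and $\mathcal{N}_{d,e}^\pm=\mathcal{N}_{d,e}\cap\mathrm{Jonq}^\pm(\mathbb{A}^2)$. $\mathbb{T}\subseteq\mathrm{GL}(2,\mathbb{C})$ is the torus of diagonal matrices and $N(\mathbb{T})$ is its normalizer in $\mathrm{GL}(2,\mathbb{C})$. Every element of $\mathcal{N}_{d,e}$ descends to an automorphism of $X_{d,e}$, and the elements descending to the identity are exactly those of $G_{d,e}$; so for a subgroup $H$ with $G_{d,e}\subseteq H\subseteq\mathcal{N}_{d,e}$ the quotient $H/G_{d,e}$ is regarded as a subgroup of $\mathrm{Aut}(X_{d,e})$. An algebraic group $G\subseteq \mathrm{Aut}(X_{d,e})$ is a (linear) algebraic group acting regularly and effectively on $X_{d,e}$.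 *)

theory Defs
  imports
    "HOL-Analysis.Analysis"
    "HOL-Algebra.Group_Action"
    "HOL-Algebra.Generated_Groups"
    "HOL-Number_Theory.Cong"
begin

section \<open>Affine varieties over the complex numbers\<close>

text \<open>
  An affine variety is given by its set \<open>X\<close> of closed points together with its coordinate
  ring \<open>R\<close>, a set of functions on the ambient type that are only ever compared on \<open>X\<close>.
\<close>

inductive_set function_algebra :: "('p \<Rightarrow> complex) set \<Rightarrow> ('p \<Rightarrow> complex) set"
  for C :: "('p \<Rightarrow> complex) set" where
  gen: "f \<in> C \<Longrightarrow> f \<in> function_algebra C"
| const: "(\<lambda>_. c) \<in> function_algebra C"
| add: "f \<in> function_algebra C \<Longrightarrow> g \<in> function_algebra C
    \<Longrightarrow> (\<lambda>x. f x + g x) \<in> function_algebra C"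
| mult: "f \<in> function_algebra C \<Longrightarrow> g \<in> function_algebra C
    \<Longrightarrow> (\<lambda>x. f x * g x) \<in> function_algebra C"

definition morphism ::
  "'p set \<Rightarrow> ('p \<Rightarrow> complex) set \<Rightarrow> 'q set \<Rightarrow> ('q \<Rightarrow> complex) set \<Rightarrow> ('p \<Rightarrow> 'q) \<Rightarrow> bool" where
  "morphism X R Y S \<phi> \<longleftrightarrow>
     \<phi> \<in> X \<rightarrow> Y \<and> (\<forall>b\<in>S. \<exists>a\<in>R. \<forall>x\<in>X. b (\<phi> x) = a x)"

definition variety_aut :: "'p set \<Rightarrow> ('p \<Rightarrow> complex) set \<Rightarrow> ('p \<Rightarrow> 'p) monoid" where
  "variety_aut X R = BijGroup X
     \<lparr>carrier := {\<phi> \<in> Bij X. morphism X R X R \<phi> \<and> morphism X R X R (inv_into X \<phi>)}\<rparr>"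

text \<open>The product of the varieties \<open>(X, R)\<close> and \<open>(Y, S)\<close> has the points \<open>X \<times> Y\<close>; its coordinate
  ring is (the image in the functions of) the tensor product of \<open>R\<close> and \<open>S\<close>.\<close>

definition product_ring ::
  "('p \<Rightarrow> complex) set \<Rightarrow> ('q \<Rightarrow> complex) set \<Rightarrow> ('p \<times> 'q \<Rightarrow> complex) set" where
  "product_ring R S =
     function_algebra ({\<lambda>z. a (fst z) | a. a \<in> R} \<union> {\<lambda>z. b (snd z) | b. b \<in> S})"

text \<open>The closed points of the spectrum of an algebra \<open>A\<close> of functions are the homomorphisms of
  \<open>\<complex>\<close>-algebras from \<open>A\<close> to \<open>\<complex>\<close>, taken to be undefined outside \<open>A\<close>; an element of \<open>A\<close>
  is a regular function on the spectrum by evaluation.\<close>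

definition spec :: "('p \<Rightarrow> complex) set \<Rightarrow> (('p \<Rightarrow> complex) \<Rightarrow> complex) set" where
  "spec A = {\<xi> \<in> extensional A.
     (\<forall>c. \<xi> (\<lambda>_. c) = c) \<and>
     (\<forall>a\<in>A. \<forall>b\<in>A. \<xi> (\<lambda>p. a p + b p) = \<xi> a + \<xi> b \<and> \<xi> (\<lambda>p. a p * b p) = \<xi> a * \<xi> b)}"

definition spec_ring :: "('p \<Rightarrow> complex) set \<Rightarrow> ((('p \<Rightarrow> complex) \<Rightarrow> complex) \<Rightarrow> complex) set" where
  "spec_ring A = {\<lambda>\<xi>. \<xi> a | a. a \<in> A}"


section \<open>Linear algebraic groups and their actions\<close>

definition GL :: "(complex^'n^'n) monoid" where
  "GL = \<lparr>carrier = {M. invertible M}, mult = (**), one = mat 1\<rparr>"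

definition GL_ring :: "(complex^'n^'n \<Rightarrow> complex) set" where
  "GL_ring = function_algebra ({\<lambda>M. M $ i $ j | i j. True} \<union> {\<lambda>M. inverse (det M)})"

definition linear_algebraic_group :: "(complex^'n^'n) set \<Rightarrow> bool" where
  "linear_algebraic_group L \<longleftrightarrow>
     subgroup L GL \<and> (\<exists>F\<subseteq>GL_ring. L = {M \<in> carrier GL. \<forall>f\<in>F. f M = 0})"

text \<open>The restrictions of \<open>GL_ring\<close> form the coordinate ring of \<open>L\<close>. Regularity of the action
  map forces every \<open>\<rho> M\<close> to lie in the automorphism group of the variety.\<close>

definition regular_effective_action ::
  "(complex^'n^'n) set \<Rightarrow> 'p set \<Rightarrow> ('p \<Rightarrow> complex) set \<Rightarrow> (complex^'n^'n \<Rightarrow> 'p \<Rightarrow> 'p) \<Rightarrow> bool" where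
  "regular_effective_action L X R \<rho> \<longleftrightarrow>
     faithful_action (GL\<lparr>carrier := L\<rparr>) X \<rho> \<and>
     morphism (L \<times> X) (product_ring GL_ring R) X R (\<lambda>(M, x). \<rho> M x)"


section \<open>The affine plane\<close>

type_synonym plane = "complex \<times> complex"

definition plane_ring :: "(plane \<Rightarrow> complex) set" where
  "plane_ring = function_algebra {fst, snd}"

definition Aut_plane :: "(plane \<Rightarrow> plane) monoid" where
  "Aut_plane = variety_aut UNIV plane_ring"

definition Jonq_plus :: "(plane \<Rightarrow> plane) set" where
  "Jonq_plus = {\<lambda>(x, y). (\<alpha> * x + poly f y, \<beta> * y) | \<alpha> \<beta> f. \<alpha> \<noteq> 0 \<and> \<beta> \<noteq> 0}"

definition Jonq_minus :: "(plane \<Rightarrow> plane) set" where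
  "Jonq_minus = {\<lambda>(x, y). (\<alpha> * x, \<beta> * y + poly f x) | \<alpha> \<beta> f. \<alpha> \<noteq> 0 \<and> \<beta> \<noteq> 0}"

definition GL2 :: "(plane \<Rightarrow> plane) set" where
  "GL2 = {\<lambda>(x, y). (a * x + b * y, c * x + d * y) | a b c d. a * d - b * c \<noteq> 0}"

definition torus :: "(plane \<Rightarrow> plane) set" where
  "torus = {\<lambda>(x, y). (a * x, d * y) | a d. a \<noteq> 0 \<and> d \<noteq> 0}"

definition normalizer_torus :: "(plane \<Rightarrow> plane) set" where
  "normalizer_torus = normalizer (Aut_plane\<lparr>carrier := GL2\<rparr>) torus"


section \<open>The toric surface\<close>

definition cyclic_group :: "nat \<Rightarrow> nat \<Rightarrow> (plane \<Rightarrow> plane) set" where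
  "cyclic_group d e =
     (let \<zeta> = exp (2 * of_real pi * \<i> / of_nat d)
      in generate Aut_plane {\<lambda>(x, y). (\<zeta> ^ e * x, \<zeta> * y)})"

definition invariant_ring :: "nat \<Rightarrow> nat \<Rightarrow> (plane \<Rightarrow> complex) set" where
  "invariant_ring d e = {f \<in> plane_ring. \<forall>h\<in>cyclic_group d e. f \<circ> h = f}"

definition surface :: "nat \<Rightarrow> nat \<Rightarrow> ((plane \<Rightarrow> complex) \<Rightarrow> complex) set" where
  "surface d e = spec (invariant_ring d e)"

definition surface_ring :: "nat \<Rightarrow> nat \<Rightarrow> (((plane \<Rightarrow> complex) \<Rightarrow> complex) \<Rightarrow> complex) set" where
  "surface_ring d e = spec_ring (invariant_ring d e)"

abbreviation Aut_surface ::
  "nat \<Rightarrow> nat \<Rightarrow> (((plane \<Rightarrow> complex) \<Rightarrow> complex) \<Rightarrow> ((plane \<Rightarrow> complex) \<Rightarrow> complex)) monoid" where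
  "Aut_surface d e \<equiv> variety_aut (surface d e) (surface_ring d e)"

definition N_full :: "nat \<Rightarrow> nat \<Rightarrow> (plane \<Rightarrow> plane) set" where
  "N_full d e = normalizer Aut_plane (cyclic_group d e)"

definition N_plus :: "nat \<Rightarrow> nat \<Rightarrow> (plane \<Rightarrow> plane) set" where
  "N_plus d e = N_full d e \<inter> Jonq_plus"

definition N_minus :: "nat \<Rightarrow> nat \<Rightarrow> (plane \<Rightarrow> plane) set" where
  "N_minus d e = N_full d e \<inter> Jonq_minus"

text \<open>The automorphism of the surface to which \<open>h\<close> in the normalizer descends: composition with
  \<open>h\<close> preserves the invariant ring, and the image of a point \<open>q\<close> of the plane, which is evaluation
  at \<open>q\<close>, is sent to evaluation at \<open>h q\<close>.\<close>

definition descend ::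
  "nat \<Rightarrow> nat \<Rightarrow> (plane \<Rightarrow> plane) \<Rightarrow> ((plane \<Rightarrow> complex) \<Rightarrow> complex) \<Rightarrow> ((plane \<Rightarrow> complex) \<Rightarrow> complex)" where
  "descend d e h = (\<lambda>\<xi>\<in>surface d e. \<lambda>a\<in>invariant_ring d e. \<xi> (a \<circ> h))"

text \<open>For a group \<open>H\<close> between the cyclic group and its normalizer, \<open>descend d e ` H\<close> is
  the quotient of \<open>H\<close> by the cyclic group, regarded as a subgroup of \<open>Aut_surface d e\<close>.\<close>

definition quotient_in_Aut ::
  "nat \<Rightarrow> nat \<Rightarrow> (plane \<Rightarrow> plane) set
    \<Rightarrow> (((plane \<Rightarrow> complex) \<Rightarrow> complex) \<Rightarrow> ((plane \<Rightarrow> complex) \<Rightarrow> complex)) set" where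
  "quotient_in_Aut d e H = descend d e ` H"

definition conjugate_into :: "('g, 'm) monoid_scheme \<Rightarrow> 'g set \<Rightarrow> 'g set \<Rightarrow> bool" where
  "conjugate_into A G K \<longleftrightarrow> (\<exists>\<psi>\<in>carrier A. \<psi> <#\<^bsub>A\<^esub> G #>\<^bsub>A\<^esub> (inv\<^bsub>A\<^esub> \<psi>) \<subseteq> K)"

end

theory Submission
  imports
    Defs
    "HOL-Computational_Algebra.Computational_Algebra"
    "HOL-Computational_Algebra.Field_as_Ring"
begin

text \<open>
  Every automorphism of the surface lifts to the normalizer \<open>\<N>\<close> of the cyclic group: the images
  of the invariants \<open>x\<^sup>d\<close> and \<open>y\<^sup>d\<close> under the comorphism have only finitely many common zeros, so
  they are coprime, and since their products with suitable powers of each other are \<open>d\<close>-th powers,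
  they are \<open>d\<close>-th powers themselves.

  \<open>\<N>\<close> is generated by \<open>\<N>\<^sup>+\<close> and one further subgroup \<open>B\<close>: if \<open>(P, Q)\<close> is an automorphism of the
  plane then the Jacobian derivation of \<open>P\<close> is locally nilpotent, and so is that of the leading
  form of \<open>P\<close> for any weights. This forces the leading form along the edge of the Newton polygon
  to be a power of \<open>x - c y\<^sup>q\<close> or \<open>y - c x\<^sup>q\<close>, and substituting shrinks the polygon. When \<open>P\<close> is
  semi-invariant, the substitution normalizes the cyclic group.

  The degree of a reduced word in \<open>\<N>\<^sup>+\<close> and \<open>B\<close> grows with its length, while regularity of the
  action bounds the degrees in the lift of an algebraic group. A subgroup with reduced words of
  bounded length is conjugate into one of the two factors.
\<close>

section \<open>Bounded subgroups of a group generated by two subgroups\<close>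

text \<open>Word length is treated as a relation: the degree estimate bounds all reduced words of an
  element at once. In the application, conjugating by the first letter of a longest word moves the
  base point of the Bass-Serre tree towards a fixed vertex. The reduction inside the normalizer
  follows only the first component \<open>P\<close>: as soon as one variable has left
  \<open>P\<close>, the constant Jacobian fixes the shape of the second component. The edge of the
  Newton polygon carries two monomials of \<open>P\<close> whose characters under the cyclic group
  must agree, and this congruence is what makes the substitution commute with the generator. The
  common zeros are finite in number because \<open>x ^ d\<close> and \<open>y ^ d\<close> vanish
  together at a single point of the surface and the quotient map has finite fibres. The
  \<open>d\<close>-th roots are ambiguous by roots of unity; the invariant
  \<open>x * y ^ (d - e)\<close> fixes one root relative to the other. The passage from regularity
  to degrees uses the invariant \<open>y ^ d\<close>: its pullback along a lift is the
  \<open>d\<close>-th power of the second component.\<close>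

lemma (in group) subgroup_conj:
  assumes "subgroup K G" "a \<in> carrier G"
  shows "subgroup {inv a \<otimes> x \<otimes> a | x. x \<in> K} G"
proof
  show "{inv a \<otimes> x \<otimes> a | x. x \<in> K} \<subseteq> carrier G"
    using assms subgroup.mem_carrier[OF assms(1)] by auto
  have "\<one> = inv a \<otimes> \<one> \<otimes> a" using assms by simp
  then show "\<one> \<in> {inv a \<otimes> x \<otimes> a | x. x \<in> K}"
    using subgroup.one_closed[OF assms(1)] by blast
next
  fix u v assume "u \<in> {inv a \<otimes> x \<otimes> a | x. x \<in> K}" "v \<in> {inv a \<otimes> x \<otimes> a | x. x \<in> K}"
  then obtain x y where xy: "x \<in> K" "y \<in> K" "u = inv a \<otimes> x \<otimes> a" "v = inv a \<otimes> y \<otimes> a" by blast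
  then have c: "x \<in> carrier G" "y \<in> carrier G" using subgroup.mem_carrier[OF assms(1)] by auto
  have "u \<otimes> v = inv a \<otimes> (x \<otimes> y) \<otimes> a"
    using c assms(2) by (simp add: xy m_assoc) (simp add: m_assoc[symmetric])
  then show "u \<otimes> v \<in> {inv a \<otimes> x \<otimes> a | x. x \<in> K}"
    using xy subgroup.m_closed[OF assms(1)] by blast
next
  fix u assume "u \<in> {inv a \<otimes> x \<otimes> a | x. x \<in> K}"
  then obtain x where x: "x \<in> K" "u = inv a \<otimes> x \<otimes> a" by blast
  then have "x \<in> carrier G" using subgroup.mem_carrier[OF assms(1)] by auto
  then have "inv u = inv a \<otimes> inv x \<otimes> a"
    using assms(2) by (simp add: x inv_mult_group m_assoc)
  then show "inv u \<in> {inv a \<otimes> x \<otimes> a | x. x \<in> K}"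
    using x subgroup.m_inv_closed[OF assms(1)] by blast
qed

text \<open>Indexing the factors by a Boolean makes \<open>\<not> s\<close> the other factor, so
  that one argument serves words starting in either factor.\<close>

locale two_subgroups = group G for G (structure) +
  fixes F :: "bool \<Rightarrow> 'a set"
  assumes subgroup_factor: "subgroup (F s) G"
begin

abbreviation core :: "'a set" where "core \<equiv> F True \<inter> F False"

text \<open>\<open>n\<close> counts the letters; \<open>s\<close> and \<open>t\<close> are the
  factors of the first and of the last letter. Both ends are recorded because they decide whether
  two words can be joined without cancellation.\<close>

inductive reduced_word :: "nat \<Rightarrow> bool \<Rightarrow> bool \<Rightarrow> 'a \<Rightarrow> bool" where
  letter: "a \<in> F s - core \<Longrightarrow> reduced_word 1 s s a"
| Cons: "a \<in> F s - core \<Longrightarrow> reduced_word n (\<not> s) t w \<Longrightarrow> reduced_word (Suc n) s t (a \<otimes> w)"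

lemma factor_closed [simp]: "a \<in> F s \<Longrightarrow> a \<in> carrier G"
  using subgroup.mem_carrier[OF subgroup_factor] .

lemma factors_subset: "F True \<union> F False \<subseteq> carrier G"
  by auto

lemma factor_mult: "a \<in> F s \<Longrightarrow> b \<in> F s \<Longrightarrow> a \<otimes> b \<in> F s"
  using subgroup.m_closed[OF subgroup_factor] .

lemma factor_inv: "a \<in> F s \<Longrightarrow> inv a \<in> F s"
  using subgroup.m_inv_closed[OF subgroup_factor] .

lemma core_in_factor: "c \<in> core \<Longrightarrow> c \<in> F s"
  by (cases s) auto

lemma core_mult: "a \<in> core \<Longrightarrow> b \<in> core \<Longrightarrow> a \<otimes> b \<in> core"
  by (simp add: factor_mult)

lemma core_inv: "a \<in> core \<Longrightarrow> inv a \<in> core"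
  by (simp add: factor_inv)

lemma core_mult_left:
  assumes "c \<in> core" "a \<in> F s - core" shows "c \<otimes> a \<in> F s - core"
proof -
  have "a \<in> core" if "c \<otimes> a \<in> core"
  proof -
    have "inv c \<otimes> (c \<otimes> a) \<in> core" using core_mult core_inv assms that by blast
    moreover have "inv c \<otimes> (c \<otimes> a) = a"
      using assms factor_closed[of c True] factor_closed[of a s] by (simp add: m_assoc[symmetric])
    ultimately show ?thesis by simp
  qed
  thus ?thesis using assms factor_mult core_in_factor by blast
qed

lemma core_mult_right:
  assumes "c \<in> core" "a \<in> F s - core" shows "a \<otimes> c \<in> F s - core"
proof -
  have "a \<in> core" if "a \<otimes> c \<in> core"
  proof -
    have "(a \<otimes> c) \<otimes> inv c \<in> core" using core_mult core_inv assms that by blast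
    moreover have "(a \<otimes> c) \<otimes> inv c = a"
      using assms factor_closed[of c True] factor_closed[of a s] by (simp add: m_assoc)
    ultimately show ?thesis by simp
  qed
  thus ?thesis using assms factor_mult core_in_factor by blast
qed

lemma core_compl_inv: "a \<in> F s - core \<Longrightarrow> inv a \<in> F s - core"
  by (metis DiffD1 DiffD2 DiffI core_inv factor_closed factor_inv inv_inv)

lemma reduced_word_closed: "reduced_word n s t w \<Longrightarrow> w \<in> carrier G"
  by (induction rule: reduced_word.induct) auto

lemma reduced_word_pos: "reduced_word n s t w \<Longrightarrow> 0 < n"
  by (induction rule: reduced_word.induct) auto

lemma reduced_word_append:
  "reduced_word n s t v \<Longrightarrow> reduced_word m (\<not> t) r w \<Longrightarrow> reduced_word (n + m) s r (v \<otimes> w)"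
proof (induction rule: reduced_word.induct)
  case (letter a s)
  then show ?case using reduced_word.Cons by simp
next
  case (Cons a s n t v)
  then have "reduced_word (Suc (n + m)) s r (a \<otimes> (v \<otimes> w))"
    using reduced_word.Cons by blast
  moreover have "a \<otimes> (v \<otimes> w) = a \<otimes> v \<otimes> w"
    using Cons reduced_word_closed[OF Cons.hyps(2)] reduced_word_closed[OF Cons.prems] factor_closed[of a s]
    by (simp add: m_assoc)
  ultimately show ?case by simp
qed

lemma reduced_word_inv: "reduced_word n s t w \<Longrightarrow> reduced_word n t s (inv w)"
proof (induction rule: reduced_word.induct)
  case (letter a s)
  then show ?case using reduced_word.letter core_compl_inv by blast
next
  case (Cons a s n t v)
  have "reduced_word 1 (\<not> \<not> s) s (inv a)"
    using letter[OF core_compl_inv[OF Cons.hyps(1)]] by simp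
  from reduced_word_append[OF Cons.IH this] have "reduced_word (Suc n) t s (inv v \<otimes> inv a)" by simp
  then show ?case
    using Cons reduced_word_closed[OF Cons.hyps(2)] factor_closed[of a s] by (simp add: inv_mult_group)
qed

lemma reduced_word_uncons:
  assumes "reduced_word n s t w" "1 < n"
  obtains a v where "a \<in> F s - core" "reduced_word (n - 1) (\<not> s) t v" "w = a \<otimes> v"
  using assms by (cases rule: reduced_word.cases) auto

lemma reduced_word_unsnoc:
  assumes "reduced_word n s t w" "1 < n"
  obtains a v where "a \<in> F t - core" "reduced_word (n - 1) s (\<not> t) v" "w = v \<otimes> a"
proof -
  obtain a v where av: "a \<in> F t - core" "reduced_word (n - 1) (\<not> t) s v" "inv w = a \<otimes> v"
    using reduced_word_uncons[OF reduced_word_inv[OF assms(1)] assms(2)] .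
  have "w = inv (inv w)" using reduced_word_closed[OF assms(1)] by simp
  also have "\<dots> = inv v \<otimes> inv a" using av reduced_word_closed by (auto simp: inv_mult_group)
  finally show thesis using that[of "inv a" "inv v"] av core_compl_inv reduced_word_inv by blast
qed

lemma reduced_word_1: "reduced_word n s t w \<Longrightarrow> n \<le> 1 \<Longrightarrow> n = 1 \<and> s = t \<and> w \<in> F s - core"
  by (induction rule: reduced_word.induct) (auto dest: reduced_word_pos)

lemma core_reduced_word:
  assumes "c \<in> core" "reduced_word n s t w" shows "reduced_word n s t (c \<otimes> w)"
  using assms(2)
proof (cases rule: reduced_word.cases)
  case letter
  then show ?thesis using core_mult_left[OF assms(1)] reduced_word.letter by blast
next
  case (Cons a n' v)
  have "reduced_word n s t ((c \<otimes> a) \<otimes> v)"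
    using Cons core_mult_left[OF assms(1)] reduced_word.Cons by blast
  then show ?thesis using Cons assms reduced_word_closed by (auto simp: m_assoc)
qed

lemma reduced_word_core:
  assumes "c \<in> core" "reduced_word n s t w" shows "reduced_word n s t (w \<otimes> c)"
proof -
  have "reduced_word n t s (inv c \<otimes> inv w)"
    by (intro core_reduced_word core_inv assms reduced_word_inv)
  from reduced_word_inv[OF this] show ?thesis
    using assms reduced_word_closed[OF assms(2)] by (auto simp: inv_mult_group)
qed

lemma reduced_word_snoc:
  "reduced_word n s r w \<Longrightarrow> r = (\<not> t) \<Longrightarrow> a \<in> F t - core \<Longrightarrow> reduced_word (Suc n) s t (w \<otimes> a)"
  using reduced_word_append[of n s "\<not> t" w 1 t a] letter by simp

text \<open>A letter multiplied on the left is prepended, merges with the first letter, or cancels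
  it up to a core element that the rest of the word absorbs.\<close>

lemma generate_cases:
  assumes "x \<in> generate G (F True \<union> F False)"
  shows "x \<in> core \<or> (\<exists>n s t. reduced_word n s t x)"
proof -
  have mult: "a \<otimes> x \<in> core \<or> (\<exists>n s t. reduced_word n s t (a \<otimes> x))"
    if "x \<in> core \<or> (\<exists>n s t. reduced_word n s t x)" "a \<in> F r" for a r x
  proof (cases "a \<in> core")
    case True
    then show ?thesis using that(1) core_mult core_reduced_word by blast
  next
    case False
    with that have a: "a \<in> F r - core" by blast
    from that(1) show ?thesis
    proof (elim disjE exE)
      assume "x \<in> core"
      then show ?thesis using core_mult_right a letter by blast
    next
      fix n s t assume w: "reduced_word n s t x"
      show ?thesis
      proof (cases "s = r")
        case False
        then have "s = (\<not> r)" by blast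
        then show ?thesis using Cons a w by blast
      next
        case sr: True
        show ?thesis
        proof (cases "n = 1")
          case True
          then have "a \<otimes> x \<in> F r" using reduced_word_1[OF w] a sr factor_mult by auto
          then show ?thesis using letter[of "a \<otimes> x" r] by blast
        next
          case False
          then have "1 < n" using reduced_word_pos[OF w] by simp
          from reduced_word_uncons[OF w this] obtain b v where
            bv: "b \<in> F s - core" "reduced_word (n - 1) (\<not> s) t v" "x = b \<otimes> v" .
          have eq: "a \<otimes> x = (a \<otimes> b) \<otimes> v" using a bv reduced_word_closed by (auto simp: m_assoc)
          show ?thesis
          proof (cases "a \<otimes> b \<in> core")
            case True
            then show ?thesis using core_reduced_word bv eq by metis
          next
            case False
            then have "a \<otimes> b \<in> F s - core" using a bv sr factor_mult by blast
            then show ?thesis using Cons bv eq by metis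
          qed
        qed
      qed
    qed
  qed
  \<comment> \<open>\<open>generate\<close> multiplies arbitrary generated elements, so the
    induction proves that left multiplication by \<open>x\<close> preserves the dichotomy for every
    \<open>y\<close>; at the end \<open>y\<close> is the unit.\<close>
  have "\<forall>y. y \<in> core \<or> (\<exists>n s t. reduced_word n s t y) \<longrightarrow>
      x \<otimes> y \<in> core \<or> (\<exists>n s t. reduced_word n s t (x \<otimes> y))"
    using assms
  proof (induction rule: generate.induct)
    case one
    then show ?case using reduced_word_closed by auto
  next
    case (incl h)
    then show ?case using mult by blast
  next
    case (inv h)
    then show ?case using mult factor_inv by blast
  next
    case (eng h1 h2)
    have "h1 \<in> carrier G" "h2 \<in> carrier G"
      using eng.hyps generate_in_carrier[OF factors_subset] by auto
    then have "h1 \<otimes> h2 \<otimes> y = h1 \<otimes> (h2 \<otimes> y)"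
      if "y \<in> core \<or> (\<exists>n s t. reduced_word n s t y)" for y
      using that reduced_word_closed by (auto simp: m_assoc)
    then show ?case using eng.IH by metis
  qed
  moreover have "\<one> \<in> core" using subgroup.one_closed[OF subgroup_factor] by auto
  moreover have "x \<otimes> \<one> = x"
    using generate_in_carrier[OF factors_subset assms] by simp
  ultimately show ?thesis by metis
qed

text \<open>If a reduced word of maximal length \<open>n \<ge> 2\<close> in the subgroup starts with the letter \<open>a\<close>, then
  comparing it with its products with the other elements shows that the bound drops after
  conjugation by \<open>a\<close>.\<close>

theorem bounded_subgroup_conjugate_into_factor:
  assumes "subgroup K G" "K \<subseteq> generate G (F True \<union> F False)"
    and "\<And>m s t w. w \<in> K \<Longrightarrow> reduced_word m s t w \<Longrightarrow> m \<le> n"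
  shows "\<exists>a \<in> generate G (F True \<union> F False). \<exists>s. \<forall>x\<in>K. inv a \<otimes> x \<otimes> a \<in> F s"
  using assms
proof (induction n arbitrary: K)
  case 0
  then have "K \<subseteq> core"
    using generate_cases reduced_word_pos by (metis bot_nat_0.not_eq_extremum le_zero_eq subset_eq)
  then have "\<forall>x\<in>K. inv \<one> \<otimes> x \<otimes> \<one> \<in> F True" by auto
  then show ?case using generate.one by blast
next
  case (Suc n)
  note K = \<open>subgroup K G\<close>
  note KG = subgroup.mem_carrier[OF K]
  show ?case
  proof (cases "n = 0")
    case True
    have letters: "x \<in> F True \<or> x \<in> F False" if "x \<in> K" for x
    proof -
      have "x \<in> core \<or> (\<exists>n s t. reduced_word n s t x)" using that Suc.prems(2) generate_cases by blast
      then show ?thesis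
      proof (elim disjE exE)
        fix m s t assume w: "reduced_word m s t x"
        then have "m \<le> 1" using Suc.prems(3) that True by fastforce
        then show ?thesis using reduced_word_1[OF w] by (cases s) auto
      qed auto
    qed
    \<comment> \<open>A group is not the union of two proper subgroups: the product of two witnesses
      would be a reduced word of length 2.\<close>
    have "K \<subseteq> F True \<or> K \<subseteq> F False"
    proof (rule ccontr)
      assume "\<not> ?thesis"
      then obtain x y where xy: "x \<in> K" "x \<notin> F True" "y \<in> K" "y \<notin> F False" by blast
      then have "x \<in> F False - core" "y \<in> F True - core" using letters by auto
      then have "reduced_word 2 False True (x \<otimes> y)"
        using Cons[of x False 1 True y] letter[of y True] xy by (simp add: numeral_2_eq_2)
      moreover have "x \<otimes> y \<in> K" using xy subgroup.m_closed[OF K] by blast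
      ultimately show False using Suc.prems(3) True by fastforce
    qed
    moreover have "inv \<one> \<otimes> x \<otimes> \<one> = x" if "x \<in> K" for x using KG[OF that] by simp
    ultimately have "\<exists>s. \<forall>x\<in>K. inv \<one> \<otimes> x \<otimes> \<one> \<in> F s" by (metis subsetD)
    then show ?thesis using generate.one by blast
  next
    case n: False
    show ?thesis
    proof (cases "\<exists>s t w. w \<in> K \<and> reduced_word (Suc n) s t w")
      case False
      have "m \<le> n" if "w \<in> K" "reduced_word m s t w" for m s t w
        using that Suc.prems(3)[OF that] False le_SucE by blast
      then show ?thesis using Suc.IH[OF K Suc.prems(2)] by blast
    next
      case True
      then obtain s t g where g: "g \<in> K" "reduced_word (Suc n) s t g" by blast
      \<comment> \<open>With different end factors \<open>g\<close> could be multiplied by itself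
        without cancellation, doubling the length beyond the bound; so both ends of \<open>g\<close>
        lie in \<open>F s\<close>.\<close>
      have "reduced_word (Suc n + Suc n) s t (g \<otimes> g)" if "t \<noteq> s"
        using that reduced_word_append[OF g(2), of "Suc n" t g] g by auto
      then have ts: "t = s" using Suc.prems(3)[OF subgroup.m_closed[OF K g(1) g(1)]] by fastforce
      have len: "1 < Suc n" using n by simp
      obtain a g1 where a: "a \<in> F s - core" "reduced_word n (\<not> s) s g1" "g = a \<otimes> g1"
        using reduced_word_uncons[OF g(2)[unfolded ts] len] unfolding diff_Suc_1 .
      obtain z g2 where z: "z \<in> F s - core" "reduced_word n s (\<not> s) g2" "g = g2 \<otimes> z"
        using reduced_word_unsnoc[OF g(2)[unfolded ts] len] unfolding diff_Suc_1 .
      note cl = reduced_word_closed[OF a(2)] reduced_word_closed[OF z(2)] KG[OF g(1)]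
      have ac: "a \<in> carrier G" "z \<in> carrier G" using a z by auto
      \<comment> \<open>In \<open>g \<otimes> g\<close> the last letter \<open>z\<close> meets the
        first letter \<open>a\<close>. Unless they cancel into the core, the square has
        \<open>2 * n + 1\<close> letters, more than \<open>n + 1\<close>.\<close>
      have za: "z \<otimes> a \<in> core"
      proof (rule ccontr)
        assume "z \<otimes> a \<notin> core"
        then have "z \<otimes> a \<in> F s - core" using a z factor_mult by blast
        then have "reduced_word (Suc (n + n)) s s (g2 \<otimes> ((z \<otimes> a) \<otimes> g1))"
          using reduced_word_append[OF z(2), of "Suc n" s "(z \<otimes> a) \<otimes> g1"] Cons[of "z \<otimes> a" s n s g1] a by simp
        moreover have "g2 \<otimes> ((z \<otimes> a) \<otimes> g1) = (g2 \<otimes> z) \<otimes> (a \<otimes> g1)"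
          using cl(1,2) ac by (simp add: m_assoc)
        ultimately have "reduced_word (Suc (n + n)) s s (g \<otimes> g)" using a(3) z(3) by metis
        then have "Suc (n + n) \<le> Suc n" using Suc.prems(3) g subgroup.m_closed[OF K] by blast
        then show False using n by simp
      qed
      let ?K = "{inv a \<otimes> x \<otimes> a | x. x \<in> K}"
      have aG: "a \<in> generate G (F True \<union> F False)"
        using a by (intro generate.incl) (cases s; auto)
      have genG: "subgroup (generate G (F True \<union> F False)) G"
        by (rule generate_is_subgroup) auto
      have K': "subgroup ?K G" using subgroup_conj[OF K ac(1)] .
      have K'G: "?K \<subseteq> generate G (F True \<union> F False)"
      proof clarify
        fix x assume "x \<in> K"
        then show "inv a \<otimes> x \<otimes> a \<in> generate G (F True \<union> F False)"
          using Suc.prems(2) aG by (intro subgroup.m_closed[OF genG] subgroup.m_inv_closed[OF genG]) auto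
      qed
      have conj: "a \<otimes> w \<otimes> inv a \<in> K" if "w \<in> ?K" for w
      proof -
        from that obtain x where x: "x \<in> K" "w = inv a \<otimes> x \<otimes> a" by blast
        have "a \<otimes> (inv a \<otimes> x \<otimes> a) \<otimes> inv a = x"
          using KG[OF x(1)] ac
          by (simp add: m_assoc) (simp add: m_assoc[symmetric])
        then show ?thesis using x by simp
      qed
      \<comment> \<open>When conjugated back, a long element starting in the other factor gains the
        letter \<open>a\<close> on the left. On the right \<open>inv a\<close> is appended, merged
        or absorbed; in the last case the word ends in \<open>F (\<not> s)\<close>, and multiplying
        by \<open>g\<close> adds \<open>n + 1\<close> further letters.\<close>
      have start: False if w: "w \<in> ?K" "reduced_word m (\<not> s) r w" and m: "n < m" for w m r
      proof -
        have wc: "w \<in> carrier G" using reduced_word_closed[OF w(2)] .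
        have aw: "reduced_word (Suc m) s r (a \<otimes> w)" using Cons a(1) w(2) by blast
        have ia: "inv a \<in> F s - core" using core_compl_inv a by blast
        show False
        proof (cases "r = s")
          case False
          then have "reduced_word (Suc (Suc m)) s s (a \<otimes> w \<otimes> inv a)"
            using reduced_word_snoc[OF aw _ ia] by simp
          then show False using Suc.prems(3)[OF conj[OF w(1)]] m by fastforce
        next
          case True
          have "1 < Suc m" using m by simp
          from reduced_word_unsnoc[OF aw[unfolded True] this] obtain l v where
            l: "l \<in> F s - core" "reduced_word (Suc m - 1) s (\<not> s) v" "a \<otimes> w = v \<otimes> l" .
          then have lv: "reduced_word m s (\<not> s) v" by simp
          have vc: "v \<in> carrier G" using reduced_word_closed[OF l(2)] .
          have "l \<in> carrier G" using l(1) factor_closed by blast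
          then have eq: "a \<otimes> w \<otimes> inv a = v \<otimes> (l \<otimes> inv a)"
            using l(3) ac vc by (simp add: m_assoc)
          show False
          proof (cases "l \<otimes> inv a \<in> core")
            case False
            then have "l \<otimes> inv a \<in> F s - core" using l ia factor_mult by blast
            then have "reduced_word (Suc m) s s (a \<otimes> w \<otimes> inv a)"
              using reduced_word_snoc[OF lv refl] eq by simp
            then show False using Suc.prems(3)[OF conj[OF w(1)]] m by fastforce
          next
            case True
            then have "reduced_word m s (\<not> s) (a \<otimes> w \<otimes> inv a)"
              using reduced_word_core[OF _ lv] eq by simp
            then have "reduced_word (m + Suc n) s s (a \<otimes> w \<otimes> inv a \<otimes> g)"
              using reduced_word_append[of m s "\<not> s" _ "Suc n" s g] g ts by simp
            then have "m + Suc n \<le> Suc n"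
              using Suc.prems(3) conj[OF w(1)] g subgroup.m_closed[OF K] by blast
            then show False using m by simp
          qed
        qed
      qed
      \<comment> \<open>By \<open>start\<close> for \<open>w\<close> and its inverse, a word longer
        than \<open>n\<close> begins and ends in \<open>F s\<close>. Multiplying
        \<open>a \<otimes> w \<otimes> inv a\<close> by \<open>g\<close> on the left lets the core
        element \<open>z \<otimes> a\<close> sink into the letter \<open>b\<close>, and more than
        \<open>n + 1\<close> letters remain.\<close>
      have bound: "m \<le> n" if w: "w \<in> ?K" "reduced_word m p r w" for m p r w
      proof (rule ccontr)
        assume "\<not> m \<le> n" then have m: "n < m" by simp
        have wi: "inv w \<in> ?K" "reduced_word m r p (inv w)"
          using w subgroup.m_inv_closed[OF K'] reduced_word_inv by blast+
        have p: "p = s"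
        proof (rule ccontr)
          assume "p \<noteq> s"
          then have "p = (\<not> s)" by blast
          then show False using start[OF w(1) _ m] w(2) by blast
        qed
        have r: "r = s"
        proof (rule ccontr)
          assume "r \<noteq> s"
          then have "r = (\<not> s)" by blast
          then show False using start[OF wi(1) _ m] wi(2) by blast
        qed
        have "1 < m" using m n by simp
        from reduced_word_uncons[OF w(2)[unfolded p r] this] obtain b v where
          b: "b \<in> F s - core" "reduced_word (m - 1) (\<not> s) s v" "w = b \<otimes> v" .
        \<comment> \<open>A single letter has equal ends, while \<open>v\<close> starts in
          \<open>F (\<not> s)\<close> and ends in \<open>F s\<close>; hence \<open>w\<close> has at
          least three letters.\<close>
        have "m - 1 \<noteq> 1" using reduced_word_1[OF b(2)] by auto
        then have m3: "1 < m - 1" using \<open>1 < m\<close> by simp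
        from reduced_word_unsnoc[OF b(2) this] obtain l v' where
          l: "l \<in> F s - core" "reduced_word (m - 1 - 1) (\<not> s) (\<not> s) v'" "v = v' \<otimes> l" .
        have wc: "w \<in> carrier G" "b \<in> carrier G" "v \<in> carrier G" "v' \<in> carrier G" "l \<in> carrier G"
          using b l reduced_word_closed by auto
        have "z \<otimes> a \<otimes> b \<in> F s - core" using core_mult_left[OF za b(1)] .
        from reduced_word_snoc[OF z(2) refl this]
        have u: "reduced_word (Suc n + (m - 1 - 1)) s (\<not> s) (g2 \<otimes> (z \<otimes> a \<otimes> b) \<otimes> v')"
          using l(2) reduced_word_append by blast
        have eq: "g \<otimes> (a \<otimes> w \<otimes> inv a) = (g2 \<otimes> (z \<otimes> a \<otimes> b) \<otimes> v') \<otimes> (l \<otimes> inv a)"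
          using wc ac cl by (simp add: z(3) b(3) l(3) m_assoc)
        have inK: "g \<otimes> (a \<otimes> w \<otimes> inv a) \<in> K" using g conj[OF w(1)] subgroup.m_closed[OF K] by blast
        have ia: "inv a \<in> F s - core" using core_compl_inv a by blast
        show False
        proof (cases "l \<otimes> inv a \<in> core")
          case True
          then have "reduced_word (Suc n + (m - 1 - 1)) s (\<not> s) (g \<otimes> (a \<otimes> w \<otimes> inv a))"
            using reduced_word_core[OF True u] eq by simp
          then show False using Suc.prems(3)[OF inK] m3 by fastforce
        next
          case False
          then have "l \<otimes> inv a \<in> F s - core" using l ia factor_mult by blast
          then have "reduced_word (Suc (Suc n + (m - 1 - 1))) s s (g \<otimes> (a \<otimes> w \<otimes> inv a))"
            using reduced_word_snoc[OF u refl] eq by simp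
          then show False using Suc.prems(3)[OF inK] m3 by fastforce
        qed
      qed
      obtain b s' where
        b: "b \<in> generate G (F True \<union> F False)" "\<forall>x\<in>?K. inv b \<otimes> x \<otimes> b \<in> F s'"
        using Suc.IH[OF K' K'G] bound by blast
      have bc: "b \<in> carrier G" using subgroup.mem_carrier[OF genG b(1)] .
      have "inv (a \<otimes> b) \<otimes> x \<otimes> (a \<otimes> b) \<in> F s'" if "x \<in> K" for x
      proof -
        have "inv a \<otimes> x \<otimes> a \<in> ?K" using that by blast
        from bspec[OF b(2) this] have "inv b \<otimes> (inv a \<otimes> x \<otimes> a) \<otimes> b \<in> F s'" .
        then show ?thesis
          using ac(1) bc KG[OF that] by (simp add: inv_mult_group m_assoc)
      qed
      moreover have "a \<otimes> b \<in> generate G (F True \<union> F False)"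
        using aG b(1) by (rule generate.eng)
      ultimately show ?thesis by blast
    qed
  qed
qed

end

section \<open>Locally nilpotent derivations\<close>

locale derivation =
  fixes D :: "'a::{idom,ring_char_0} \<Rightarrow> 'a"
  assumes add: "D (a + b) = D a + D b"
    and mult: "D (a * b) = D a * b + a * D b"
begin

lemma zero [simp]: "D 0 = 0"
  using add[of 0 0] by simp

lemma iter_zero [simp]: "(D ^^ n) 0 = 0"
  by (induction n) auto

lemma iter_add: "(D ^^ n) (a + b) = (D ^^ n) a + (D ^^ n) b"
  by (induction n) (auto simp: add)

lemma iter_sum: "(D ^^ n) (\<Sum>i\<in>I. f i) = (\<Sum>i\<in>I. (D ^^ n) (f i))"
  by (induction I rule: infinite_finite_induct) (auto simp: iter_add)

lemma of_nat [simp]: "D (of_nat k) = 0"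
  using mult[of 1 1] by (induction k) (auto simp: add)

lemma leibniz: "(D ^^ n) (a * b) = (\<Sum>k\<le>n. of_nat (n choose k) * (D ^^ k) a * (D ^^ (n - k)) b)"
proof (induction n)
  case (Suc n)
  let ?t = "\<lambda>k l. (D ^^ k) a * (D ^^ l) b"
  have "(D ^^ Suc n) (a * b) = (\<Sum>k\<le>n. D (of_nat (n choose k) * ?t k (n - k)))"
    using iter_sum[of 1] by (simp add: Suc mult.assoc)
  also have "\<dots> = (\<Sum>k\<le>n. of_nat (n choose k) * ?t (Suc k) (n - k))
      + (\<Sum>k\<le>n. of_nat (n choose k) * ?t k (Suc (n - k)))"
    by (simp add: mult algebra_simps sum.distrib)
  also have "(\<Sum>k\<le>n. of_nat (n choose k) * ?t (Suc k) (n - k)) =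
      (\<Sum>k\<le>Suc n. (if k = 0 then 0 else of_nat (n choose (k - 1)) * ?t k (Suc n - k)))"
    by (subst sum.atMost_Suc_shift) simp
  also have "(\<Sum>k\<le>n. of_nat (n choose k) * ?t k (Suc (n - k))) =
      (\<Sum>k\<le>Suc n. of_nat (n choose k) * ?t k (Suc n - k))"
    by (simp add: Suc_diff_le)
  also have "(\<Sum>k\<le>Suc n. (if k = 0 then 0 else of_nat (n choose (k - 1)) * ?t k (Suc n - k))) +
      (\<Sum>k\<le>Suc n. of_nat (n choose k) * ?t k (Suc n - k)) =
      (\<Sum>k\<le>Suc n. of_nat (Suc n choose k) * ?t k (Suc n - k))"
    unfolding sum.distrib[symmetric]
  proof (rule sum.cong)
    fix k assume "k \<in> {..Suc n}"
    show "(if k = 0 then 0 else of_nat (n choose (k - 1)) * ?t k (Suc n - k)) +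
        of_nat (n choose k) * ?t k (Suc n - k) = of_nat (Suc n choose k) * ?t k (Suc n - k)"
      by (cases k) (auto simp: algebra_simps)
  qed simp
  finally show ?case by (simp add: mult.assoc)
qed simp

lemma power: "D (a ^ n) = of_nat n * a ^ (n - 1) * D a"
proof (induction n)
  case (Suc n)
  then show ?case by (cases n) (auto simp: mult algebra_simps)
qed (use of_nat[of 1] in simp)

lemma diff: "D (a - b) = D a - D b"
  using add[of "a - b" b] by (simp add: algebra_simps)

text \<open>Nilpotency is stated for single elements so that it can be spread from generators of an
  algebra by closure under sums and products.\<close>

definition nilp :: "'a \<Rightarrow> bool" where
  "nilp a \<longleftrightarrow> (\<exists>n. (D ^^ n) a = 0)"

lemma iter_zero_mono: "(D ^^ n) a = 0 \<Longrightarrow> n \<le> m \<Longrightarrow> (D ^^ m) a = 0"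
proof -
  assume "(D ^^ n) a = 0" "n \<le> m"
  then have "(D ^^ m) a = (D ^^ (m - n)) ((D ^^ n) a)"
    by (metis comp_apply funpow_add le_add_diff_inverse2)
  then show ?thesis using \<open>(D ^^ n) a = 0\<close> by simp
qed

lemma nilp_add: "nilp a \<Longrightarrow> nilp b \<Longrightarrow> nilp (a + b)"
proof -
  assume "nilp a" "nilp b"
  then obtain n m where "(D ^^ n) a = 0" "(D ^^ m) b = 0" unfolding nilp_def by blast
  then have "(D ^^ (n + m)) (a + b) = 0"
    unfolding iter_add using iter_zero_mono[of n a "n + m"] iter_zero_mono[of m b "n + m"] by simp
  then show ?thesis unfolding nilp_def by blast
qed

lemma nilp_mult: "nilp a \<Longrightarrow> nilp b \<Longrightarrow> nilp (a * b)"
proof -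
  assume "nilp a" "nilp b"
  then obtain n m where nm: "(D ^^ n) a = 0" "(D ^^ m) b = 0" unfolding nilp_def by blast
  have "of_nat (n + m choose k) * (D ^^ k) a * (D ^^ (n + m - k)) b = 0" for k
    using nm iter_zero_mono[of n a k] iter_zero_mono[of m b "n + m - k"] by (cases "n \<le> k") auto
  then have "(D ^^ (n + m)) (a * b) = 0"
    unfolding leibniz by (intro sum.neutral) blast
  then show ?thesis unfolding nilp_def by blast
qed

end

locale locally_nilpotent = derivation +
  assumes nilpotent: "nilp a"
begin

text \<open>The degree in \<open>t\<close> of the polynomial \<open>exp (t D) a\<close>. Its value
  at 0 is 0, which is why additivity is stated for nonzero arguments.\<close>

definition deg :: "'a \<Rightarrow> nat" where
  "deg a = (LEAST n. (D ^^ Suc n) a = 0)"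

lemma iter_Suc_deg: "(D ^^ Suc (deg a)) a = 0"
proof -
  obtain n where "(D ^^ n) a = 0" using nilpotent unfolding nilp_def by blast
  then have "(D ^^ Suc n) a = 0" by simp
  then show ?thesis unfolding deg_def by (rule LeastI)
qed

lemma iter_deg: "a \<noteq> 0 \<Longrightarrow> (D ^^ deg a) a \<noteq> 0"
  using not_less_Least[of "deg a - 1" "\<lambda>n. (D ^^ Suc n) a = 0"]
  by (cases "deg a") (auto simp: deg_def)

lemma deg_eqI: "(D ^^ n) a \<noteq> 0 \<Longrightarrow> (D ^^ Suc n) a = 0 \<Longrightarrow> deg a = n"
  unfolding deg_def by (rule Least_equality) (use iter_zero_mono[of _ a n] not_less_eq_eq in blast)+

text \<open>In the Leibniz formula of order \<open>deg a + deg b\<close> only the term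
  \<open>k = deg a\<close> survives, with a binomial coefficient that is nonzero in characteristic
  0; one order higher nothing survives.\<close>

lemma deg_mult:
  assumes "a \<noteq> 0" "b \<noteq> 0" shows "deg (a * b) = deg a + deg b"
proof (rule deg_eqI)
  let ?n = "deg a + deg b"
  have a: "(D ^^ k) a = 0" if "deg a < k" for k
    using iter_zero_mono[OF iter_Suc_deg[of a], of k] that by simp
  have b: "(D ^^ k) b = 0" if "deg b < k" for k
    using iter_zero_mono[OF iter_Suc_deg[of b], of k] that by simp
  have "of_nat (?n choose k) * (D ^^ k) a * (D ^^ (?n - k)) b =
     (if k = deg a then of_nat (?n choose deg a) * (D ^^ deg a) a * (D ^^ deg b) b else 0)"
     if "k \<le> ?n" for k
    using a[of k] b[of "?n - k"] that by (cases k "deg a" rule: linorder_cases) auto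
  then have "(D ^^ ?n) (a * b) = of_nat (?n choose deg a) * (D ^^ deg a) a * (D ^^ deg b) b"
    unfolding leibniz by (simp add: sum.delta)
  then show "(D ^^ ?n) (a * b) \<noteq> 0"
    using iter_deg assms by (simp add: binomial_eq_0_iff)
  have "of_nat (Suc ?n choose k) * (D ^^ k) a * (D ^^ (Suc ?n - k)) b = 0" for k
    using a[of k] b[of "Suc ?n - k"] by (cases "deg a < k") auto
  then show "(D ^^ Suc ?n) (a * b) = 0"
    unfolding leibniz by (intro sum.neutral) blast
qed

lemma deg_eq_0_iff: "deg a = 0 \<longleftrightarrow> D a = 0"
  using iter_Suc_deg[of a] deg_eqI[of 0 a] by (cases "a = 0") (auto simp: deg_def)

lemma deg_D: "D a \<noteq> 0 \<Longrightarrow> deg (D a) = deg a - 1"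
proof (rule deg_eqI)
  assume "D a \<noteq> 0"
  then have "deg a = Suc (deg a - 1)" using deg_eq_0_iff[of a] by simp
  moreover have "a \<noteq> 0" using \<open>D a \<noteq> 0\<close> by auto
  ultimately show "(D ^^ (deg a - 1)) (D a) \<noteq> 0" "(D ^^ Suc (deg a - 1)) (D a) = 0"
    using iter_deg[of a] iter_Suc_deg[of a] by (metis comp_apply funpow_Suc_right)+
qed

lemma deg_one [simp]: "deg 1 = 0"
  using deg_mult[of 1 1] by simp

lemma deg_power: "a \<noteq> 0 \<Longrightarrow> deg (a ^ n) = n * deg a"
  by (induction n) (auto simp: deg_mult)

text \<open>Degrees are natural numbers that add up to 0: the kernel is factorially closed.\<close>

lemma kernel_factor: "D (a * b) = 0 \<Longrightarrow> a * b \<noteq> 0 \<Longrightarrow> D a = 0"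
  using deg_mult[of a b] by (simp add: deg_eq_0_iff[symmetric])

lemma kernel_power: "D (a ^ n) = 0 \<Longrightarrow> 0 < n \<Longrightarrow> D a = 0"
  using deg_power[of a n] by (cases "a = 0") (auto simp: deg_eq_0_iff[symmetric])

end

section \<open>Polynomials in two variables and weighted degrees\<close>

text \<open>A polynomial in \<open>x\<close> and \<open>y\<close> is a polynomial in \<open>x\<close> over the polynomials in \<open>y\<close>.\<close>

definition cf :: "'a::zero poly poly \<Rightarrow> nat \<Rightarrow> nat \<Rightarrow> 'a" where
  "cf p i j = coeff (coeff p i) j"

definition supp :: "'a::zero poly poly \<Rightarrow> (nat \<times> nat) set" where
  "supp p = {(i, j). cf p i j \<noteq> 0}"

abbreviation bconst :: "'a::zero \<Rightarrow> 'a poly poly" where "bconst c \<equiv> [:[:c:]:]"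
abbreviation X :: "'a::comm_semiring_1 poly poly" where "X \<equiv> [:0, 1:]"
abbreviation Y :: "'a::comm_semiring_1 poly poly" where "Y \<equiv> [:[:0, 1:]:]"

lemma cf_eqI: "(\<And>i j. cf p i j = cf q i j) \<Longrightarrow> p = q"
  unfolding cf_def by (intro poly_eqI) blast

lemma cf_simps [simp]:
  "cf 0 i j = 0" "cf (p + q) i j = cf p i j + cf q i j"
  "cf (- r) i j = - cf r i j" "cf (r - s) i j = cf r i j - cf s i j"
  for p q :: "'a::comm_monoid_add poly poly" and r s :: "'b::ab_group_add poly poly"
  by (auto simp: cf_def)

lemma cf_mult: "cf (p * q) i j = (\<Sum>k\<le>i. \<Sum>l\<le>j. cf p k l * cf q (i - k) (j - l))"
  by (simp add: cf_def coeff_mult coeff_sum)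

lemma in_supp: "(i, j) \<in> supp p \<longleftrightarrow> cf p i j \<noteq> 0"
  by (simp add: supp_def)

lemma supp_eq_empty: "supp p = {} \<longleftrightarrow> p = 0"
  by (auto simp: supp_def intro!: cf_eqI)

lemma supp_add: "supp (p + q) \<subseteq> supp p \<union> supp (q :: 'a::comm_monoid_add poly poly)"
  by (auto simp: supp_def)

lemma supp_minus: "supp (- p) = supp (p :: 'a::ab_group_add poly poly)"
  by (auto simp: supp_def)

lemma supp_diff: "supp (p - q) \<subseteq> supp p \<union> supp (q :: 'a::ab_group_add poly poly)"
  by (auto simp: supp_def)

lemma supp_multE:
  assumes "(i, j) \<in> supp (p * q)"
  obtains i1 j1 i2 j2 where "i = i1 + i2" "j = j1 + j2" "(i1, j1) \<in> supp p" "(i2, j2) \<in> supp q"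
proof -
  from assms obtain k where k: "k \<le> i" "(\<Sum>l\<le>j. cf p k l * cf q (i - k) (j - l)) \<noteq> 0"
    unfolding in_supp cf_mult by (metis (lifting) sum.neutral atMost_iff)
  then obtain l where "l \<le> j" "cf p k l * cf q (i - k) (j - l) \<noteq> 0"
    by (metis (lifting) sum.neutral atMost_iff)
  then show thesis using that[of k "i - k" l "j - l"] k unfolding in_supp
    by (metis le_add_diff_inverse mult_zero_left mult_zero_right)
qed

lemma finite_supp: "finite (supp p)"
proof (rule finite_subset)
  show "supp p \<subseteq> (\<Union>i\<in>{..degree p}. {i} \<times> {..degree (coeff p i)})"
    by (force simp: supp_def cf_def intro: le_degree)
qed auto

lemma bconst_monom: "bconst a * X ^ i * Y ^ j = monom (monom a j) i"
proof -
  have "(Y :: 'a poly poly) ^ j = [:monom 1 j:]"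
    by (simp add: poly_const_pow monom_altdef)
  moreover have "(X :: 'a poly poly) ^ i = monom 1 i" by (simp add: monom_altdef)
  ultimately show ?thesis
    by (simp add: smult_monom mult_monom)
qed

lemma cf_monom [simp]: "cf (monom (monom a l) k) i j = (if i = k \<and> j = l then a else 0)"
  by (auto simp: cf_def)

lemma cf_bconst_mult [simp]: "cf (bconst a * p) i j = a * cf p i j"
  by (simp add: cf_def)

lemma bpoly_induct:
  assumes "\<And>a. P (bconst a)" "P X" "P Y" "\<And>p q. P p \<Longrightarrow> P q \<Longrightarrow> P (p + q)"
    "\<And>p q. P p \<Longrightarrow> P q \<Longrightarrow> P (p * q)"
  shows "P (p :: 'a::comm_ring_1 poly poly)"
proof -
  have c: "P [:c:]" for c
  proof (induction c)
    case 0
    then show ?case using assms(1)[of 0] by simp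
  next
    case (pCons a c)
    have "[:pCons a c:] = bconst a + Y * [:c:]" by simp
    then show ?case using assms pCons by metis
  qed
  show ?thesis
  proof (induction p)
    case 0
    then show ?case using assms(1)[of 0] by simp
  next
    case (pCons a p)
    have "pCons a p = [:a:] + X * p" by simp
    then show ?case using assms pCons c by metis
  qed
qed

definition part :: "(nat \<times> nat) set \<Rightarrow> 'a::comm_monoid_add poly poly \<Rightarrow> 'a poly poly" where
  "part S p = (\<Sum>(i, j)\<in>supp p \<inter> S. monom (monom (cf p i j) j) i)"

lemma cf_sum: "cf (\<Sum>x\<in>A. f x) i j = (\<Sum>x\<in>A. cf (f x) i j)"
  by (simp add: cf_def coeff_sum)

lemma cf_part: "cf (part S p) i j = (if (i, j) \<in> S then cf p i j else 0)"
proof -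
  have "cf (part S p) i j = (\<Sum>x\<in>supp p \<inter> S. if x = (i, j) then cf p i j else 0)"
    unfolding part_def cf_sum by (intro sum.cong) (auto split: if_splits)
  then show ?thesis using finite_supp[of p] by (auto simp: in_supp)
qed

definition degx :: "'a::zero poly poly \<Rightarrow> nat" where "degx p = Max (insert 0 (fst ` supp p))"
definition degy :: "'a::zero poly poly \<Rightarrow> nat" where "degy p = Max (insert 0 (snd ` supp p))"

lemma le_degx: "(i, j) \<in> supp p \<Longrightarrow> i \<le> degx p"
  unfolding degx_def using finite_supp[of p] by (intro Max_ge) force+

lemma le_degy: "(i, j) \<in> supp p \<Longrightarrow> j \<le> degy p"
  unfolding degy_def using finite_supp[of p] by (intro Max_ge) force+

lemma degx_attained: "0 < degx p \<Longrightarrow> \<exists>j. (degx p, j) \<in> supp p"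
  unfolding degx_def using finite_supp[of p] Max_in[of "insert 0 (fst ` supp p)"] by fastforce

lemma degy_attained: "0 < degy p \<Longrightarrow> \<exists>i. (i, degy p) \<in> supp p"
  unfolding degy_def using finite_supp[of p] Max_in[of "insert 0 (snd ` supp p)"] by fastforce

section \<open>Partial derivatives, the Jacobian derivation and weights\<close>

definition dx :: "'a::{idom,ring_char_0} poly poly \<Rightarrow> 'a poly poly" where "dx = pderiv"
definition dy :: "'a::{idom,ring_char_0} poly poly \<Rightarrow> 'a poly poly" where "dy = map_poly pderiv"

lemma cf_dx: "cf (dx p) i j = of_nat (Suc i) * cf p (Suc i) j"
  unfolding dx_def cf_def coeff_pderiv of_nat_poly by simp

lemma cf_dy: "cf (dy p) i j = of_nat (Suc j) * cf p i (Suc j)"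
  by (simp add: dy_def cf_def coeff_map_poly coeff_pderiv del: of_nat_Suc)

lemma derivation_dx: "derivation dx"
  by standard (auto simp: dx_def pderiv_add pderiv_mult algebra_simps)

lemma coeff_dy: "coeff (dy p) i = pderiv (coeff p i)"
  by (simp add: dy_def coeff_map_poly)

lemma pderiv_sum: "pderiv (\<Sum>i\<in>I. f i) = (\<Sum>i\<in>I. pderiv (f i))"
  by (induction I rule: infinite_finite_induct) (auto simp: pderiv_add)

lemma derivation_dy: "derivation dy"
proof
  show "dy (p + q) = dy p + dy q" for p q :: "'a poly poly"
    by (rule poly_eqI) (simp add: coeff_dy pderiv_add)
  show "dy (p * q) = dy p * q + p * dy q" for p q :: "'a poly poly"
    by (rule poly_eqI)
      (simp add: coeff_dy coeff_mult pderiv_sum pderiv_mult sum.distrib[symmetric] add.commute mult.commute[of _ "pderiv _"])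
qed

interpretation dx: derivation dx by (rule derivation_dx)
interpretation dy: derivation dy by (rule derivation_dy)

lemma dx_simps [simp]: "dx (bconst a) = 0" "dx X = 1" "dx Y = 0"
  by (simp_all add: dx_def pderiv_pCons one_pCons)

lemma dy_simps [simp]: "dy (bconst a) = 0" "dy X = 0" "dy Y = 1"
  by (simp_all add: dy_def map_poly_pCons pderiv_pCons one_pCons)

text \<open>The Jacobian determinant, read as a derivation in the second argument that kills the
  first.\<close>

definition jac :: "'a::{idom,ring_char_0} poly poly \<Rightarrow> 'a poly poly \<Rightarrow> 'a poly poly" where
  "jac p q = dx p * dy q - dy p * dx q"

lemma derivation_jac: "derivation (jac p)"
  by standard (simp_all add: jac_def dx.add dx.mult dy.add dy.mult algebra_simps)

lemma jac_simps [simp]: "jac p (bconst a) = 0" "jac p X = - dy p" "jac p Y = dx p" "jac p p = 0"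
  by (simp_all add: jac_def)

text \<open>The bound is an integer because differentiation subtracts the weight of a variable,
  possibly passing below 0.\<close>

definition weight_le :: "nat \<Rightarrow> nat \<Rightarrow> int \<Rightarrow> 'a::zero poly poly \<Rightarrow> bool" where
  "weight_le a b t p \<longleftrightarrow> (\<forall>i j. (i, j) \<in> supp p \<longrightarrow> int (a * i + b * j) \<le> t)"

definition homogeneous :: "nat \<Rightarrow> nat \<Rightarrow> int \<Rightarrow> 'a::zero poly poly \<Rightarrow> bool" where
  "homogeneous a b t p \<longleftrightarrow> (\<forall>i j. (i, j) \<in> supp p \<longrightarrow> int (a * i + b * j) = t)"

lemma weight_le_mono: "weight_le a b s p \<Longrightarrow> s \<le> t \<Longrightarrow> weight_le a b t p"
  unfolding weight_le_def by (meson order_trans)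

lemma homogeneous_weight_le: "homogeneous a b t p \<Longrightarrow> weight_le a b t p"
  unfolding weight_le_def homogeneous_def by simp

lemma weight_le_add: "weight_le a b t p \<Longrightarrow> weight_le a b t q \<Longrightarrow> weight_le a b t (p + q :: 'a::comm_monoid_add poly poly)"
  unfolding weight_le_def using supp_add[of p q] by blast

lemma weight_le_diff: "weight_le a b t p \<Longrightarrow> weight_le a b t q \<Longrightarrow> weight_le a b t (p - q :: 'a::ab_group_add poly poly)"
  unfolding weight_le_def using supp_diff[of p q] by blast

lemma weight_le_mult:
  "weight_le a b s p \<Longrightarrow> weight_le a b t q \<Longrightarrow> weight_le a b (s + t) (p * q)"
  unfolding weight_le_def
proof (intro allI impI)
  fix i j
  assume p: "\<forall>i j. (i, j) \<in> supp p \<longrightarrow> int (a * i + b * j) \<le> s"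
    and q: "\<forall>i j. (i, j) \<in> supp q \<longrightarrow> int (a * i + b * j) \<le> t" and pq: "(i, j) \<in> supp (p * q)"
  obtain i1 j1 i2 j2 where ij: "i = i1 + i2" "j = j1 + j2" "(i1, j1) \<in> supp p" "(i2, j2) \<in> supp q"
    by (rule supp_multE[OF pq])
  then have "int (a * i1 + b * j1) \<le> s" "int (a * i2 + b * j2) \<le> t" using p q by blast+
  moreover have "int (a * i + b * j) = int (a * i1 + b * j1) + int (a * i2 + b * j2)"
    unfolding ij by (simp add: distrib_left)
  ultimately show "int (a * i + b * j) \<le> s + t" by linarith
qed

lemma homogeneous_diff: "homogeneous a b t p \<Longrightarrow> homogeneous a b t q \<Longrightarrow> homogeneous a b t (p - q :: 'a::ab_group_add poly poly)"
  unfolding homogeneous_def using supp_diff[of p q] by blast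

lemma homogeneous_mult:
  "homogeneous a b s p \<Longrightarrow> homogeneous a b t q \<Longrightarrow> homogeneous a b (s + t) (p * q)"
  unfolding homogeneous_def
proof (intro allI impI)
  fix i j
  assume p: "\<forall>i j. (i, j) \<in> supp p \<longrightarrow> int (a * i + b * j) = s"
    and q: "\<forall>i j. (i, j) \<in> supp q \<longrightarrow> int (a * i + b * j) = t" and pq: "(i, j) \<in> supp (p * q)"
  obtain i1 j1 i2 j2 where ij: "i = i1 + i2" "j = j1 + j2" "(i1, j1) \<in> supp p" "(i2, j2) \<in> supp q"
    by (rule supp_multE[OF pq])
  then have "int (a * i1 + b * j1) = s" "int (a * i2 + b * j2) = t" using p q by blast+
  moreover have "int (a * i + b * j) = int (a * i1 + b * j1) + int (a * i2 + b * j2)"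
    unfolding ij by (simp add: distrib_left)
  ultimately show "int (a * i + b * j) = s + t" by linarith
qed

lemma supp_dx: "(i, j) \<in> supp (dx p) \<Longrightarrow> (Suc i, j) \<in> supp p"
  by (simp add: in_supp cf_dx)

lemma supp_dy: "(i, j) \<in> supp (dy p) \<Longrightarrow> (i, Suc j) \<in> supp p"
  by (simp add: in_supp cf_dy)

lemma weight_le_dx: "weight_le a b t p \<Longrightarrow> weight_le a b (t - a) (dx p)"
  unfolding weight_le_def using supp_dx by fastforce

lemma weight_le_dy: "weight_le a b t p \<Longrightarrow> weight_le a b (t - b) (dy p)"
  unfolding weight_le_def using supp_dy by fastforce

lemma homogeneous_dx: "homogeneous a b t p \<Longrightarrow> homogeneous a b (t - a) (dx p)"
  unfolding homogeneous_def using supp_dx by fastforce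

lemma homogeneous_dy: "homogeneous a b t p \<Longrightarrow> homogeneous a b (t - b) (dy p)"
  unfolding homogeneous_def using supp_dy by fastforce

lemma weight_le_jac:
  assumes "weight_le a b s p" "weight_le a b t q"
  shows "weight_le a b (s + t - a - b) (jac p q)"
  using weight_le_diff[OF weight_le_mult[OF weight_le_dx[OF assms(1)] weight_le_dy[OF assms(2)]]
    weight_le_mult[OF weight_le_dy[OF assms(1)] weight_le_dx[OF assms(2)],
      THEN weight_le_mono[of _ _ _ _ "s - a + (t - b)"]]]
  by (simp add: jac_def algebra_simps)

lemma homogeneous_jac:
  assumes "homogeneous a b s p" "homogeneous a b t q"
  shows "homogeneous a b (s + t - a - b) (jac p q)"
proof -
  have "homogeneous a b (s - a + (t - b)) (dx p * dy q)" "homogeneous a b (s - b + (t - a)) (dy p * dx q)"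
    by (intro homogeneous_mult homogeneous_dx homogeneous_dy assms)+
  then show ?thesis
    unfolding jac_def by (intro homogeneous_diff) (simp_all add: algebra_simps)
qed

text \<open>The iterates of \<open>jac P\<close> on a homogeneous polynomial have the iterates of \<open>jac P0\<close> as their
  leading parts.\<close>

lemma locally_nilpotent_leading_part:
  fixes P0 P1 :: "'a::{idom,ring_char_0} poly poly"
  assumes lnd: "locally_nilpotent (jac (P0 + P1))"
    and P0: "homogeneous a b t P0" and P1: "weight_le a b (t - 1) P1"
  shows "locally_nilpotent (jac P0)"
proof -
  interpret P: locally_nilpotent "jac (P0 + P1)" by (rule lnd)
  interpret P0: derivation "jac P0" by (rule derivation_jac)
  have split: "jac (P0 + P1) f = jac P0 f + jac P1 f" for f
    by (simp add: jac_def dx.add dy.add algebra_simps)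
  have nil: "P0.nilp f" if f: "homogeneous a b s f" for f s
  proof -
    let ?s = "\<lambda>n. s + int n * (t - a - b)"
    have "homogeneous a b (?s n) ((jac P0 ^^ n) f) \<and>
        weight_le a b (?s n - 1) ((jac (P0 + P1) ^^ n) f - (jac P0 ^^ n) f)" for n
    proof (induction n)
      case 0
      then show ?case using f by (simp add: weight_le_def supp_def)
    next
      case (Suc n)
      let ?g = "(jac P0 ^^ n) f" and ?h = "(jac (P0 + P1) ^^ n) f"
      have eq: "?s (Suc n) = t + ?s n - a - b" by (simp add: algebra_simps)
      have g: "homogeneous a b (?s n) ?g" and hg: "weight_le a b (?s n - 1) (?h - ?g)"
        using Suc by blast+
      have "homogeneous a b (?s (Suc n)) (jac P0 ?g)"
        unfolding eq by (rule homogeneous_jac[OF P0 g])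
      moreover have "weight_le a b (?s (Suc n) - 1) (jac (P0 + P1) ?h - jac P0 ?g)"
      proof -
        have "jac (P0 + P1) ?h - jac P0 ?g = jac P0 (?h - ?g) + (jac P1 (?h - ?g) + jac P1 ?g)"
          by (simp add: split derivation.diff[OF derivation_jac])
        moreover have "weight_le a b (?s (Suc n) - 1) (jac P0 (?h - ?g))"
          using weight_le_jac[OF homogeneous_weight_le[OF P0] hg] by (simp add: eq algebra_simps)
        moreover have "weight_le a b (?s (Suc n) - 1) (jac P1 (?h - ?g))"
          using weight_le_jac[OF P1 hg] by (rule weight_le_mono) (simp add: algebra_simps)
        moreover have "weight_le a b (?s (Suc n) - 1) (jac P1 ?g)"
          using weight_le_jac[OF P1 homogeneous_weight_le[OF g]] by (simp add: algebra_simps)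
        ultimately show ?thesis by (simp add: weight_le_add)
      qed
      ultimately show ?case by simp
    qed
    moreover obtain n where n: "(jac (P0 + P1) ^^ n) f = 0"
      using P.nilpotent unfolding P.nilp_def by blast
    ultimately have *: "homogeneous a b (?s n) ((jac P0 ^^ n) f)"
        "weight_le a b (?s n - 1) (0 - (jac P0 ^^ n) f)"
      by metis+
    \<comment> \<open>Once the iterate of the full derivation is 0, the leading iterate is
      homogeneous of one weight and at the same time bounded by a smaller one, so it has no
      monomials.\<close>
    have "supp ((jac P0 ^^ n) f) = {}"
    proof (rule ccontr)
      assume "supp ((jac P0 ^^ n) f) \<noteq> {}"
      then obtain i j where "(i, j) \<in> supp ((jac P0 ^^ n) f)" by auto
      then show False using * unfolding homogeneous_def weight_le_def
        by (simp add: supp_minus)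
    qed
    then show ?thesis unfolding P0.nilp_def supp_eq_empty by blast
  qed
  show ?thesis
  proof
    fix f :: "'a poly poly"
    show "P0.nilp f"
    \<comment> \<open>A general polynomial is not homogeneous; nilpotency spreads from the
      homogeneous generators \<open>X\<close> and \<open>Y\<close>.\<close>
    proof (induction f rule: bpoly_induct)
      case (1 c)
      have "(jac P0 ^^ 1) (bconst c) = 0" by simp
      then show ?case unfolding P0.nilp_def by blast
    next
      case 2
      show ?case by (rule nil[of a]) (auto simp: homogeneous_def supp_def cf_def coeff_pCons split: nat.splits)
    next
      case 3
      show ?case by (rule nil[of b]) (auto simp: homogeneous_def supp_def cf_def coeff_pCons split: nat.splits)
    next
      case (4 p q)
      then show ?case by (rule P0.nilp_add)
    next
      case (5 p q)
      then show ?case by (rule P0.nilp_mult)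
    qed
  qed
qed

section \<open>The Newton polygon of a coordinate\<close>

lemma bconst_monomial_nonzero: "a \<noteq> 0 \<Longrightarrow> (bconst a * X ^ i * Y ^ j = (0::'a::{idom,ring_char_0} poly poly)) \<longleftrightarrow> False"
  unfolding bconst_monom by simp

lemma split_leading_part:
  fixes P :: "'a::{idom,ring_char_0} poly poly"
  assumes "locally_nilpotent (jac P)" "weight_le a b t P"
  shows "locally_nilpotent (jac (part {(i, j). int (a * i + b * j) = t} P))" (is "locally_nilpotent (jac ?P0)")
proof (rule locally_nilpotent_leading_part)
  show "locally_nilpotent (jac (?P0 + (P - ?P0)))" using assms(1) by simp
  show "homogeneous a b t ?P0" by (auto simp: homogeneous_def in_supp cf_part)
  have "int (a * i + b * j) \<le> t - 1" if "(i, j) \<in> supp (P - ?P0)" for i j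
  proof -
    have "(i, j) \<in> supp P" "int (a * i + b * j) \<noteq> t"
      using that by (auto simp: in_supp cf_part split: if_splits)
    then show ?thesis using assms(2) unfolding weight_le_def by force
  qed
  then show "weight_le a b (t - 1) (P - ?P0)" unfolding weight_le_def by blast
qed

text \<open>The leading form is a monomial killed by its own Jacobian derivation. If it contained
  both variables, its divisor \<open>X\<close> would lie in the kernel, yet the derivation sends
  \<open>X\<close> to minus the nonzero \<open>y\<close>-derivative of that monomial.\<close>

lemma monomial_vertex_on_axis:
  fixes P :: "'a::{idom,ring_char_0} poly poly"
  assumes lnd: "locally_nilpotent (jac P)" and v: "(i0, j0) \<in> supp P"
    and dom: "\<And>i j. (i, j) \<in> supp P \<Longrightarrow> (i, j) \<noteq> (i0, j0) \<Longrightarrow> a * i + b * j < a * i0 + b * j0"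
  shows "i0 = 0 \<or> j0 = 0"
proof (rule ccontr)
  assume "\<not> ?thesis"
  then have pos: "i0 > 0" "j0 > 0" by auto
  define t where "t = int (a * i0 + b * j0)"
  define P0 where "P0 = part {(i, j). int (a * i + b * j) = t} P"
  have "int (a * i + b * j) \<le> t" if "(i, j) \<in> supp P" for i j
    using dom[OF that] unfolding t_def by (cases "(i, j) = (i0, j0)") (auto simp del: of_nat_add of_nat_mult)
  then have "weight_le a b t P" unfolding weight_le_def by blast
  then interpret P0: locally_nilpotent "jac P0"
    unfolding P0_def by (rule split_leading_part[OF lnd])
  let ?c = "cf P i0 j0"
  have c: "?c \<noteq> 0" using v by (simp add: in_supp)
  have P0: "P0 = bconst ?c * X ^ i0 * Y ^ j0"
    unfolding bconst_monom
  proof (rule cf_eqI)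
    fix i j
    show "cf P0 i j = cf (monom (monom ?c j0) i0) i j"
      using dom[of i j] unfolding P0_def cf_part t_def cf_monom in_supp of_nat_eq_iff mem_Collect_eq prod.case
      by (cases "(i, j) = (i0, j0)"; cases "cf P i j = 0") auto
  qed
  also have "\<dots> = X * (bconst ?c * X ^ (i0 - 1) * Y ^ j0)"
    using pos by (cases i0) (auto simp: algebra_simps)
  finally have XP: "P0 = X * (bconst ?c * X ^ (i0 - 1) * Y ^ j0)" .
  have "P0 \<noteq> 0" using P0 bconst_monomial_nonzero[OF c] by simp
  then have "jac P0 X = 0"
    using P0.kernel_factor[of X "bconst ?c * X ^ (i0 - 1) * Y ^ j0"] XP by (metis jac_simps(4))
  then have "cf (dy P0) i0 (j0 - 1) = 0" by simp
  then have "of_nat j0 * cf P0 i0 j0 = 0" using pos by (simp add: cf_dy del: of_nat_Suc)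
  then show False using c pos unfolding P0 bconst_monom by simp
qed

text \<open>Every vertex of the Newton polygon singled out by natural weights lies on an axis, which
  confines the polygon to the triangle below the segment joining the two extreme points.\<close>

lemma newton_polygon_triangle:
  fixes P :: "'a::{idom,ring_char_0} poly poly"
  assumes lnd: "locally_nilpotent (jac P)" and pos: "0 < degx P" "0 < degy P"
  shows "(degx P, 0) \<in> supp P" "(0, degy P) \<in> supp P"
    and "\<And>i j. (i, j) \<in> supp P \<Longrightarrow> degy P * i + degx P * j \<le> degx P * degy P"
proof -
  let ?n = "degx P" and ?m = "degy P"
  note fin = finite_supp[of P]
  have fx: "finite {j. (?n, j) \<in> supp P}"
    using finite_subset[of "{j. (?n, j) \<in> supp P}" "snd ` supp P"] fin by force
  have fy: "finite {i. (i, ?m) \<in> supp P}"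
    using finite_subset[of "{i. (i, ?m) \<in> supp P}" "fst ` supp P"] fin by force
  define j0 where "j0 = Max {j. (?n, j) \<in> supp P}"
  have j0: "(?n, j0) \<in> supp P" using Max_in[OF fx] degx_attained[OF pos(1)] unfolding j0_def by blast
  have "?n = 0 \<or> j0 = 0"
  \<comment> \<open>As \<open>j \<le> ?m\<close> on the support, the weights \<open>Suc ?m\<close>
    and 1 order it lexicographically, first by \<open>i\<close>.\<close>
  proof (rule monomial_vertex_on_axis[OF lnd j0, of "Suc ?m" 1])
    fix i j assume ij: "(i, j) \<in> supp P" "(i, j) \<noteq> (?n, j0)"
    show "Suc ?m * i + 1 * j < Suc ?m * ?n + 1 * j0"
    proof (cases "i = ?n")
      case True
      then have "j \<le> j0" unfolding j0_def using ij fx by (intro Max_ge) auto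
      then show ?thesis using True ij by auto
    next
      case False
      then have "Suc i \<le> ?n" using le_degx[OF ij(1)] by simp
      from mult_le_mono2[OF this, of "Suc ?m"] show ?thesis using le_degy[OF ij(1)] by simp
    qed
  qed
  then show xs: "(?n, 0) \<in> supp P" using j0 pos by auto
  define i0 where "i0 = Max {i. (i, ?m) \<in> supp P}"
  have i0: "(i0, ?m) \<in> supp P" using Max_in[OF fy] degy_attained[OF pos(2)] unfolding i0_def by blast
  have "i0 = 0 \<or> ?m = 0"
  proof (rule monomial_vertex_on_axis[OF lnd i0, of 1 "Suc ?n"])
    fix i j assume ij: "(i, j) \<in> supp P" "(i, j) \<noteq> (i0, ?m)"
    show "1 * i + Suc ?n * j < 1 * i0 + Suc ?n * ?m"
    proof (cases "j = ?m")
      case True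
      then have "i \<le> i0" unfolding i0_def using ij fy by (intro Max_ge) auto
      then show ?thesis using True ij by auto
    next
      case False
      then have "Suc j \<le> ?m" using le_degy[OF ij(1)] by simp
      from mult_le_mono2[OF this, of "Suc ?n"] show ?thesis using le_degx[OF ij(1)] by simp
    qed
  qed
  then show ys: "(0, ?m) \<in> supp P" using i0 pos by auto
  show "?m * i + ?n * j \<le> ?n * ?m" if ij: "(i, j) \<in> supp P" for i j
  proof (rule ccontr)
    assume "\<not> ?thesis"
    then have big: "Suc (?n * ?m) \<le> ?m * i + ?n * j" by simp
    \<comment> \<open>This weight equals \<open>Suc ?n * (?m * i + ?n * j) + i\<close>: it compares
      heights with respect to the expected edge and breaks ties by \<open>i\<close>, which can be
      read off modulo \<open>Suc ?n\<close> because \<open>i \<le> ?n\<close>. The maximizer is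
      therefore unique, hence on an axis, where the height is at most
      \<open>?n * ?m\<close>.\<close>
    let ?w = "\<lambda>(i, j). (Suc ?n * ?m + 1) * i + Suc ?n * ?n * j"
    have "Max (?w ` supp P) \<in> ?w ` supp P" using fin ij by (intro Max_in) auto
    then obtain i1 j1 where v: "(i1, j1) \<in> supp P" and eq: "Max (?w ` supp P) = ?w (i1, j1)" by auto
    have max: "?w q \<le> ?w (i1, j1)" if "q \<in> supp P" for q
      unfolding eq[symmetric] using that fin by (intro Max_ge) auto
    have w: "?w (i, j) = Suc ?n * (?m * i + ?n * j) + i" for i j by (simp add: algebra_simps)
    have md: "(Suc ?n * x + i) mod Suc ?n = i" if "i \<le> ?n" for x i
      using that by (simp only: mod_mult_self4 mod_less less_Suc_eq_le)
    have "i1 = 0 \<or> j1 = 0"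
    proof (rule monomial_vertex_on_axis[OF lnd v, of "Suc ?n * ?m + 1" "Suc ?n * ?n"])
      fix i j assume ij: "(i, j) \<in> supp P" "(i, j) \<noteq> (i1, j1)"
      have "?w (i, j) \<noteq> ?w (i1, j1)"
      proof
        assume e: "?w (i, j) = ?w (i1, j1)"
        have "i = ?w (i, j) mod Suc ?n" "i1 = ?w (i1, j1) mod Suc ?n"
          unfolding w using md[OF le_degx[OF ij(1)]] md[OF le_degx[OF v]] by simp_all
        then have "i = i1" using e by simp
        then have "?m * i + ?n * j = ?m * i1 + ?n * j1" using e unfolding w by (simp del: mult_Suc)
        then have "?n * j = ?n * j1" using \<open>i = i1\<close> by simp
        then show False using ij \<open>i = i1\<close> pos by simp
      qed
      then show "(Suc ?n * ?m + 1) * i + Suc ?n * ?n * j < (Suc ?n * ?m + 1) * i1 + Suc ?n * ?n * j1"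
        using max[OF ij(1)] by simp
    qed
    moreover have "Suc ?n * Suc (?n * ?m) \<le> Suc ?n * (?m * i1 + ?n * j1) + i1"
      using max[OF ij] mult_le_mono2[OF big, of "Suc ?n"] unfolding w by linarith
    ultimately show False
    proof (elim disjE)
      assume a: "i1 = 0" "Suc ?n * Suc (?n * ?m) \<le> Suc ?n * (?m * i1 + ?n * j1) + i1"
      have "?n * j1 \<le> ?n * ?m" using le_degy[OF v] by simp
      from mult_le_mono2[OF this, of "Suc ?n"] show False using a by simp
    next
      assume a: "j1 = 0" "Suc ?n * Suc (?n * ?m) \<le> Suc ?n * (?m * i1 + ?n * j1) + i1"
      have i1: "i1 \<le> ?n" using le_degx[OF v] .
      then have "?m * i1 \<le> ?n * ?m" by (simp add: mult.commute)
      from mult_le_mono2[OF this, of "Suc ?n"] show False using a i1 by simp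
    qed
  qed
qed

text \<open>Roots of \<open>\<phi>\<close> are split off one at a time over the algebraically closed
  field. The sum is the homogenization of \<open>\<phi>\<close> in \<open>U\<close> and
  \<open>V\<close>, which later become \<open>X ^ p\<close> and \<open>Y ^ q\<close>.\<close>

lemma binary_form_factorization:
  fixes \<phi> :: "complex poly" and U V :: "complex poly poly"
  shows "\<exists>cs. length cs = degree \<phi> \<and>
    (\<Sum>l\<le>degree \<phi>. bconst (coeff \<phi> l) * U ^ l * V ^ (degree \<phi> - l)) =
      bconst (lead_coeff \<phi>) * (\<Prod>c\<leftarrow>cs. U - bconst c * V)"
proof (induction "degree \<phi>" arbitrary: \<phi>)
  case 0
  then show ?case by auto
next
  case (Suc k)
  then obtain c where "poly \<phi> c = 0"
    using fundamental_theorem_of_algebra constant_degree by (metis nat.distinct(1))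
  then obtain \<psi> where \<psi>: "\<phi> = [:- c, 1:] * \<psi>" by (metis poly_eq_0_iff_dvd dvdE)
  then have "\<psi> \<noteq> 0" using Suc(2) by auto
  then have deg: "degree \<phi> = Suc (degree \<psi>)" unfolding \<psi> by (subst degree_mult_eq) auto
  let ?f = "\<lambda>\<phi>. \<Sum>l\<le>degree \<phi>. bconst (coeff \<phi> l) * U ^ l * V ^ (degree \<phi> - l)"
  have k: "k = degree \<psi>" using Suc(2) deg by simp
  obtain cs where cs: "length cs = degree \<psi>" "?f \<psi> = bconst (lead_coeff \<psi>) * (\<Prod>c\<leftarrow>cs. U - bconst c * V)"
    using Suc(1)[OF k] by blast
  have c0: "coeff \<phi> 0 = - c * coeff \<psi> 0" and cS: "coeff \<phi> (Suc l) = coeff \<psi> l - c * coeff \<psi> (Suc l)" for l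
    unfolding \<psi> by (simp_all add: coeff_pCons)
  have "?f \<phi> = bconst (coeff \<phi> 0) * V ^ Suc k + (\<Sum>l\<le>k. bconst (coeff \<phi> (Suc l)) * U ^ Suc l * V ^ (k - l))"
    unfolding deg k[symmetric] by (subst sum.atMost_Suc_shift) simp
  also have "\<dots> = (\<Sum>l\<le>k. bconst (coeff \<psi> l) * U ^ Suc l * V ^ (k - l))
      - bconst c * (bconst (coeff \<psi> 0) * V ^ Suc k + (\<Sum>l\<le>k. bconst (coeff \<psi> (Suc l)) * U ^ Suc l * V ^ (k - l)))"
  proof -
    have "bconst (coeff \<phi> (Suc l)) * u = bconst (coeff \<psi> l) * u - bconst c * (bconst (coeff \<psi> (Suc l)) * u)" for l u
      by (simp add: cS smult_diff_left[symmetric] flip: diff_pCons)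
        (simp add: smult_diff_left)
    then have "(\<Sum>l\<le>k. bconst (coeff \<phi> (Suc l)) * (U ^ Suc l * V ^ (k - l))) =
        (\<Sum>l\<le>k. bconst (coeff \<psi> l) * (U ^ Suc l * V ^ (k - l))) -
        bconst c * (\<Sum>l\<le>k. bconst (coeff \<psi> (Suc l)) * (U ^ Suc l * V ^ (k - l)))"
      by (simp add: sum_subtractf sum_distrib_left del: mult_pCons_left mult_pCons_right)
    moreover have "bconst (coeff \<phi> 0) = - (bconst c * bconst (coeff \<psi> 0))"
      by (simp add: c0)
    ultimately show ?thesis by (simp only: mult.assoc) (simp add: algebra_simps del: mult_pCons_left mult_pCons_right)
  qed
  also have "bconst (coeff \<psi> 0) * V ^ Suc k + (\<Sum>l\<le>k. bconst (coeff \<psi> (Suc l)) * U ^ Suc l * V ^ (k - l)) =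
      (\<Sum>l\<le>Suc k. bconst (coeff \<psi> l) * U ^ l * V ^ (Suc k - l))"
    by (subst sum.atMost_Suc_shift) simp
  also have "\<dots> = (\<Sum>l\<le>k. bconst (coeff \<psi> l) * U ^ l * V ^ (Suc k - l))"
    by (simp add: k coeff_eq_0)
  also have "\<dots> = V * ?f \<psi>"
    unfolding sum_distrib_left k[symmetric] by (intro sum.cong) (auto simp: Suc_diff_le algebra_simps)
  also have "(\<Sum>l\<le>k. bconst (coeff \<psi> l) * U ^ Suc l * V ^ (k - l)) = U * ?f \<psi>"
    unfolding sum_distrib_left k[symmetric] by (intro sum.cong) (auto simp: algebra_simps)
  also have "U * ?f \<psi> - bconst c * (V * ?f \<psi>) = (U - bconst c * V) * ?f \<psi>"
    by (simp only: left_diff_distrib mult.assoc)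
  finally have *: "?f \<phi> = (U - bconst c * V) * ?f \<psi>" .
  have lc: "lead_coeff \<phi> = lead_coeff \<psi>" unfolding \<psi> lead_coeff_mult by simp
  have "?f \<phi> = bconst (lead_coeff \<phi>) * (\<Prod>c\<leftarrow>c # cs. U - bconst c * V)"
    unfolding * cs(2) lc by (simp only: list.map prod_list.Cons mult.left_commute)
  then show ?case using cs(1) deg by (metis length_Cons)
qed


lemma bconst_diff: "bconst (a - b) = bconst a - bconst b" by simp

lemma bconst_XY_power: "bconst a * (X ^ p) ^ l * (Y ^ q) ^ r = monom (monom a (q * r)) (p * l)"
  using bconst_monom[of a "p * l" "q * r"] by (simp only: power_mult)

lemma (in derivation) kernel_prod_list:
  assumes "locally_nilpotent D" "prod_list xs \<noteq> 0" "D (prod_list xs) = 0" "x \<in> set xs"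
  shows "D x = 0"
  using assms(2-4)
proof (induction xs)
  case (Cons y ys)
  interpret locally_nilpotent D by (rule assms(1))
  have "D y = 0" using kernel_factor[of y "prod_list ys"] Cons.prems by simp
  moreover have "D (prod_list ys) = 0"
    using kernel_factor[of "prod_list ys" y] Cons.prems by (simp add: mult.commute)
  ultimately show ?case using Cons by auto
qed simp

text \<open>The edge form is a product of factors \<open>X ^ p - bconst c * Y ^ q\<close>, each
  killed by the Jacobian derivation of the form because the kernel is factorially closed. Two values
  of \<open>c\<close> would put \<open>Y\<close> into the kernel, so all factors agree; comparing
  the degrees of \<open>X\<close> and \<open>Y\<close> under this derivation leaves
  \<open>p = 1\<close> or \<open>q = 1\<close>.\<close>

theorem newton_form:
  fixes P :: "complex poly poly"
  assumes lnd: "locally_nilpotent (jac P)" and pos: "0 < degx P" "0 < degy P"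
  obtains a c p q k P1 where "a \<noteq> 0" "c \<noteq> 0" "0 < k" "0 < p" "0 < q" "p = 1 \<or> q = 1"
    "degx P = p * k" "degy P = q * k" "P = bconst a * (X ^ p - bconst c * Y ^ q) ^ k + P1"
    "\<forall>i j. (i, j) \<in> supp P1 \<longrightarrow> degy P * i + degx P * j < degx P * degy P"
proof -
  define n m where "n = degx P" and "m = degy P"
  note nm = n_def[symmetric] m_def[symmetric]
  note tri = newton_polygon_triangle[OF lnd pos, unfolded nm]
  have pos: "0 < n" "0 < m" using pos nm by auto
  define k where "k = gcd n m"
  have k: "0 < k" using pos by (simp add: k_def)
  define p q where "p = n div k" and "q = m div k"
  have n: "n = p * k" and m: "m = q * k" by (simp_all add: p_def q_def k_def)
  have p: "0 < p" and q: "0 < q" using n m pos by auto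
  have pq: "coprime p q" unfolding p_def q_def k_def using pos by (intro div_gcd_coprime) simp
  have "int (m * i + n * j) \<le> int (n * m)" if "(i, j) \<in> supp P" for i j
    using tri(3)[OF that] by (simp del: of_nat_add of_nat_mult)
  then have wt: "weight_le m n (int (n * m)) P" unfolding weight_le_def by blast
  define P0 where "P0 = part {(i, j). int (m * i + n * j) = int (n * m)} P"
  interpret D0: locally_nilpotent "jac P0"
    unfolding P0_def by (rule split_leading_part[OF lnd wt])
  have cf0: "cf P0 i j = (if m * i + n * j = n * m then cf P i j else 0)" for i j
    unfolding P0_def cf_part mem_Collect_eq prod.case of_nat_eq_iff ..
  have cf0_n: "cf P0 n 0 \<noteq> 0" and cf0_m: "cf P0 0 m \<noteq> 0"
    using tri(1,2) by (simp_all add: cf0 in_supp)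
  \<comment> \<open>Since \<open>p\<close> and \<open>q\<close> are coprime, consecutive lattice
    points on the edge differ by \<open>(p, - q)\<close>.\<close>
  have lattice: "\<exists>l\<le>k. i = p * l \<and> j = q * (k - l)" if "m * i + n * j = n * m" for i j
  proof -
    have "k * (q * i + p * j) = k * (p * q * k)"
      using that unfolding n m by (simp add: algebra_simps)
    then have e: "q * i + p * j = p * q * k" using k by simp
    then have "p dvd q * i"
      by (metis dvd_add_left_iff dvd_triv_left mult.assoc)
    then have "p dvd i" using pq by (simp add: coprime_dvd_mult_right_iff)
    then obtain l where l: "i = p * l" by blast
    have "p * (q * l + j) = p * (q * k)" using e unfolding l by (simp add: algebra_simps)
    then have "q * l + j = q * k" using p by simp
    moreover from this have "l \<le> k" using q by (metis le_add1 mult_le_cancel1)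
    ultimately show ?thesis using l by (auto simp: diff_mult_distrib2)
  qed
  \<comment> \<open>The edge form, dehomogenized; the corner \<open>(n, 0)\<close> makes its degree
    exactly \<open>k\<close>.\<close>
  define \<phi> where "\<phi> = (\<Sum>l\<le>k. monom (cf P (p * l) (q * (k - l))) l)"
  have co: "coeff \<phi> l = (if l \<le> k then cf P (p * l) (q * (k - l)) else 0)" for l
    unfolding \<phi>_def by (simp add: coeff_sum)
  have deg: "degree \<phi> = k"
  proof (rule antisym)
    show "degree \<phi> \<le> k" by (rule degree_le) (simp add: co)
    show "k \<le> degree \<phi>" using tri(1) by (intro le_degree) (simp add: co in_supp n)
  qed
  let ?U = "X ^ p :: complex poly poly" and ?V = "Y ^ q :: complex poly poly"
  have P0_form: "P0 = (\<Sum>l\<le>k. bconst (coeff \<phi> l) * ?U ^ l * ?V ^ (k - l))"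
  proof (rule cf_eqI)
    fix i j
    have "cf (\<Sum>l\<le>k. bconst (coeff \<phi> l) * ?U ^ l * ?V ^ (k - l)) i j =
        (\<Sum>l\<le>k. if i = p * l \<and> j = q * (k - l) then coeff \<phi> l else 0)"
      unfolding bconst_XY_power cf_sum cf_monom ..
    also have "\<dots> = (if m * i + n * j = n * m then cf P i j else 0)"
    proof (cases "m * i + n * j = n * m")
      case True
      then obtain l where l: "l \<le> k" "i = p * l" "j = q * (k - l)" using lattice by blast
      have "(\<Sum>l'\<le>k. if i = p * l' \<and> j = q * (k - l') then coeff \<phi> l' else 0) =
          (\<Sum>l'\<le>k. if l' = l then coeff \<phi> l else 0)"
        using p l by (intro sum.cong) auto
      then show ?thesis using True l by (simp add: co)
    next
      case False
      have "m * (p * l) + n * (q * (k - l)) = n * m" if "l \<le> k" for l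
      proof -
        have "m * (p * l) + n * (q * (k - l)) = p * q * k * (l + (k - l))"
          unfolding n m by (simp only: distrib_left ac_simps)
        then show ?thesis using that unfolding n m by (simp add: ac_simps)
      qed
      then have "(\<Sum>l\<le>k. if i = p * l \<and> j = q * (k - l) then coeff \<phi> l else 0) = 0"
        using False by (intro sum.neutral) auto
      then show ?thesis using False by simp
    qed
    finally show "cf P0 i j = cf (\<Sum>l\<le>k. bconst (coeff \<phi> l) * ?U ^ l * ?V ^ (k - l)) i j"
      by (simp only: cf0)
  qed
  define a where "a = lead_coeff \<phi>"
  have a: "a \<noteq> 0" unfolding a_def using deg k by auto
  obtain cs where cs: "length cs = k" "P0 = bconst a * (\<Prod>c\<leftarrow>cs. ?U - bconst c * ?V)"
    using binary_form_factorization[of \<phi> ?U ?V] unfolding P0_form deg a_def by blast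
  have P0_nz: "P0 \<noteq> 0" using cf0_n by auto
  define c where "c = hd cs"
  have D0_factor: "jac P0 (?U - bconst b * ?V) = 0" if "b \<in> set cs" for b
  proof (rule D0.kernel_prod_list[OF D0.locally_nilpotent_axioms])
    let ?\<Pi> = "\<Prod>c\<leftarrow>cs. ?U - bconst c * ?V"
    have prod: "?\<Pi> * bconst a = P0" unfolding cs(2) by (rule mult.commute)
    then have "jac P0 (?\<Pi> * bconst a) = 0" "?\<Pi> * bconst a \<noteq> 0"
      using P0_nz by (simp_all only: jac_simps not_False_eq_True)
    then show "jac P0 ?\<Pi> = 0" by (rule D0.kernel_factor)
    show "?\<Pi> \<noteq> 0" using P0_nz unfolding prod[symmetric] by (simp only: mult_eq_0_iff) blast
  qed (use that in auto)
  have same: "b = c" if b: "b \<in> set cs" for b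
  proof (rule ccontr)
    assume bc: "b \<noteq> c"
    have c: "c \<in> set cs" unfolding c_def using b by (cases cs) auto
    have eq: "bconst (b - c) * ?V = (?U - bconst c * ?V) - (?U - bconst b * ?V)"
      unfolding bconst_diff left_diff_distrib by simp
    have "jac P0 (bconst (b - c) * ?V) = 0"
      unfolding eq
      using D0.diff[of "?U - bconst c * ?V" "?U - bconst b * ?V", unfolded D0_factor[OF b] D0_factor[OF c]]
      by (simp only: diff_self)
    then have "jac P0 (?V * bconst (b - c)) = 0" by (simp only: mult.commute)
    moreover have "?V * bconst (b - c) \<noteq> 0" using bc by simp
    ultimately have "jac P0 ?V = 0" by (rule D0.kernel_factor)
    \<comment> \<open>\<open>jac P0 Y\<close> is the \<open>x\<close>-derivative of
      \<open>P0\<close>, which is nonzero because of the corner \<open>(n, 0)\<close>.\<close>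
    then have "jac P0 Y = 0" using D0.kernel_power q by blast
    then have "cf (dx P0) (n - 1) 0 = 0" by simp
    then show False using cf0_n pos by (simp add: cf_dx del: of_nat_Suc)
  qed
  have "cs = replicate k c" using same cs(1) by (metis replicate_eqI)
  then have P0_eq: "P0 = bconst a * (?U - bconst c * ?V) ^ k"
    using cs(2) by (simp add: map_replicate prod_list_replicate)
  \<comment> \<open>With \<open>c = 0\<close> the form would be a multiple of \<open>X ^ n\<close>
    and miss the corner \<open>(0, m)\<close>.\<close>
  have c: "c \<noteq> 0"
  proof
    assume "c = 0"
    then have "P0 = bconst a * (X ^ p) ^ k * (Y ^ 0) ^ 0" using P0_eq by simp
    then show False using cf0_m p k pos by (simp only: bconst_XY_power cf_monom) simp
  qed
  let ?h = "?U - bconst c * ?V"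
  have h_nz: "?h \<noteq> 0"
  proof
    assume "?h = 0"
    then have "P0 = 0" unfolding P0_eq using k by (simp only: power_0_left) simp
    then show False using P0_nz by blast
  qed
  have deg_h: "D0.deg ?h = 0"
    using D0_factor[of c] cs(1) k unfolding c_def D0.deg_eq_0_iff by (cases cs) auto
  interpret dx: derivation "dx :: complex poly poly \<Rightarrow> _" by (rule derivation_dx)
  interpret dy: derivation "dy :: complex poly poly \<Rightarrow> _" by (rule derivation_dy)
  have deg_const: "D0.deg (bconst b) = 0" for b by (simp add: D0.deg_eq_0_iff)
  have deg_nat: "D0.deg (of_nat b) = 0" for b by (simp add: D0.deg_eq_0_iff)
  have dyP: "dy P0 = - (bconst (a * c) * of_nat (k * q) * ?h ^ (k - 1) * Y ^ (q - 1))"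
    unfolding P0_eq by (simp add: dy.mult dy.power dy.diff algebra_simps del: mult_pCons_left)
      (simp add: algebra_simps)
  have dxP: "dx P0 = bconst a * of_nat (k * p) * ?h ^ (k - 1) * X ^ (p - 1)"
    unfolding P0_eq by (simp add: dx.mult dx.power dx.diff algebra_simps del: mult_pCons_left)
      (simp add: algebra_simps)
  have nz: "(of_nat (k * q) :: complex poly poly) \<noteq> 0" "(of_nat (k * p) :: complex poly poly) \<noteq> 0"
    using k p q by (simp_all del: of_nat_mult)
  have X0: "X ^ b \<noteq> (0 :: complex poly poly)" and Y0: "Y ^ b \<noteq> (0 :: complex poly poly)" for b by simp_all
  \<comment> \<open>\<open>jac P0 X\<close> is a nonzero constant times a power of the kernel
    element \<open>?h\<close> times \<open>Y ^ (q - 1)\<close>, so only \<open>Y\<close> contributes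
    to its degree; on the other hand the derivation lowers the degree of \<open>X\<close> by
    1.\<close>
  have deg_X: "D0.deg X - 1 = (q - 1) * D0.deg Y" and DX: "jac P0 X \<noteq> 0"
  proof -
    have e: "jac P0 X = bconst (a * c) * of_nat (k * q) * ?h ^ (k - 1) * Y ^ (q - 1)"
      unfolding jac_simps dyP by (rule minus_minus)
    have nz': "bconst (a * c) \<noteq> 0" "?h ^ (k - 1) \<noteq> 0"
      using a c power_not_zero[OF h_nz, of "k - 1"] by simp_all
    show DX: "jac P0 X \<noteq> 0" unfolding e using nz nz' Y0 by (simp only: mult_eq_0_iff) blast
    have "D0.deg (jac P0 X) = (q - 1) * D0.deg Y"
      unfolding e using nz nz' Y0 h_nz
      by (simp only: D0.deg_mult mult_eq_0_iff simp_thms D0.deg_power deg_const deg_nat deg_h mult_0_right add_0_left) (simp add: D0.deg_power)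
    then show "D0.deg X - 1 = (q - 1) * D0.deg Y" using D0.deg_D[OF DX] by simp
  qed
  have deg_Y: "D0.deg Y - 1 = (p - 1) * D0.deg X" and DY: "jac P0 Y \<noteq> 0"
  proof -
    have e: "jac P0 Y = bconst a * of_nat (k * p) * ?h ^ (k - 1) * X ^ (p - 1)"
      unfolding jac_simps dxP by simp
    have nz': "bconst a \<noteq> 0" "?h ^ (k - 1) \<noteq> 0"
      using a power_not_zero[OF h_nz, of "k - 1"] by simp_all
    show DY: "jac P0 Y \<noteq> 0" unfolding e using nz nz' X0 by (simp only: mult_eq_0_iff) blast
    have "D0.deg (jac P0 Y) = (p - 1) * D0.deg X"
      unfolding e using nz nz' X0 h_nz
      by (simp only: D0.deg_mult mult_eq_0_iff simp_thms D0.deg_power deg_const deg_nat deg_h mult_0_right add_0_left) (simp add: D0.deg_power)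
    then show "D0.deg Y - 1 = (p - 1) * D0.deg X" using D0.deg_D[OF DY] by simp
  qed
  \<comment> \<open>If both exponents exceeded 1, each of the two degrees would be smaller than the
    other.\<close>
  have "p = 1 \<or> q = 1"
  proof (rule ccontr)
    assume "\<not> ?thesis"
    then have "1 \<le> p - 1" "1 \<le> q - 1" using p q by auto
    then have "D0.deg Y \<le> D0.deg X - 1" "D0.deg X \<le> D0.deg Y - 1"
      unfolding deg_X deg_Y by simp_all
    moreover have "0 < D0.deg X" using DX D0.deg_eq_0_iff by blast
    ultimately show False by simp
  qed
  moreover have "P = bconst a * ?h ^ k + (P - P0)" unfolding P0_eq by simp
  moreover have "m * i + n * j < n * m" if "(i, j) \<in> supp (P - P0)" for i j
  proof -
    have "(i, j) \<in> supp P" "m * i + n * j \<noteq> n * m"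
      using that by (auto simp: in_supp cf0 split: if_splits)
    then show ?thesis using tri(3) by force
  qed
  ultimately show thesis using that[OF a c k p q] n m unfolding nm by blast
qed

section \<open>Reduction of a polynomial automorphism\<close>

definition ev :: "complex poly poly \<Rightarrow> plane \<Rightarrow> complex" where
  "ev p = (\<lambda>(x, y). poly (poly p [:x:]) y)"

lemma ev_simps [simp]:
  "ev (p + q) z = ev p z + ev q z" "ev (p - q) z = ev p z - ev q z" "ev (- p) z = - ev p z"
  "ev (p * q) z = ev p z * ev q z" "ev (p ^ n) z = ev p z ^ n"
  "ev (bconst a) z = a" "ev X z = fst z" "ev Y z = snd z" "ev 0 z = 0" "ev 1 z = 1"
  by (cases z; simp add: ev_def poly_power)+

lemma ev_monom [simp]: "ev (monom (monom a j) i) (x, y) = a * x ^ i * y ^ j"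
  unfolding bconst_monom[symmetric] by (simp del: mult_pCons_left mult_pCons_right)

lemma ev_sum: "ev (\<Sum>i\<in>I. f i) z = (\<Sum>i\<in>I. ev (f i) z)"
  by (induction I rule: infinite_finite_induct) auto

lemma ev_in_plane_ring: "ev p \<in> plane_ring"
  unfolding plane_ring_def
proof (induction p rule: bpoly_induct)
  case (1 a)
  have "ev (bconst a) = (\<lambda>_. a)" by (rule ext) simp
  then show ?case by (simp only: function_algebra.const)
next
  case 2
  have "ev X = fst" by (rule ext) simp
  then show ?case by (simp add: function_algebra.gen)
next
  case 3
  have "ev Y = snd" by (rule ext) simp
  then show ?case by (simp add: function_algebra.gen)
next
  case (4 p q)
  have "ev (p + q) = (\<lambda>z. ev p z + ev q z)" by (rule ext) simp
  then show ?case using 4 by (simp add: function_algebra.add)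
next
  case (5 p q)
  have "ev (p * q) = (\<lambda>z. ev p z * ev q z)" by (rule ext) simp
  then show ?case using 5 by (simp add: function_algebra.mult)
qed

lemma plane_ring_ev: "F \<in> plane_ring \<longleftrightarrow> (\<exists>p. F = ev p)"
proof
  assume "F \<in> plane_ring"
  then show "\<exists>p. F = ev p"
    unfolding plane_ring_def
  proof (induction rule: function_algebra.induct)
    case (gen f)
    have "fst = ev X" "snd = ev Y" by (auto intro!: ext)
    then show ?case using gen by blast
  next
    case (const c)
    have "(\<lambda>_. c) = ev (bconst c)" by (auto intro!: ext)
    then show ?case by blast
  next
    case (add f g)
    then obtain p q where "f = ev p" "g = ev q" by blast
    then have "(\<lambda>x. f x + g x) = ev (p + q)" by (auto intro!: ext)
    then show ?case by blast
  next
    case (mult f g)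
    then obtain p q where "f = ev p" "g = ev q" by blast
    then have "(\<lambda>x. f x * g x) = ev (p * q)" by (auto intro!: ext)
    then show ?case by blast
  qed
qed (use ev_in_plane_ring in blast)

text \<open>A nonzero polynomial over the domain of polynomials in \<open>y\<close> has finitely
  many roots, while here all constants \<open>[:x:]\<close> are roots.\<close>

lemma ev_eq_0:
  assumes "\<And>z. ev p z = 0" shows "p = 0"
proof (rule ccontr)
  assume "p \<noteq> 0"
  then have "finite {s. poly p s = 0}" by (rule poly_roots_finite)
  moreover have "poly p [:x:] = 0" for x
    using assms[of "(x, _)"] by (simp add: ev_def poly_all_0_iff_0[symmetric])
  then have "range (\<lambda>x. [:x:]) \<subseteq> {s. poly p s = 0}" by auto
  moreover have "infinite (range (\<lambda>x::complex. [:x:]))"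
    by (subst finite_image_iff) (auto simp: inj_on_def infinite_UNIV_char_0)
  ultimately show False using finite_subset by blast
qed

lemma ev_inject: "ev p = ev q \<longleftrightarrow> p = q"
  using ev_eq_0[of "p - q"] by auto

text \<open>The exchange of the variables; it transfers statements proved for \<open>x\<close> to
  \<open>y\<close>.\<close>

definition sw :: "complex poly poly \<Rightarrow> complex poly poly" where
  "sw p = (\<Sum>(i, j)\<in>supp p. monom (monom (cf p i j) i) j)"

lemma cf_sw: "cf (sw p) i j = cf p j i"
proof -
  have "cf (sw p) i j = (\<Sum>x\<in>supp p. if x = (j, i) then cf p j i else 0)"
    unfolding sw_def cf_sum by (intro sum.cong) (auto split: if_splits)
  then show ?thesis using finite_supp[of p] by (auto simp: in_supp)
qed

lemma supp_sw: "(i, j) \<in> supp (sw p) \<longleftrightarrow> (j, i) \<in> supp p"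
  by (simp add: in_supp cf_sw)

lemma ev_expand: "ev p (x, y) = (\<Sum>(i, j)\<in>supp p. cf p i j * x ^ i * y ^ j)"
proof -
  have "p = part UNIV p" by (rule cf_eqI) (simp add: cf_part)
  then have "ev p (x, y) = ev (part UNIV p) (x, y)" by simp
  also have "\<dots> = (\<Sum>(i, j)\<in>supp p. cf p i j * x ^ i * y ^ j)"
    unfolding part_def ev_sum by (intro sum.cong) auto
  finally show ?thesis .
qed

lemma ev_sw: "ev (sw p) (x, y) = ev p (y, x)"
  unfolding ev_expand[of p] sw_def ev_sum by (intro sum.cong) auto

lemma degx_le: "(\<And>i j. (i, j) \<in> supp p \<Longrightarrow> i \<le> n) \<Longrightarrow> degx p \<le> n"
  unfolding degx_def using finite_supp[of p] by (subst Max_le_iff) auto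

lemma degy_le: "(\<And>i j. (i, j) \<in> supp p \<Longrightarrow> j \<le> n) \<Longrightarrow> degy p \<le> n"
  unfolding degy_def using finite_supp[of p] by (subst Max_le_iff) auto

lemma degx_sw: "degx (sw p) = degy p" and degy_sw: "degy (sw p) = degx p"
proof -
  have "supp (sw p) = prod.swap ` supp p" by (auto simp: supp_sw intro: rev_image_eqI)
  then show "degx (sw p) = degy p" "degy (sw p) = degx p" by (simp_all add: degx_def degy_def image_image)
qed

definition shear :: "complex \<Rightarrow> nat \<Rightarrow> complex poly poly \<Rightarrow> complex poly poly" where
  "shear c q p = pcompose p [:monom c q, 1:]"

lemma ev_shear: "ev (shear c q p) (x, y) = ev p (x + c * y ^ q, y)"
proof -
  have *: "poly (poly p s) y = poly (poly p [:poly s y:]) y" for p :: "complex poly poly" and s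
    by (induction p) auto
  show ?thesis
    unfolding ev_def shear_def prod.case poly_pcompose
    by (subst *) (simp add: poly_monom add.commute)
qed

lemma weight_le_pCons:
  assumes "weight_le a b t (pCons d p)"
  shows "weight_le a b t [:d:]" "weight_le a b (t - a) p"
proof -
  show "weight_le a b t [:d:]"
    unfolding weight_le_def
  proof (intro allI impI)
    fix i j assume "(i, j) \<in> supp [:d:]"
    then have "i = 0" "(i, j) \<in> supp (pCons d p)"
      by (cases i; simp add: in_supp cf_def)+
    then show "int (a * i + b * j) \<le> t" using assms unfolding weight_le_def by blast
  qed
  show "weight_le a b (t - a) p"
    unfolding weight_le_def
  proof (intro allI impI)
    fix i j assume "(i, j) \<in> supp p"
    then have "(Suc i, j) \<in> supp (pCons d p)" by (simp add: in_supp cf_def)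
    then have "int (a * Suc i + b * j) \<le> t" using assms unfolding weight_le_def by blast
    then show "int (a * i + b * j) \<le> t - a" by simp
  qed
qed

text \<open>Substituting \<open>x + c * y ^ q\<close> for \<open>x\<close> is homogeneous for the
  weights \<open>q\<close> and 1.\<close>

lemma weight_le_shear: "weight_le q 1 t p \<Longrightarrow> weight_le q 1 t (shear c q p)"
proof (induction p arbitrary: t)
  case 0
  then show ?case by (simp add: shear_def weight_le_def supp_def)
next
  case (pCons d p)
  have "weight_le q 1 q [:monom c q, 1:]"
    by (auto simp: weight_le_def supp_def cf_def coeff_pCons split: nat.splits)
  from weight_le_mult[OF this pCons.IH[OF weight_le_pCons(2)[OF pCons.prems]]]
  have "weight_le q 1 t ([:monom c q, 1:] * shear c q p)" by simp
  then show ?case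
    using weight_le_pCons(1)[OF pCons.prems]
    unfolding shear_def pcompose_pCons by (intro weight_le_add) auto
qed

text \<open>The shear straightens the leading form to \<open>bconst a * X ^ k\<close>; everything
  else lies strictly below the edge, so the corner \<open>(0, q * k)\<close> disappears. The two
  monomials in the support are kept for a later comparison of characters.\<close>

lemma shear_reduces:
  assumes P: "P = bconst a * (X - bconst c * Y ^ q) ^ k + P1" and nz: "a \<noteq> 0" "c \<noteq> 0" "0 < k" "0 < q"
    and P1: "\<And>i j. (i, j) \<in> supp P1 \<Longrightarrow> q * i + j < q * k"
  shows "(k, 0) \<in> supp P" "(k - 1, q) \<in> supp P"
    and "degx (shear c q P) + degy (shear c q P) < k + q * k"
proof -
  have lin: "X - bconst c * Y ^ q = [:- monom c q, 1:]"
    using bconst_monom[of c 0 q] by (simp add: monom_0)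
  have cf_lin: "cf ((X - bconst c * Y ^ q) ^ k) i j = coeff (of_nat (k choose i) * (- monom c q) ^ (k - i)) j" if "i \<le> k" for i j
    unfolding lin cf_def coeff_linear_poly_power[OF that] by simp
  have P10: "cf P1 i j = 0" if "q * k \<le> q * i + j" for i j
    using P1[of i j] that by (auto simp: in_supp)
  have "cf P k 0 = a" unfolding P by (simp add: cf_lin P10 del: mult_pCons_left)
  then show "(k, 0) \<in> supp P" using nz by (simp add: in_supp)
  \<comment> \<open>The point \<open>(k - 1, q)\<close> lies on the edge too, and the binomial
    theorem gives it the coefficient \<open>- (k * a * c)\<close>, nonzero in characteristic
    0.\<close>
  have "q * (k - 1) + q = q * k" using nz by (cases k) auto
  then have "cf P (k - 1) q = a * (of_nat k * (- c))"
    unfolding P using nz binomial_symmetric[of 1 k]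
    by (simp add: cf_lin P10 of_nat_poly del: mult_pCons_left) (simp add: of_nat_poly)
  then show "(k - 1, q) \<in> supp P" using nz by (simp add: in_supp)
  have "weight_le q 1 (int (q * k) - 1) P1"
    unfolding weight_le_def
  proof (intro allI impI)
    fix i j assume "(i, j) \<in> supp P1"
    from P1[OF this] have "int (q * i + j) < int (q * k)" by (simp only: of_nat_less_iff)
    then show "int (q * i + 1 * j) \<le> int (q * k) - 1" by simp
  qed
  then have wt: "weight_le q 1 (int (q * k) - 1) (shear c q P1)" by (rule weight_le_shear)
  have "shear c q P = bconst a * X ^ k * Y ^ 0 + shear c q P1"
    unfolding ev_inject[symmetric]
    by (rule ext) (auto simp: P ev_shear simp del: mult_pCons_left mult_pCons_right)
  then have sh: "shear c q P = monom (monom a 0) k + shear c q P1" unfolding bconst_monom .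
  have dom: "i = k \<and> j = 0 \<or> q * i + j < q * k" if "(i, j) \<in> supp (shear c q P)" for i j
  proof (cases "i = k \<and> j = 0")
    case False
    then have "(i, j) \<in> supp (shear c q P1)" using that by (auto simp: in_supp sh split: if_splits)
    then have "int (q * i + 1 * j) \<le> int (q * k) - 1" using wt unfolding weight_le_def by blast
    then have "int (q * i + j) < int (q * k)" by simp
    then have "q * i + j < q * k" by (simp only: of_nat_less_iff)
    then show ?thesis by blast
  qed auto
  have "degx (shear c q P) \<le> k"
  proof (rule degx_le)
    fix i j assume "(i, j) \<in> supp (shear c q P)"
    from dom[OF this] show "i \<le> k"
    proof
      assume "q * i + j < q * k"
      then have "q * i < q * k" by linarith
      then show ?thesis by simp
    qed simp
  qed
  moreover have "degy (shear c q P) \<le> q * k - 1"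
    by (rule degy_le) (use dom in fastforce)
  moreover have "0 < q * k" using nz by simp
  ultimately show "degx (shear c q P) + degy (shear c q P) < k + q * k" by linarith
qed


text \<open>\<open>u\<close> and \<open>v\<close> stand for the partial derivatives of
  \<open>F\<close> composed with \<open>h\<close>. Their bare existence suffices, since they enter
  only through a determinant that multiplies the Jacobian.\<close>

lemma plane_chain_rule:
  assumes h: "h = (\<lambda>z. (ev P z, ev Q z))" and F: "F \<in> plane_ring"
  shows "\<exists>r u v. ev r = F \<circ> h \<and> dx r = u * dx P + v * dx Q \<and> dy r = u * dy P + v * dy Q"
  using F unfolding plane_ring_def
proof (induction rule: function_algebra.induct)
  case (gen f)
  then show ?case
  proof (elim insertE emptyE)
    assume "f = fst"
    then have "ev P = f \<circ> h \<and> dx P = 1 * dx P + 0 * dx Q \<and> dy P = 1 * dy P + 0 * dy Q"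
      by (auto simp: h)
    then show ?thesis by blast
  next
    assume "f = snd"
    then have "ev Q = f \<circ> h \<and> dx Q = 0 * dx P + 1 * dx Q \<and> dy Q = 0 * dy P + 1 * dy Q"
      by (auto simp: h)
    then show ?thesis by blast
  qed
next
  case (const c)
  have "ev (bconst c) = (\<lambda>_. c) \<circ> h \<and> dx (bconst c) = 0 * dx P + 0 * dx Q \<and>
      dy (bconst c) = 0 * dy P + 0 * dy Q"
    by auto
  then show ?case by blast
next
  case (add f g)
  then obtain r u v r' u' v' where
    "ev r = f \<circ> h" "dx r = u * dx P + v * dx Q" "dy r = u * dy P + v * dy Q"
    "ev r' = g \<circ> h" "dx r' = u' * dx P + v' * dx Q" "dy r' = u' * dy P + v' * dy Q" by blast
  then have "ev (r + r') = (\<lambda>x. f x + g x) \<circ> h \<and> dx (r + r') = (u + u') * dx P + (v + v') * dx Q \<and>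
      dy (r + r') = (u + u') * dy P + (v + v') * dy Q"
    by (auto simp: derivation.add[OF derivation_dx] derivation.add[OF derivation_dy] algebra_simps)
  then show ?case by blast
next
  case (mult f g)
  then obtain r u v r' u' v' where
    "ev r = f \<circ> h" "dx r = u * dx P + v * dx Q" "dy r = u * dy P + v * dy Q"
    "ev r' = g \<circ> h" "dx r' = u' * dx P + v' * dx Q" "dy r' = u' * dy P + v' * dy Q" by blast
  then have "ev (r * r') = (\<lambda>x. f x * g x) \<circ> h \<and>
      dx (r * r') = (u * r' + r * u') * dx P + (v * r' + r * v') * dx Q \<and>
      dy (r * r') = (u * r' + r * u') * dy P + (v * r' + r * v') * dy Q"
    by (auto simp: derivation.mult[OF derivation_dx] derivation.mult[OF derivation_dy] algebra_simps)
  then show ?case by blast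
qed

locale polynomial_automorphism =
  fixes h k :: "plane \<Rightarrow> plane" and P Q :: "complex poly poly"
  assumes h: "h = (\<lambda>z. (ev P z, ev Q z))"
    and k: "\<And>F. F \<in> plane_ring \<Longrightarrow> F \<circ> k \<in> plane_ring"
    and kh: "\<And>z. k (h z) = z"
begin

text \<open>The chain rule for \<open>k \<circ> h = id\<close> exhibits \<open>jac P Q\<close> as a
  divisor of 1 in the polynomial ring, whose units are the nonzero constants.\<close>

lemma jac_const: "\<exists>c. c \<noteq> 0 \<and> jac P Q = bconst c"
proof -
  have gens: "fst \<in> plane_ring" "snd \<in> plane_ring"
    unfolding plane_ring_def by (simp_all add: function_algebra.gen)
  obtain r u v where r: "ev r = fst \<circ> k \<circ> h" "dx r = u * dx P + v * dx Q" "dy r = u * dy P + v * dy Q"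
    using plane_chain_rule[OF h k[OF gens(1)]] by blast
  obtain r' u' v' where
    r': "ev r' = snd \<circ> k \<circ> h" "dx r' = u' * dx P + v' * dx Q" "dy r' = u' * dy P + v' * dy Q"
    using plane_chain_rule[OF h k[OF gens(2)]] by blast
  have "ev r = ev X" "ev r' = ev Y" using r(1) r'(1) kh by (auto intro!: ext)
  then have eqs: "r = X" "r' = Y" unfolding ev_inject by blast+
  have "(u * v' - v * u') * jac P Q =
      (u * dx P + v * dx Q) * (u' * dy P + v' * dy Q) - (u * dy P + v * dy Q) * (u' * dx P + v' * dx Q)"
    by (simp add: jac_def algebra_simps)
  also have "\<dots> = 1" unfolding r(2,3)[symmetric] r'(2,3)[symmetric] eqs dx_simps dy_simps by simp
  finally have "jac P Q dvd 1" by (metis dvd_triv_right)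
  then show ?thesis by (auto simp: is_unit_poly_iff)
qed

text \<open>One step kills \<open>P\<close>, two steps kill \<open>Q\<close> because
  \<open>jac P Q\<close> is constant, and every polynomial is a polynomial in \<open>P\<close> and
  \<open>Q\<close>: compose it with \<open>k\<close>, then with \<open>h\<close>.\<close>

lemma locally_nilpotent_jac: "locally_nilpotent (jac P)"
proof -
  interpret derivation "jac P" by (rule derivation_jac)
  obtain c where c: "jac P Q = bconst c" using jac_const by blast
  have "(jac P ^^ 1) P = 0" "(jac P ^^ 2) Q = 0" by (simp_all add: c numeral_2_eq_2)
  then have nil: "nilp P" "nilp Q" unfolding nilp_def by blast+
  have ex: "\<exists>r. nilp r \<and> ev r = F \<circ> h" if "F \<in> plane_ring" for F
    using that unfolding plane_ring_def
  proof (induction rule: function_algebra.induct)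
    case (gen f)
    then have "f \<circ> h = ev P \<or> f \<circ> h = ev Q" by (auto simp: h)
    then show ?case using nil by metis
  next
    case (const c)
    have "(jac P ^^ 1) (bconst c) = 0" by simp
    then have "nilp (bconst c)" unfolding nilp_def by blast
    moreover have "ev (bconst c) = (\<lambda>_. c) \<circ> h" by auto
    ultimately show ?case by blast
  next
    case (add f g)
    then obtain r s where "nilp r" "ev r = f \<circ> h" "nilp s" "ev s = g \<circ> h" by blast
    then have "nilp (r + s)" "ev (r + s) = (\<lambda>x. f x + g x) \<circ> h" using nilp_add by auto
    then show ?case by blast
  next
    case (mult f g)
    then obtain r s where "nilp r" "ev r = f \<circ> h" "nilp s" "ev s = g \<circ> h" by blast
    then have "nilp (r * s)" "ev (r * s) = (\<lambda>x. f x * g x) \<circ> h" using nilp_mult by auto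
    then show ?case by blast
  qed
  show ?thesis
  proof
    fix f
    obtain r where r: "nilp r" "ev r = ev f \<circ> k \<circ> h" using ex[OF k[OF ev_in_plane_ring]] by blast
    have "ev r = ev f" using r(2) kh by (auto intro!: ext)
    then show "nilp f" using r(1) unfolding ev_inject by simp
  qed
qed

text \<open>Without \<open>y\<close> in \<open>P\<close> the Jacobian is \<open>dx P * dy Q\<close>,
  and a product equal to a nonzero constant has constant factors.\<close>

lemma affine_in_x:
  assumes "degy P = 0"
  shows "\<exists>\<alpha> \<alpha>0 \<beta> f. \<alpha> \<noteq> 0 \<and> \<beta> \<noteq> 0 \<and> h = (\<lambda>(x, y). (\<alpha> * x + \<alpha>0, \<beta> * y + poly f x))"
proof -
  have P0: "cf P i j = 0" if "0 < j" for i j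
    using le_degy[of i j P] assms that by (auto simp: in_supp)
  have dyP: "dy P = 0" by (rule cf_eqI) (simp add: cf_dy P0)
  obtain c where c: "c \<noteq> 0" "jac P Q = bconst c" using jac_const by blast
  then have prod: "dx P * dy Q = bconst c" by (simp add: jac_def dyP)
  have cd: "bconst c dvd 1" using c(1) by (simp add: is_unit_poly_iff dvd_field_iff)
  have "dx P dvd 1" "dy Q dvd 1" using prod cd by (metis dvd_triv_left dvd_triv_right dvd_trans)+
  then obtain a b where ab: "a \<noteq> 0" "b \<noteq> 0" "dx P = bconst a" "dy Q = bconst b"
    by (auto simp: is_unit_poly_iff dvd_field_iff)
  have cfa: "cf (bconst a) i j = (if i = 0 \<and> j = 0 then a else 0)" for a :: complex and i j
    by (auto simp: cf_def coeff_pCons split: nat.splits)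
  have P1: "of_nat (Suc i) * cf P (Suc i) j = (if i = 0 \<and> j = 0 then a else 0)" for i j
    using ab(3) cf_dx[of P i j] by (simp add: cfa)
  have Q1: "of_nat (Suc j) * cf Q i (Suc j) = (if i = 0 \<and> j = 0 then b else 0)" for i j
    using ab(4) cf_dy[of Q i j] by (simp add: cfa)
  have "P = bconst a * X + bconst (cf P 0 0)"
  proof (rule cf_eqI)
    fix i j
    show "cf P i j = cf (bconst a * X + bconst (cf P 0 0)) i j"
    proof (cases i)
      case 0
      then show ?thesis using P0[of j 0] by (cases j) (auto simp: cf_def)
    next
      case (Suc i')
      then show ?thesis using P1[of i' j] by (cases i'; cases j) (auto simp: cf_def simp del: of_nat_Suc)
    qed
  qed
  then have evP: "ev P (x, y) = a * x + cf P 0 0" for x y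
    by (metis ev_simps(1,4,6,7) fst_conv)
  define f where "f = map_poly (\<lambda>c. coeff c 0) Q"
  have f: "poly (map_poly (\<lambda>c. [:c:]) f) [:x:] = [:poly f x:]" for x
    by (induction f) (auto simp: map_poly_pCons)
  have "Q = bconst b * Y + map_poly (\<lambda>c. [:c:]) f"
  proof (rule cf_eqI)
    fix i j
    show "cf Q i j = cf (bconst b * Y + map_poly (\<lambda>c. [:c:]) f) i j"
    proof (cases j)
      case 0
      then show ?thesis by (cases i) (auto simp: cf_def coeff_map_poly f_def)
    next
      case (Suc j')
      then show ?thesis using Q1[of j' i] by (cases i; cases j') (auto simp: cf_def coeff_map_poly simp del: of_nat_Suc)
    qed
  qed
  then have "ev Q (x, y) = ev (bconst b * Y) (x, y) + ev (map_poly (\<lambda>c. [:c:]) f) (x, y)" for x y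
    by (metis ev_simps(1))
  then have evQ: "ev Q (x, y) = b * y + poly f x" for x y
    using f[of x] by (simp add: ev_def)
  show ?thesis using ab(1,2) evP evQ unfolding h by (intro exI[of _ a] exI[of _ "cf P 0 0"] exI[of _ b] exI[of _ f]) auto
qed

lemma swapped: "polynomial_automorphism (h \<circ> prod.swap) (prod.swap \<circ> k) (sw P) (sw Q)"
proof
  show "h \<circ> prod.swap = (\<lambda>z. (ev (sw P) z, ev (sw Q) z))"
    by (auto simp: h ev_sw intro!: ext)
  show "F \<circ> (prod.swap \<circ> k) \<in> plane_ring" if F: "F \<in> plane_ring" for F
  proof -
    obtain p where "F = ev p" using F plane_ring_ev by blast
    then have "F \<circ> prod.swap = ev (sw p)" by (auto simp: ev_sw intro!: ext)
    then show ?thesis using k[of "F \<circ> prod.swap"] ev_in_plane_ring by (simp add: comp_assoc[symmetric])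
  qed
qed (simp add: kh)

lemma affine_in_y:
  assumes "degx P = 0"
  shows "\<exists>\<alpha> \<alpha>0 \<beta> f. \<alpha> \<noteq> 0 \<and> \<beta> \<noteq> 0 \<and> h = (\<lambda>(x, y). (\<alpha> * y + \<alpha>0, \<beta> * x + poly f y))"
proof -
  interpret s: polynomial_automorphism "h \<circ> prod.swap" "prod.swap \<circ> k" "sw P" "sw Q" by (rule swapped)
  obtain \<alpha> \<alpha>0 \<beta> f where *: "\<alpha> \<noteq> 0" "\<beta> \<noteq> 0"
    "h \<circ> prod.swap = (\<lambda>(x, y). (\<alpha> * x + \<alpha>0, \<beta> * y + poly f x))"
    using s.affine_in_x assms by (auto simp: degy_sw)
  have "h = h \<circ> prod.swap \<circ> prod.swap" by auto
  also have "\<dots> = (\<lambda>(x, y). (\<alpha> * y + \<alpha>0, \<beta> * x + poly f y))" unfolding *(3) by auto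
  finally show ?thesis using *(1,2) by blast
qed

text \<open>Two monomials on the edge are returned along with the drop in degree: for a
  semi-invariant \<open>P\<close> they must have equal characters, which later ties \<open>q\<close>
  to \<open>e\<close>.\<close>

theorem reduction:
  assumes "0 < degx P" "0 < degy P"
  shows "\<exists>c q l p. ((Suc l, 0) \<in> supp P \<and> (l, q) \<in> supp P \<and> (\<forall>x y. ev p (x, y) = ev P (x + c * y ^ q, y))
      \<or> (0, Suc l) \<in> supp P \<and> (q, l) \<in> supp P \<and> (\<forall>x y. ev p (x, y) = ev P (x, y + c * x ^ q)))
      \<and> degx p + degy p < degx P + degy P"
proof -
  obtain a c k p q P1 where
    nz: "a \<noteq> 0" "c \<noteq> 0" "0 < k" "0 < p" "0 < q" and pq: "p = 1 \<or> q = 1"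
    and deg: "degx P = p * k" "degy P = q * k"
    and P: "P = bconst a * (X ^ p - bconst c * Y ^ q) ^ k + P1"
    and P1: "\<forall>i j. (i, j) \<in> supp P1 \<longrightarrow> degy P * i + degx P * j < degx P * degy P"
    by (rule newton_form[OF locally_nilpotent_jac assms], rule that)
  have P1': "q * i + p * j < p * q * k" if "(i, j) \<in> supp P1" for i j
  proof -
    have "k * (q * i + p * j) < k * (p * q * k)"
      using P1[rule_format, OF that] unfolding deg by (simp add: algebra_simps)
    then show ?thesis by simp
  qed
  show ?thesis
  proof (cases "p = 1")
    case True
    have red: "(k, 0) \<in> supp P" "(k - 1, q) \<in> supp P"
      "degx (shear c q P) + degy (shear c q P) < k + q * k"
      by (rule shear_reduces[of P a c q k P1]; use P P1' nz True in simp)+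
    obtain l where "k = Suc l" using nz by (cases k) auto
    then show ?thesis
      using red deg True ev_shear[of c q P]
      by (intro exI[of _ c] exI[of _ q] exI[of _ l] exI[of _ "shear c q P"]) simp
  next
    case False
    then have q: "q = 1" using pq by simp
    \<comment> \<open>For \<open>q = 1\<close> the variables are exchanged; pulling
      \<open>- c\<close> out of the linear factor produces the form that
      \<open>shear_reduces\<close> accepts, with \<open>1 / c\<close> in place of
      \<open>c\<close>.\<close>
    have swP: "sw P = bconst (a * (- c) ^ k) * (X - bconst (1 / c) * Y ^ p) ^ k + sw P1"
      unfolding ev_inject[symmetric]
    proof (rule ext)
      fix z :: plane obtain x y where z: "z = (x, y)" by fastforce
      have "(y ^ p - c * x) ^ k = (- c) ^ k * (x - 1 / c * y ^ p) ^ k"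
        using nz by (simp add: power_mult_distrib[symmetric] algebra_simps)
      then show "ev (sw P) z = ev (bconst (a * (- c) ^ k) * (X - bconst (1 / c) * Y ^ p) ^ k + sw P1) z"
        by (simp add: P q z ev_sw del: mult_pCons_left mult_pCons_right)
    qed
    have red: "(k, 0) \<in> supp (sw P)" "(k - 1, p) \<in> supp (sw P)"
      "degx (shear (1 / c) p (sw P)) + degy (shear (1 / c) p (sw P)) < k + p * k"
      by (rule shear_reduces[of "sw P" "a * (- c) ^ k" "1 / c" p k "sw P1"];
        use swP P1' nz q in \<open>force simp: supp_sw algebra_simps\<close>)+
    obtain l where l: "k = Suc l" using nz by (cases k) auto
    have "ev (sw (shear (1 / c) p (sw P))) (x, y) = ev P (x, y + 1 / c * x ^ p)" for x y
      by (simp add: ev_sw ev_shear)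
    then show ?thesis
      using red deg q l
      by (intro exI[of _ "1 / c"] exI[of _ p] exI[of _ l] exI[of _ "sw (shear (1 / c) p (sw P))"])
        (simp add: supp_sw degx_sw degy_sw)
  qed
qed

end

section \<open>Automorphism groups\<close>

lemma morphism_compose:
  assumes "morphism A R B S \<phi>" "morphism B S C T \<psi>"
  shows "morphism A R C T (\<lambda>x. \<psi> (\<phi> x))"
  using assms unfolding morphism_def by (fastforce simp: Pi_iff)

lemma morphism_cong:
  assumes "\<And>x. x \<in> A \<Longrightarrow> \<phi> x = \<psi> x" "morphism A R B S \<phi>"
  shows "morphism A R B S \<psi>"
  using assms unfolding morphism_def by (fastforce simp: Pi_iff)

lemma morphism_id: "morphism A R A R (\<lambda>x. x)"
  unfolding morphism_def by auto

text \<open>The group inverse is \<open>inv_into\<close> restricted to \<open>A\<close>. The two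
  agree on \<open>A\<close>, which is all that \<open>morphism\<close> inspects; the same holds for
  the inverse of an inverse and of a composition.\<close>

lemma subgroup_variety_aut:
  "subgroup {\<phi> \<in> Bij A. morphism A R A R \<phi> \<and> morphism A R A R (inv_into A \<phi>)} (BijGroup A)"
    (is "subgroup ?H _")
proof
  have inv_eq: "inv_into A (\<lambda>x\<in>A. inv_into A \<phi> x) x = \<phi> x" if "\<phi> \<in> Bij A" "x \<in> A" for \<phi> x
    using that by (intro inv_into_f_eq) (auto simp: Bij_def bij_betw_def inj_on_inv_into inv_into_into)
  show "?H \<subseteq> carrier (BijGroup A)" by (auto simp: BijGroup_def)
  show "\<one>\<^bsub>BijGroup A\<^esub> \<in> ?H"
  proof -
    have "inv_into A (\<lambda>x\<in>A. x) x = x" if "x \<in> A" for x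
      using that by (intro inv_into_f_eq) (auto simp: inj_on_def)
    note id = this
    have "morphism A R A R (inv_into A (\<lambda>x\<in>A. x))"
      by (rule morphism_cong[OF _ morphism_id]) (simp only: id)
    moreover have "morphism A R A R (\<lambda>x\<in>A. x)" by (rule morphism_cong[OF _ morphism_id]) auto
    ultimately show ?thesis by (simp add: BijGroup_def id_Bij)
  qed
  show "m_inv (BijGroup A) \<phi> \<in> ?H" if "\<phi> \<in> ?H" for \<phi>
  proof -
    have "morphism A R A R (inv_into A (\<lambda>x\<in>A. inv_into A \<phi> x))"
      by (rule morphism_cong[of A \<phi>]) (use that inv_eq in auto)
    moreover have "morphism A R A R (\<lambda>x\<in>A. inv_into A \<phi> x)"
      by (rule morphism_cong[of A "inv_into A \<phi>"]) (use that in auto)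
    ultimately show ?thesis using that by (simp add: inv_BijGroup restrict_inv_into_Bij)
  qed
  show "\<phi> \<otimes>\<^bsub>BijGroup A\<^esub> \<psi> \<in> ?H" if "\<phi> \<in> ?H" "\<psi> \<in> ?H" for \<phi> \<psi>
  proof -
    have B: "\<phi> \<in> Bij A" "\<psi> \<in> Bij A" using that by auto
    have inv: "inv_into A (compose A \<phi> \<psi>) x = inv_into A \<psi> (inv_into A \<phi> x)" if "x \<in> A" for x
    proof (rule inv_into_f_eq)
      show "inj_on (compose A \<phi> \<psi>) A" using compose_Bij[OF B] by (auto simp: Bij_def bij_betw_def)
      show "inv_into A \<psi> (inv_into A \<phi> x) \<in> A" using Bij_inv_into_mem B that by metis
      show "compose A \<phi> \<psi> (inv_into A \<psi> (inv_into A \<phi> x)) = x"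
        using B that Bij_inv_into_mem[OF B(1) that] Bij_inv_into_mem[OF B(2)]
        by (simp add: compose_def Bij_def bij_betw_def f_inv_into_f)
    qed
    have mor: "morphism A R A R (\<lambda>x. inv_into A \<psi> (inv_into A \<phi> x))"
      by (rule morphism_compose) (use that in auto)
    have "morphism A R A R (inv_into A (compose A \<phi> \<psi>))"
      by (rule morphism_cong[OF _ mor]) (simp only: inv)
    moreover have "morphism A R A R (compose A \<phi> \<psi>)"
      by (rule morphism_cong[of A "\<lambda>x. \<phi> (\<psi> x)"])
        (use that morphism_compose[of A R A R \<psi> A R \<phi>] in \<open>auto simp: compose_def\<close>)
    ultimately show ?thesis using B compose_Bij[OF B] by (simp add: BijGroup_def)
  qed
qed

lemma group_variety_aut: "group (variety_aut A R)"
  unfolding variety_aut_def by (rule subgroup.subgroup_is_group[OF subgroup_variety_aut group_BijGroup])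

lemma variety_aut_carrier:
  "\<phi> \<in> carrier (variety_aut A R) \<longleftrightarrow> \<phi> \<in> Bij A \<and> morphism A R A R \<phi> \<and> morphism A R A R (inv_into A \<phi>)"
  by (simp add: variety_aut_def)

lemma variety_aut_mult:
  "\<phi> \<in> Bij A \<Longrightarrow> \<psi> \<in> Bij A \<Longrightarrow> \<phi> \<otimes>\<^bsub>variety_aut A R\<^esub> \<psi> = compose A \<phi> \<psi>"
  by (simp add: variety_aut_def BijGroup_def)

lemma variety_aut_one: "\<one>\<^bsub>variety_aut A R\<^esub> = (\<lambda>x\<in>A. x)"
  by (simp add: variety_aut_def BijGroup_def)

lemma variety_aut_inv:
  "\<phi> \<in> carrier (variety_aut A R) \<Longrightarrow> m_inv (variety_aut A R) \<phi> = (\<lambda>x\<in>A. inv_into A \<phi> x)"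
  unfolding variety_aut_def
  by (simp add: group.m_inv_consistent[OF group_BijGroup subgroup_variety_aut] inv_BijGroup)

section \<open>Automorphisms of the plane and the triangular groups\<close>

lemma plane_ring_pullback:
  assumes "fst \<circ> h \<in> plane_ring" "snd \<circ> h \<in> plane_ring" "F \<in> plane_ring"
  shows "F \<circ> h \<in> plane_ring"
  using assms(3) unfolding plane_ring_def
proof (induction rule: function_algebra.induct)
  case (gen f)
  then show ?case using assms(1,2) unfolding plane_ring_def by blast
qed (auto simp: comp_def intro: function_algebra.intros)

definition pulls_back :: "(plane \<Rightarrow> plane) \<Rightarrow> bool" where
  "pulls_back h \<longleftrightarrow> (\<forall>F\<in>plane_ring. F \<circ> h \<in> plane_ring)"

lemma morphism_plane: "morphism UNIV plane_ring UNIV plane_ring h \<longleftrightarrow> pulls_back h"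
proof -
  have "(\<exists>a\<in>plane_ring. \<forall>x. b (h x) = a x) \<longleftrightarrow> b \<circ> h \<in> plane_ring" for b :: "plane \<Rightarrow> complex"
    unfolding comp_def by (metis ext)
  then show ?thesis unfolding morphism_def pulls_back_def by simp
qed

lemma pulls_backI:
  assumes "\<And>z. fst (h z) = ev P z" "\<And>z. snd (h z) = ev Q z"
  shows "pulls_back h"
proof -
  have "fst \<circ> h = ev P" "snd \<circ> h = ev Q" using assms by auto
  then show ?thesis unfolding pulls_back_def using plane_ring_pullback ev_in_plane_ring by metis
qed

lemma group_Aut_plane: "group Aut_plane"
  unfolding Aut_plane_def by (rule group_variety_aut)

interpretation plane: group Aut_plane by (rule group_Aut_plane)

lemma Aut_plane_carrier:
  "h \<in> carrier Aut_plane \<longleftrightarrow> bij h \<and> pulls_back h \<and> pulls_back (inv_into UNIV h)"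
  by (simp add: Aut_plane_def variety_aut_carrier morphism_plane Bij_def extensional_UNIV)

lemma Aut_plane_mult: "h \<in> carrier Aut_plane \<Longrightarrow> g \<in> carrier Aut_plane \<Longrightarrow> h \<otimes>\<^bsub>Aut_plane\<^esub> g = h \<circ> g"
  unfolding Aut_plane_def by (auto simp: variety_aut_carrier variety_aut_mult compose_def)

lemma Aut_plane_one: "\<one>\<^bsub>Aut_plane\<^esub> = id"
  unfolding Aut_plane_def by (auto simp: variety_aut_one)

lemma Aut_plane_inv: "h \<in> carrier Aut_plane \<Longrightarrow> m_inv Aut_plane h = inv_into UNIV h"
  unfolding Aut_plane_def by (subst variety_aut_inv) (auto simp: restrict_def)

lemma Aut_planeI:
  assumes "\<And>z. h (k z) = z" "\<And>z. k (h z) = z" "pulls_back h" "pulls_back k"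
  shows "h \<in> carrier Aut_plane" "m_inv Aut_plane h = k"
proof -
  have "bij h" using assms(1,2) by (intro o_bij[of k]) auto
  moreover have inv: "inv_into UNIV h = k" using assms(1,2)
    by (intro ext) (metis UNIV_I \<open>bij h\<close> bij_is_inj inv_into_f_f)
  ultimately show "h \<in> carrier Aut_plane" using assms by (simp add: Aut_plane_carrier)
  then show "m_inv Aut_plane h = k" using inv by (simp add: Aut_plane_inv)
qed

lemma Aut_plane_components:
  assumes "h \<in> carrier Aut_plane"
  obtains P Q where "h = (\<lambda>z. (ev P z, ev Q z))" "polynomial_automorphism h (inv_into UNIV h) P Q"
proof -
  have "fst \<in> plane_ring" "snd \<in> plane_ring"
    unfolding plane_ring_def by (simp_all add: function_algebra.gen)
  then have "fst \<circ> h \<in> plane_ring" "snd \<circ> h \<in> plane_ring"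
    using assms unfolding Aut_plane_carrier pulls_back_def by blast+
  then obtain P Q where PQ: "fst \<circ> h = ev P" "snd \<circ> h = ev Q" unfolding plane_ring_ev by blast
  have h: "h = (\<lambda>z. (ev P z, ev Q z))"
    unfolding PQ[symmetric] by simp
  moreover have "polynomial_automorphism h (inv_into UNIV h) P Q"
  proof
    show "inv_into UNIV h (h z) = z" for z
      using assms unfolding Aut_plane_carrier by (simp add: bij_is_inj)
  qed (use h assms Aut_plane_carrier pulls_back_def in auto)
  ultimately show thesis using that by blast
qed

lemma subgroup_cancel_right:
  assumes "subgroup H Aut_plane" "h \<circ> s \<in> H" "s \<in> H" "h \<in> carrier Aut_plane"
  shows "h \<in> H"
proof -
  have s: "s \<in> carrier Aut_plane" using assms subgroup.mem_carrier by metis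
  have "h = (h \<otimes>\<^bsub>Aut_plane\<^esub> s) \<otimes>\<^bsub>Aut_plane\<^esub> m_inv Aut_plane s"
    using s assms(4) by (simp add: plane.m_assoc)
  then show ?thesis
    using assms(2,3) s assms(4) subgroup.m_closed[OF assms(1)] subgroup.m_inv_closed[OF assms(1)]
    by (metis Aut_plane_mult)
qed

abbreviation swap :: "plane \<Rightarrow> plane" where "swap \<equiv> \<lambda>(x, y). (y, x)"

lemma swap_Aut: "swap \<in> carrier Aut_plane" "m_inv Aut_plane swap = swap"
proof -
  have "pulls_back swap" by (rule pulls_backI[of _ Y X]) auto
  then show "swap \<in> carrier Aut_plane" "m_inv Aut_plane swap = swap"
    using Aut_planeI[of swap swap] by auto
qed

lemma ev_const_poly: "ev [:f:] (x, y) = poly f y"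
  by (simp add: ev_def)

lemma Jonq_plus_Aut:
  assumes "\<alpha> \<noteq> 0" "\<beta> \<noteq> 0"
  shows "(\<lambda>(x, y). (\<alpha> * x + poly f y, \<beta> * y)) \<in> carrier Aut_plane" (is "?h \<in> _")
    "m_inv Aut_plane (\<lambda>(x, y). (\<alpha> * x + poly f y, \<beta> * y)) =
      (\<lambda>(x, y). (1 / \<alpha> * x + poly (smult (- 1 / \<alpha>) (pcompose f [:0, 1 / \<beta>:])) y, 1 / \<beta> * y))" (is "_ = ?k")
proof -
  have pb: "pulls_back (\<lambda>(x, y). (\<alpha> * x + poly f y, \<beta> * y))" for \<alpha> \<beta> f
    by (rule pulls_backI[of _ "bconst \<alpha> * X + [:f:]" "bconst \<beta> * Y"])
      (auto simp: ev_const_poly split: prod.splits simp del: mult_pCons_left mult_pCons_right)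
  have "?h (?k z) = z" "?k (?h z) = z" for z
    using assms by (cases z; simp add: poly_pcompose field_simps)+
  then show "?h \<in> carrier Aut_plane" "m_inv Aut_plane ?h = ?k"
    using Aut_planeI[of ?h ?k] pb by blast+
qed

lemma Jonq_plus_subset: "Jonq_plus \<subseteq> carrier Aut_plane"
  unfolding Jonq_plus_def using Jonq_plus_Aut by blast

lemma subgroup_Jonq_plus: "subgroup Jonq_plus Aut_plane"
proof
  show "Jonq_plus \<subseteq> carrier Aut_plane" by (rule Jonq_plus_subset)
  have "(\<lambda>(x, y). (1 * x + poly 0 y, 1 * y)) \<in> Jonq_plus"
    unfolding Jonq_plus_def by (rule CollectI, rule exI[of _ 1], rule exI[of _ 1], rule exI[of _ 0]) simp
  then show "\<one>\<^bsub>Aut_plane\<^esub> \<in> Jonq_plus" by (simp add: Aut_plane_one id_def)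
next
  fix g h assume gh: "g \<in> Jonq_plus" "h \<in> Jonq_plus"
  then obtain \<alpha> \<beta> f \<alpha>' \<beta>' f' where g: "g = (\<lambda>(x, y). (\<alpha> * x + poly f y, \<beta> * y))" "\<alpha> \<noteq> 0" "\<beta> \<noteq> 0"
    and h: "h = (\<lambda>(x, y). (\<alpha>' * x + poly f' y, \<beta>' * y))" "\<alpha>' \<noteq> 0" "\<beta>' \<noteq> 0"
    unfolding Jonq_plus_def by blast
  have "g \<circ> h = (\<lambda>(x, y). ((\<alpha> * \<alpha>') * x + poly (smult \<alpha> f' + pcompose f [:0, \<beta>':]) y, (\<beta> * \<beta>') * y))"
    by (auto simp: g(1) h(1) poly_pcompose algebra_simps)
  then have "g \<circ> h \<in> Jonq_plus" unfolding Jonq_plus_def using g h by fastforce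
  then show "g \<otimes>\<^bsub>Aut_plane\<^esub> h \<in> Jonq_plus"
    using gh Jonq_plus_subset by (simp add: Aut_plane_mult subset_iff)
next
  fix g assume "g \<in> Jonq_plus"
  then obtain \<alpha> \<beta> f where g: "g = (\<lambda>(x, y). (\<alpha> * x + poly f y, \<beta> * y))" "\<alpha> \<noteq> 0" "\<beta> \<noteq> 0"
    unfolding Jonq_plus_def by blast
  then have "1 / \<alpha> \<noteq> 0" "1 / \<beta> \<noteq> 0" by auto
  then show "m_inv Aut_plane g \<in> Jonq_plus"
    unfolding g(1) Jonq_plus_Aut(2)[OF g(2,3)] unfolding Jonq_plus_def by blast
qed

lemma swap_conj_Jonq: "h \<in> Jonq_minus \<longleftrightarrow> swap \<circ> h \<circ> swap \<in> Jonq_plus"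
proof
  assume "h \<in> Jonq_minus"
  then obtain \<alpha> \<beta> f where h: "h = (\<lambda>(x, y). (\<alpha> * x, \<beta> * y + poly f x))" "\<alpha> \<noteq> 0" "\<beta> \<noteq> 0"
    unfolding Jonq_minus_def by blast
  have "swap \<circ> h \<circ> swap = (\<lambda>(x, y). (\<beta> * x + poly f y, \<alpha> * y))" by (auto simp: h(1))
  then show "swap \<circ> h \<circ> swap \<in> Jonq_plus" using h unfolding Jonq_plus_def by blast
next
  assume "swap \<circ> h \<circ> swap \<in> Jonq_plus"
  then obtain \<alpha> \<beta> f where h: "swap \<circ> h \<circ> swap = (\<lambda>(x, y). (\<alpha> * x + poly f y, \<beta> * y))" "\<alpha> \<noteq> 0" "\<beta> \<noteq> 0"
    unfolding Jonq_plus_def by blast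
  have "h = swap \<circ> (swap \<circ> h \<circ> swap) \<circ> swap" by (auto simp: fun_eq_iff split: prod.splits)
  also have "\<dots> = (\<lambda>(x, y). (\<beta> * x, \<alpha> * y + poly f x))" unfolding h(1) by auto
  finally show "h \<in> Jonq_minus" using h unfolding Jonq_minus_def by blast
qed

lemma swap_conj_Aut: "h \<in> carrier Aut_plane \<longleftrightarrow> swap \<circ> h \<circ> swap \<in> carrier Aut_plane"
proof -
  have *: "swap \<circ> h \<circ> swap \<in> carrier Aut_plane" if "h \<in> carrier Aut_plane" for h
    using that swap_Aut(1) by (metis Aut_plane_mult plane.m_closed)
  have "swap \<circ> (swap \<circ> h \<circ> swap) \<circ> swap = h" by (auto simp: fun_eq_iff split: prod.splits)
  then show ?thesis using * by metis
qed

lemma subgroup_Jonq_minus: "subgroup Jonq_minus Aut_plane"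
proof -
  have c: "inv\<^bsub>Aut_plane\<^esub> swap \<otimes>\<^bsub>Aut_plane\<^esub> x \<otimes>\<^bsub>Aut_plane\<^esub> swap = swap \<circ> x \<circ> swap"
    if "x \<in> Jonq_plus" for x
    unfolding swap_Aut(2) using swap_Aut(1) subsetD[OF Jonq_plus_subset that]
    by (metis Aut_plane_mult plane.m_closed)
  have e: "swap \<circ> (swap \<circ> h \<circ> swap) \<circ> swap = h" for h :: "plane \<Rightarrow> plane"
    by (auto simp: fun_eq_iff split: prod.splits)
  have "Jonq_minus = {swap \<circ> x \<circ> swap | x. x \<in> Jonq_plus}"
  proof (intro equalityI subsetI)
    fix h assume "h \<in> Jonq_minus"
    then have "swap \<circ> h \<circ> swap \<in> Jonq_plus" using swap_conj_Jonq by blast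
    then show "h \<in> {swap \<circ> x \<circ> swap | x. x \<in> Jonq_plus}"
      using e[of h, symmetric] by (intro CollectI exI[of _ "swap \<circ> h \<circ> swap"] conjI)
  next
    fix h assume "h \<in> {swap \<circ> x \<circ> swap | x. x \<in> Jonq_plus}"
    then obtain x where "x \<in> Jonq_plus" "h = swap \<circ> x \<circ> swap" by blast
    then show "h \<in> Jonq_minus" unfolding swap_conj_Jonq by (simp only: e)
  qed
  also have "\<dots> = {inv\<^bsub>Aut_plane\<^esub> swap \<otimes>\<^bsub>Aut_plane\<^esub> x \<otimes>\<^bsub>Aut_plane\<^esub> swap | x. x \<in> Jonq_plus}"
    by (intro Collect_cong) (metis c)
  finally show ?thesis using plane.subgroup_conj[OF subgroup_Jonq_plus swap_Aut(1)] by simp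
qed

section \<open>The normalizer of the cyclic group\<close>

locale toric_surface =
  fixes d e :: nat
  assumes coprime: "coprime d e" and e_pos: "1 \<le> e" and e_less: "e < d"
begin

definition \<zeta> :: complex where "\<zeta> = exp (2 * of_real pi * \<i> / of_nat d)"

lemma d_pos: "1 \<le> d" "1 < d" using e_pos e_less by auto

lemma zeta_power: "\<zeta> ^ k = exp (2 * of_real pi * \<i> * of_nat k / of_nat d)"
  unfolding \<zeta>_def exp_of_nat_mult[symmetric] by (simp add: algebra_simps)

lemma zeta_eq_iff: "\<zeta> ^ j = \<zeta> ^ k \<longleftrightarrow> [j = k] (mod d)"
  unfolding zeta_power complex_root_unity_eq[OF d_pos(1)] cong_def ..

lemma zeta_nonzero [simp]: "\<zeta> \<noteq> 0" unfolding \<zeta>_def by simp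

lemma zeta_power_d: "\<zeta> ^ d = 1"
  using zeta_eq_iff[of d 0] by (simp add: cong_def)

lemma root_of_unity: "c ^ d = 1 \<Longrightarrow> \<exists>k. c = \<zeta> ^ k"
  using complex_roots_unity[OF d_pos(1)] unfolding zeta_power by blast

lemma e_not_0: "\<not> [e = 0] (mod d)"
  using e_pos e_less by (simp add: cong_def)

text \<open>The \<open>k\<close>-th power of the generator. Natural exponents suffice because its
  \<open>d\<close>-th power is the identity; the inverse is \<open>rot (d * k - k)\<close>.\<close>

definition rot :: "nat \<Rightarrow> plane \<Rightarrow> plane" where
  "rot k = (\<lambda>(x, y). (\<zeta> ^ (e * k) * x, \<zeta> ^ k * y))"

lemma rot_add: "rot (j + k) = rot j \<circ> rot k"
  by (auto simp: rot_def power_add algebra_simps)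

lemma rot_0: "rot 0 = id" by (auto simp: rot_def)

lemma rot_d: "rot (d * k) = id"
  by (auto simp: rot_def power_mult zeta_power_d power_mult[symmetric] mult.left_commute[of e])

lemma pulls_back_rot: "pulls_back (rot k)"
  by (rule pulls_backI[of _ "bconst (\<zeta> ^ (e * k)) * X" "bconst (\<zeta> ^ k) * Y"])
    (auto simp: rot_def split: prod.splits simp del: mult_pCons_left mult_pCons_right)

lemma rot_inverse: "rot k \<circ> rot (d * k - k) = id" "rot (d * k - k) \<circ> rot k = id"
  using d_pos by (simp_all add: rot_add[symmetric] rot_d)

lemma rot_Aut: "rot k \<in> carrier Aut_plane" and rot_inv: "m_inv Aut_plane (rot k) = rot (d * k - k)"
proof -
  have "rot k (rot (d * k - k) z) = z" "rot (d * k - k) (rot k z) = z" for z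
    using fun_cong[OF rot_inverse(1)[of k], of z] fun_cong[OF rot_inverse(2)[of k], of z] by simp_all
  then show "rot k \<in> carrier Aut_plane" "m_inv Aut_plane (rot k) = rot (d * k - k)"
    using Aut_planeI[of "rot k" "rot (d * k - k)"] pulls_back_rot by blast+
qed

lemma cyclic_group_eq: "cyclic_group d e = range rot"
proof -
  have gen: "cyclic_group d e = generate Aut_plane {rot 1}"
    unfolding cyclic_group_def Let_def \<zeta>_def[symmetric] rot_def by simp
  have "x \<in> range rot" if "x \<in> generate Aut_plane {rot 1}" for x
    using that
  proof (induction rule: generate.induct)
    case one
    then show ?case using rot_0 Aut_plane_one by (metis rangeI)
  next
    case (eng g h)
    then obtain j k where "g = rot j" "h = rot k" by blast
    then have "g \<otimes>\<^bsub>Aut_plane\<^esub> h = rot (j + k)" by (simp add: Aut_plane_mult rot_Aut rot_add)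
    then show ?case by blast
  qed (auto simp: rot_inv simp del: One_nat_def)
  moreover have "rot k \<in> generate Aut_plane {rot 1}" for k
  proof (induction k)
    case 0
    show ?case using generate.one[of Aut_plane "{rot 1}"] unfolding rot_0 Aut_plane_one .
  next
    case (Suc k)
    have "rot (Suc k) = rot 1 \<otimes>\<^bsub>Aut_plane\<^esub> rot k"
      using rot_add[of 1 k] rot_Aut by (simp add: Aut_plane_mult)
    then show ?case using generate.eng[OF generate.incl[of "rot 1"] Suc] by simp
  qed
  ultimately show ?thesis unfolding gen by blast
qed

lemma cyclic_group_Aut: "cyclic_group d e \<subseteq> carrier Aut_plane"
  unfolding cyclic_group_eq using rot_Aut by blast

lemma N_full_iff:
  "h \<in> N_full d e \<longleftrightarrow> h \<in> carrier Aut_plane \<and> (\<lambda>g. h \<circ> g \<circ> inv_into UNIV h) ` range rot = range rot"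
proof -
  have "h <#\<^bsub>Aut_plane\<^esub> range rot #>\<^bsub>Aut_plane\<^esub> (inv\<^bsub>Aut_plane\<^esub> h) = (\<lambda>g. h \<circ> g \<circ> inv_into UNIV h) ` range rot"
    if h: "h \<in> carrier Aut_plane"
  proof -
    have "h \<otimes>\<^bsub>Aut_plane\<^esub> g \<otimes>\<^bsub>Aut_plane\<^esub> (inv\<^bsub>Aut_plane\<^esub> h) = h \<circ> g \<circ> inv_into UNIV h" if "g \<in> range rot" for g
    proof -
      have g: "g \<in> carrier Aut_plane" using that rot_Aut by blast
      have "h \<otimes>\<^bsub>Aut_plane\<^esub> g \<otimes>\<^bsub>Aut_plane\<^esub> (inv\<^bsub>Aut_plane\<^esub> h) = (h \<otimes>\<^bsub>Aut_plane\<^esub> g) \<circ> (inv\<^bsub>Aut_plane\<^esub> h)"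
        using h g by (intro Aut_plane_mult) auto
      then show ?thesis using h g by (simp only: Aut_plane_mult Aut_plane_inv)
    qed
    then show ?thesis unfolding l_coset_def r_coset_def by auto
  qed
  then show ?thesis
    unfolding N_full_def normalizer_def stabilizer_def cyclic_group_eq
    using cyclic_group_Aut[unfolded cyclic_group_eq] by auto
qed

lemma subgroup_N_full: "subgroup (N_full d e) Aut_plane"
  unfolding N_full_def by (rule plane.normalizer_imp_subgroup[OF cyclic_group_Aut])

lemma N_fullD:
  assumes "h \<in> N_full d e"
  shows "h \<in> carrier Aut_plane" "\<exists>l. h \<circ> rot k = rot l \<circ> h"
proof -
  show h: "h \<in> carrier Aut_plane" using assms unfolding N_full_iff by blast
  have "h \<circ> rot k \<circ> inv_into UNIV h \<in> range rot" using assms unfolding N_full_iff by blast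
  then obtain l where "h \<circ> rot k \<circ> inv_into UNIV h = rot l" by blast
  then have "h \<circ> rot k \<circ> (inv_into UNIV h \<circ> h) = rot l \<circ> h" by (simp only: comp_assoc[symmetric])
  moreover have "inv_into UNIV h \<circ> h = id" using h unfolding Aut_plane_carrier by (simp add: bij_is_inj)
  ultimately show "\<exists>l. h \<circ> rot k = rot l \<circ> h" by auto
qed

text \<open>The two conditions are the two inclusions between the cyclic group and its conjugate,
  freed of the inverse of \<open>h\<close>.\<close>

lemma N_fullI:
  assumes h: "h \<in> carrier Aut_plane" and "\<And>k. \<exists>l. h \<circ> rot k = rot l \<circ> h" "\<And>l. \<exists>k. h \<circ> rot k = rot l \<circ> h"
  shows "h \<in> N_full d e"
proof -
  have "surj h" using h unfolding Aut_plane_carrier by (simp add: bij_is_surj)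
  then have "h \<circ> inv_into UNIV h = id" by (simp add: surj_iff)
  then have c: "h \<circ> rot k \<circ> inv_into UNIV h = rot l" if "h \<circ> rot k = rot l \<circ> h" for k l
    using that by (simp add: comp_assoc)
  have "h \<circ> rot k \<circ> inv_into UNIV h \<in> range rot" for k using assms(2)[of k] c by blast
  moreover have "rot l \<in> (\<lambda>g. h \<circ> g \<circ> inv_into UNIV h) ` range rot" for l
    using assms(3)[of l] c by (metis (no_types, lifting) imageI rangeI)
  ultimately show ?thesis unfolding N_full_iff using h by blast
qed

lemma rot_commute_power: "h \<circ> rot 1 = rot 1 \<circ> h \<Longrightarrow> h \<circ> rot k = rot k \<circ> h"
proof (induction k)
  case (Suc k)
  have "h (rot 1 z) = rot 1 (h z)" "h (rot k z) = rot k (h z)" "rot (Suc k) z = rot 1 (rot k z)" for z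
    using fun_cong[OF Suc.prems, of z] fun_cong[OF Suc.IH[OF Suc.prems], of z]
      fun_cong[OF rot_add[of 1 k], of z] by simp_all
  then show ?case by (intro ext) (simp only: comp_apply)
qed (simp add: rot_0)

lemma N_full_commute:
  assumes "h \<in> carrier Aut_plane" "h \<circ> rot 1 = rot 1 \<circ> h"
  shows "h \<in> N_full d e"
  using assms rot_commute_power[OF assms(2)] by (intro N_fullI) blast+

lemma rot_1: "rot 1 = (\<lambda>(x, y). (\<zeta> ^ e * x, \<zeta> * y))" by (simp add: rot_def)

lemma swap_N_full: "[e\<^sup>2 = 1] (mod d) \<Longrightarrow> swap \<in> N_full d e"
proof (rule N_fullI[OF swap_Aut(1)])
  assume e: "[e\<^sup>2 = 1] (mod d)"
  then have "[e * (e * k) = k] (mod d)" for k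
    using cong_mult[OF e cong_refl[of k]] by (simp add: power2_eq_square mult.assoc)
  then have *: "\<zeta> ^ (e * (e * k)) = \<zeta> ^ k" for k unfolding zeta_eq_iff .
  then have "swap \<circ> rot k = rot (e * k) \<circ> swap" for k by (auto simp: rot_def)
  then show "\<exists>l. swap \<circ> rot k = rot l \<circ> swap" for k by blast
  have "swap \<circ> rot (e * l) = rot l \<circ> swap" for l using * by (auto simp: rot_def)
  then show "\<exists>k. swap \<circ> rot k = rot l \<circ> swap" for l by blast
qed

text \<open>Monomials are eigenvectors of the generator with eigenvalue
  \<open>\<zeta> ^ (e * i + j)\<close>, and a polynomial function determines its
  coefficients.\<close>

lemma semi_invariant_supp:
  assumes "\<And>z. ev P (rot 1 z) = c * ev P z" and "(i, j) \<in> supp P"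
  shows "\<zeta> ^ (e * i + j) = c"
proof -
  define R where "R = (\<Sum>(i, j)\<in>supp P. monom (monom (cf P i j * \<zeta> ^ (e * i + j)) j) i)"
  have cfR: "cf R i j = cf P i j * \<zeta> ^ (e * i + j)" for i j
  proof -
    have "cf R i j = (\<Sum>x\<in>supp P. if x = (i, j) then cf P i j * \<zeta> ^ (e * i + j) else 0)"
      unfolding R_def cf_sum by (intro sum.cong) (auto split: if_splits)
    then show ?thesis using finite_supp[of P] by (auto simp: in_supp)
  qed
  have "ev R (x, y) = ev P (rot 1 (x, y))" for x y
    unfolding rot_1 prod.case ev_expand[of P] R_def ev_sum
    by (intro sum.cong) (auto simp: power_mult_distrib power_add power_mult[symmetric])
  then have "ev R = ev (bconst c * P)" using assms(1) by (auto simp del: mult_pCons_left)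
  then have "R = bconst c * P" unfolding ev_inject .
  then have "cf P i j * \<zeta> ^ (e * i + j) = c * cf P i j" using cfR[of i j] by (metis cf_bconst_mult)
  then show ?thesis using assms(2) by (simp add: in_supp)
qed

lemma shear_N_plus:
  assumes "[q = e] (mod d)"
  shows "(\<lambda>(x, y). (x + c * y ^ q, y)) \<in> N_plus d e"
proof -
  let ?h = "\<lambda>(x, y). (x + c * y ^ q, y)"
  have J: "?h \<in> Jonq_plus"
    unfolding Jonq_plus_def
    by (rule CollectI, rule exI[of _ 1], rule exI[of _ 1], rule exI[of _ "monom c q"]) (simp add: poly_monom)
  have "\<zeta> ^ q = \<zeta> ^ e" using assms unfolding zeta_eq_iff .
  then have "?h \<circ> rot 1 = rot 1 \<circ> ?h" unfolding rot_1 by (auto simp: power_mult_distrib algebra_simps)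
  then show ?thesis unfolding N_plus_def using J N_full_commute Jonq_plus_subset by blast
qed

lemma shear_N_minus:
  assumes "[e * q = 1] (mod d)"
  shows "(\<lambda>(x, y). (x, y + c * x ^ q)) \<in> N_minus d e"
proof -
  let ?h = "\<lambda>(x, y). (x, y + c * x ^ q)"
  have J: "?h \<in> Jonq_minus"
    unfolding Jonq_minus_def
    by (rule CollectI, rule exI[of _ 1], rule exI[of _ 1], rule exI[of _ "monom c q"]) (simp add: poly_monom)
  have "\<zeta> ^ (e * q) = \<zeta> ^ 1" using assms unfolding zeta_eq_iff .
  then have "?h \<circ> rot 1 = rot 1 \<circ> ?h" unfolding rot_1
    by (auto simp: power_mult_distrib power_mult algebra_simps)
  then show ?thesis unfolding N_minus_def
    using J N_full_commute subgroup.subset[OF subgroup_Jonq_minus] by blast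
qed

text \<open>\<open>H\<close> is abstract so that one induction serves all three choices of the
  second factor. It runs on \<open>degx P + degy P\<close> for the first component; composing with a
  shear from \<open>H\<close> lowers this sum, and the shear is cancelled again inside
  \<open>H\<close>.\<close>

theorem N_full_generated:
  assumes H: "subgroup H Aut_plane" "N_plus d e \<subseteq> H" "N_minus d e \<subseteq> H"
    and swap_H: "[e\<^sup>2 = 1] (mod d) \<Longrightarrow> swap \<in> H"
    and "h \<in> N_full d e"
  shows "h \<in> H"
proof -
  have "\<forall>h P Q. h \<in> N_full d e \<longrightarrow> h = (\<lambda>z. (ev P z, ev Q z)) \<longrightarrow> degx P + degy P = n \<longrightarrow> h \<in> H" for n
  proof (induction n rule: less_induct)
    case (less n)
    show ?case
    proof (intro allI impI)
      fix h P Q assume hN: "h \<in> N_full d e" and hPQ: "h = (\<lambda>z. (ev P z, ev Q z))" and n: "degx P + degy P = n"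
      note hA = N_fullD(1)[OF hN]
      obtain P' Q' where PQ': "h = (\<lambda>z. (ev P' z, ev Q' z))" "polynomial_automorphism h (inv_into UNIV h) P' Q'"
        using Aut_plane_components[OF hA] .
      have "ev P' = ev P" "ev Q' = ev Q" using hPQ PQ'(1) by (auto simp: fun_eq_iff)
      then have "P' = P" "Q' = Q" unfolding ev_inject by auto
      then interpret h: polynomial_automorphism h "inv_into UNIV h" P Q using PQ'(2) by simp
      obtain k where k: "h \<circ> rot 1 = rot k \<circ> h" using N_fullD(2)[OF hN] by blast
      have k': "h (\<zeta> ^ e * x, \<zeta> * y) = (\<zeta> ^ (e * k) * fst (h (x, y)), \<zeta> ^ k * snd (h (x, y)))" for x y
        using fun_cong[OF k, of "(x, y)"] by (simp add: rot_def split: prod.splits)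
      have semi: "ev P (rot 1 z) = \<zeta> ^ (e * k) * ev P z" for z
        using fun_cong[OF k, of z] by (simp add: hPQ rot_def)
      have comp: "h \<circ> s \<in> N_full d e" if "s \<in> N_full d e" for s
        using subgroup.m_closed[OF subgroup_N_full hN that] Aut_plane_mult[OF hA N_fullD(1)[OF that]] by simp
      consider "degy P = 0" | "degx P = 0" | "0 < degx P" "0 < degy P" by auto
      then show "h \<in> H"
      proof cases
        case 1
        then obtain \<alpha> \<alpha>0 \<beta> f where f: "\<alpha> \<noteq> 0" "\<beta> \<noteq> 0" "h = (\<lambda>(x, y). (\<alpha> * x + \<alpha>0, \<beta> * y + poly f x))"
          using h.affine_in_x by blast
        \<comment> \<open>The origin is fixed by the cyclic group, so its image is fixed by
          \<open>rot k\<close>. A nonzero first coordinate there forces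
          \<open>\<zeta> ^ (e * k) = 1\<close>, and the point \<open>(1, 0)\<close> then gives
          \<open>\<zeta> ^ e = 1\<close>.\<close>
        have "\<alpha>0 = 0"
        proof (rule ccontr)
          assume a: "\<alpha>0 \<noteq> 0"
          then have 1: "\<zeta> ^ (e * k) = 1" using k'[of 0 0] f(3) by simp
          have "\<alpha> * \<zeta> ^ e = \<alpha>" using k'[of 1 0] f(3) 1 by simp
          then have "\<zeta> ^ e = \<zeta> ^ 0" using f by simp
          then show False unfolding zeta_eq_iff using e_not_0 by blast
        qed
        then have "h \<in> Jonq_minus" using f unfolding Jonq_minus_def by auto
        then show ?thesis using hN H(3) unfolding N_minus_def by blast
      next
        case 2
        then obtain \<alpha> \<alpha>0 \<beta> f where f: "\<alpha> \<noteq> 0" "\<beta> \<noteq> 0" "h = (\<lambda>(x, y). (\<alpha> * y + \<alpha>0, \<beta> * x + poly f y))"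
          using h.affine_in_y by blast
        have "\<alpha>0 = 0"
        proof (rule ccontr)
          assume a: "\<alpha>0 \<noteq> 0"
          then have 1: "\<zeta> ^ (e * k) = 1" using k'[of 0 0] f(3) by simp
          have "\<alpha> * \<zeta> = \<alpha>" using k'[of 0 1] f(3) 1 by simp
          then have "\<zeta> ^ 1 = \<zeta> ^ 0" using f by simp
          then have "[1 = 0] (mod d)" unfolding zeta_eq_iff .
          then show False using d_pos by (simp add: cong_def)
        qed
        \<comment> \<open>The first component is now a multiple of \<open>y\<close>, so
          \<open>h\<close> exchanges the two characters: \<open>e * k\<close> is congruent to 1 and
          \<open>k\<close> to \<open>e\<close>. This case therefore occurs only when the swap
          normalizes the cyclic group.\<close>
        have "\<zeta> ^ (e * k) = \<zeta> ^ 1" using k'[of 0 1] f \<open>\<alpha>0 = 0\<close> by simp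
        then have ek: "[e * k = 1] (mod d)" unfolding zeta_eq_iff .
        have c: "\<zeta> ^ k * poly f 0 = poly f 0" "\<beta> * \<zeta> ^ e + poly f 0 = \<zeta> ^ k * (\<beta> + poly f 0)"
          using k'[of 0 0] k'[of 1 0] f(3) by simp_all
        have "\<beta> * \<zeta> ^ e = \<zeta> ^ k * \<beta>" using c(2) unfolding distrib_left c(1) by (rule add_right_imp_eq)
        then have "\<zeta> ^ e = \<zeta> ^ k" using f by simp
        then have "[e = k] (mod d)" unfolding zeta_eq_iff .
        then have "[e * e = e * k] (mod d)" by (intro cong_mult cong_refl)
        then have e2: "[e\<^sup>2 = 1] (mod d)" using ek cong_trans unfolding power2_eq_square by blast
        have sw: "swap \<circ> h \<in> N_full d e"
          using subgroup.m_closed[OF subgroup_N_full swap_N_full[OF e2] hN] Aut_plane_mult[OF swap_Aut(1) hA] by simp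
        have "swap \<circ> h = (\<lambda>(x, y). (\<beta> * x + poly f y, \<alpha> * y))" using f(3) \<open>\<alpha>0 = 0\<close> by auto
        then have "swap \<circ> h \<in> Jonq_plus" using f(1,2) unfolding Jonq_plus_def by blast
        then have sH: "swap \<circ> h \<in> H" using sw H(2) unfolding N_plus_def by blast
        have "swap \<circ> (swap \<circ> h) = h" by (auto simp: fun_eq_iff split: prod.splits)
        then show ?thesis
          using subgroup.m_closed[OF H(1) swap_H[OF e2] sH] Aut_plane_mult[OF swap_Aut(1) N_fullD(1)[OF sw]] by simp
      next
        case 3
        from h.reduction[OF this] obtain c q l p where
          red: "degx p + degy p < degx P + degy P" and
          cs: "(Suc l, 0) \<in> supp P \<and> (l, q) \<in> supp P \<and> (\<forall>x y. ev p (x, y) = ev P (x + c * y ^ q, y))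
            \<or> (0, Suc l) \<in> supp P \<and> (q, l) \<in> supp P \<and> (\<forall>x y. ev p (x, y) = ev P (x, y + c * x ^ q))"
          by blast
        have "\<exists>s. s \<in> N_full d e \<and> s \<in> H \<and> (\<forall>z. ev p z = ev P (s z))"
          using cs
        proof (elim disjE conjE)
          assume a: "(Suc l, 0) \<in> supp P" "(l, q) \<in> supp P" "\<forall>x y. ev p (x, y) = ev P (x + c * y ^ q, y)"
          \<comment> \<open>All monomials of the semi-invariant \<open>P\<close> carry one
            character; comparing two of them gives \<open>q\<close> congruent to \<open>e\<close>,
            so that the shear is equivariant.\<close>
          have "\<zeta> ^ (e * Suc l + 0) = \<zeta> ^ (e * l + q)"
            using semi_invariant_supp[OF semi a(1)] semi_invariant_supp[OF semi a(2)] by simp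
          then have "\<zeta> ^ q = \<zeta> ^ e" by (simp add: power_add)
          then have "[q = e] (mod d)" unfolding zeta_eq_iff .
          from shear_N_plus[OF this, of c] show ?thesis
            using a(3) H(2) by (intro exI[of _ "\<lambda>(x, y). (x + c * y ^ q, y)"]) (auto simp: N_plus_def)
        next
          assume a: "(0, Suc l) \<in> supp P" "(q, l) \<in> supp P" "\<forall>x y. ev p (x, y) = ev P (x, y + c * x ^ q)"
          have "\<zeta> ^ (e * 0 + Suc l) = \<zeta> ^ (e * q + l)"
            using semi_invariant_supp[OF semi a(1)] semi_invariant_supp[OF semi a(2)] by simp
          then have "\<zeta> ^ (e * q) = \<zeta> ^ 1" by (simp add: power_add)
          then have "[e * q = 1] (mod d)" unfolding zeta_eq_iff .
          from shear_N_minus[OF this, of c] show ?thesis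
            using a(3) H(3) by (intro exI[of _ "\<lambda>(x, y). (x, y + c * x ^ q)"]) (auto simp: N_minus_def)
        qed
        then obtain s where s: "s \<in> N_full d e" "s \<in> H" "\<And>z. ev p z = ev P (s z)" by blast
        have hs: "h \<circ> s \<in> N_full d e" using comp[OF s(1)] .
        obtain Pn Qn where n': "h \<circ> s = (\<lambda>z. (ev Pn z, ev Qn z))"
          using Aut_plane_components[OF N_fullD(1)[OF hs]] .
        have "ev Pn = ev p" using n' s(3) by (auto simp: hPQ fun_eq_iff)
        then have "Pn = p" unfolding ev_inject .
        then have "h \<circ> s \<in> H" using less.IH[of "degx p + degy p"] red n hs n' by blast
        then show ?thesis using subgroup_cancel_right[OF H(1) _ s(2) hA] by blast
      qed
    qed
  qed
  moreover obtain P Q where "h = (\<lambda>z. (ev P z, ev Q z))"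
    using Aut_plane_components[OF N_fullD(1)[OF assms(5)]] .
  ultimately show ?thesis using assms(5) by blast
qed

end

section \<open>Degree growth and the three factors\<close>

text \<open>The degrees of the components of a word along the curve \<open>t \<mapsto> (t\<^sup>2, t\<^sup>3)\<close> grow with its length.
  The exponents 2 and 3 make this point satisfy the invariant \<open>before_plus\<close> both initially and after
  one arbitrary letter of the second factor.\<close>

definition along_curve :: "(plane \<Rightarrow> plane) \<Rightarrow> complex poly \<Rightarrow> complex poly \<Rightarrow> bool" where
  "along_curve h u v \<longleftrightarrow> (\<forall>t. h (t\<^sup>2, t ^ 3) = (poly u t, poly v t))"

text \<open>Under this inequality a polynomial \<open>f\<close> of degree at least 2 gives
  \<open>pcompose f v\<close> a larger degree than \<open>u\<close>, so a letter of the first factor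
  meets no cancellation.\<close>

definition before_plus :: "complex poly \<Rightarrow> complex poly \<Rightarrow> bool" where
  "before_plus u v \<longleftrightarrow> 0 < degree v \<and> degree u < 2 * degree v"

definition after_plus :: "complex poly \<Rightarrow> complex poly \<Rightarrow> bool" where
  "after_plus u v \<longleftrightarrow> 0 < degree v \<and> 2 * degree v \<le> degree u"

definition plus_letter :: "(plane \<Rightarrow> plane) \<Rightarrow> bool" where
  "plus_letter a \<longleftrightarrow> (\<exists>\<alpha> \<beta> f. \<beta> \<noteq> 0 \<and> 2 \<le> degree f \<and> a = (\<lambda>(x, y). (\<alpha> * x + poly f y, \<beta> * y)))"

text \<open>A common interface for the second factors of all three cases. The first conjunct treats
  the rightmost letter of a word, which acts on the curve itself; the second treats a letter applied
  after one of the first factor.\<close>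

definition other_letter :: "(plane \<Rightarrow> plane) \<Rightarrow> bool" where
  "other_letter b \<longleftrightarrow> (\<exists>u v. along_curve b u v \<and> before_plus u v) \<and>
    (\<forall>h u v. along_curve h u v \<and> after_plus u v \<longrightarrow>
      (\<exists>u' v'. along_curve (b \<circ> h) u' v' \<and> before_plus u' v' \<and> degree u \<le> degree v'))"

lemma along_curve_id: "along_curve id (monom 1 2) (monom 1 3)" "before_plus (monom 1 2) (monom 1 3)"
  by (simp_all add: along_curve_def before_plus_def poly_monom degree_monom_eq)

lemma plus_letter_step:
  assumes "plus_letter a" "along_curve h u v" "before_plus u v"
  shows "\<exists>u' v'. along_curve (a \<circ> h) u' v' \<and> after_plus u' v' \<and> degree v' = degree v"
proof -
  obtain \<alpha> \<beta> f where a: "\<beta> \<noteq> 0" "2 \<le> degree f" "a = (\<lambda>(x, y). (\<alpha> * x + poly f y, \<beta> * y))"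
    using assms(1) unfolding plus_letter_def by blast
  have "along_curve (a \<circ> h) (smult \<alpha> u + pcompose f v) (smult \<beta> v)"
    using assms(2) by (simp add: along_curve_def a(3) poly_pcompose)
  moreover have "degree (smult \<alpha> u) < degree (pcompose f v)"
  proof -
    have "degree u < 2 * degree v" using assms(3) unfolding before_plus_def by blast
    also have "\<dots> \<le> degree f * degree v" using a(2) by simp
    finally show ?thesis using degree_smult_le[of \<alpha> u] by (simp add: degree_pcompose)
  qed
  then have "degree (smult \<alpha> u + pcompose f v) = degree f * degree v"
    by (simp add: degree_add_eq_right degree_pcompose)
  then have "after_plus (smult \<alpha> u + pcompose f v) (smult \<beta> v)"
    using a assms(3) by (simp add: after_plus_def before_plus_def)
  ultimately show ?thesis using a(1) by (metis degree_smult_eq)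
qed

text \<open>Letters of \<open>F True\<close> leave \<open>degree v\<close> alone, and a letter of
  \<open>F False\<close> applied after one of them at least doubles it, because
  \<open>2 * degree v \<le> degree u \<le> degree v'\<close>. A bound linear in the length is
  extracted from this.\<close>

lemma reduced_word_growth:
  assumes F: "two_subgroups Aut_plane F" and w: "two_subgroups.reduced_word Aut_plane F n s t w"
    and plus: "\<And>a. a \<in> F True - F False \<Longrightarrow> plus_letter a"
    and other: "\<And>b. b \<in> F False - F True \<Longrightarrow> other_letter b"
  shows "\<exists>u v. along_curve w u v \<and> (if s then after_plus u v \<and> n \<le> 2 * degree v + 1
    else before_plus u v \<and> n \<le> 2 * degree v)"
proof -
  interpret two_subgroups Aut_plane F by (rule F)
  show ?thesis using w
  proof (induction rule: reduced_word.induct)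
    case (letter a s)
    show ?case
    proof (cases s)
      case True
      then have "plus_letter a" using plus letter by auto
      from plus_letter_step[OF this along_curve_id] show ?thesis using True by auto
    next
      case False
      then have "other_letter a" using other letter by auto
      then obtain u v where "along_curve a u v" "before_plus u v" unfolding other_letter_def by blast
      moreover from this have "1 \<le> 2 * degree v" unfolding before_plus_def by simp
      ultimately show ?thesis using False by auto
    qed
  next
    case (Cons a s n t w)
    have "a \<in> carrier Aut_plane" "w \<in> carrier Aut_plane"
      using Cons.hyps reduced_word_closed factor_closed by blast+
    then have comp: "a \<otimes>\<^bsub>Aut_plane\<^esub> w = a \<circ> w" by (rule Aut_plane_mult)
    obtain u v where uv: "along_curve w u v" "if \<not> s then after_plus u v \<and> n \<le> 2 * degree v + 1
      else before_plus u v \<and> n \<le> 2 * degree v" using Cons.IH by blast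
    show ?case
    proof (cases s)
      case True
      then have "plus_letter a" using plus Cons.hyps by auto
      from plus_letter_step[OF this uv(1)] show ?thesis using True uv unfolding comp by fastforce
    next
      case False
      then have "other_letter a" "after_plus u v" using other Cons.hyps uv by auto
      then obtain u' v' where uv': "along_curve (a \<circ> w) u' v'" "before_plus u' v'" "degree u \<le> degree v'"
        using uv(1) unfolding other_letter_def by blast
      have "Suc n \<le> 2 * degree v'"
        using uv uv'(3) \<open>after_plus u v\<close> False unfolding after_plus_def by simp
      then have "\<exists>u v. along_curve (a \<circ> w) u v \<and> before_plus u v \<and> Suc n \<le> 2 * degree v"
        using uv'(1,2) by blast
      then show ?thesis unfolding comp using False by (simp only: if_False)
    qed
  qed
qed

text \<open>The second component is the one whose degree along the curve bounds the length of a
  word.\<close>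

definition bounded_degree :: "(plane \<Rightarrow> plane) set \<Rightarrow> bool" where
  "bounded_degree K \<longleftrightarrow> (\<exists>m. \<forall>h\<in>K. \<exists>v. degree v \<le> m \<and> (\<forall>t. snd (h (t\<^sup>2, t ^ 3)) = poly v t))"

lemma bounded_degree_conjugate:
  assumes "two_subgroups Aut_plane F"
    and plus: "\<And>a. a \<in> F True - F False \<Longrightarrow> plus_letter a"
    and other: "\<And>b. b \<in> F False - F True \<Longrightarrow> other_letter b"
    and K: "subgroup K Aut_plane" "K \<subseteq> generate Aut_plane (F True \<union> F False)" "bounded_degree K"
  shows "\<exists>a\<in>generate Aut_plane (F True \<union> F False). \<exists>s. \<forall>x\<in>K.
    inv\<^bsub>Aut_plane\<^esub> a \<otimes>\<^bsub>Aut_plane\<^esub> x \<otimes>\<^bsub>Aut_plane\<^esub> a \<in> F s"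
proof -
  interpret two_subgroups Aut_plane F by (rule assms(1))
  obtain m where m: "\<And>h. h \<in> K \<Longrightarrow> \<exists>v. degree v \<le> m \<and> (\<forall>t. snd (h (t\<^sup>2, t ^ 3)) = poly v t)"
    using K(3) unfolding bounded_degree_def by blast
  have "n \<le> 2 * m + 1" if w: "w \<in> K" "reduced_word n s t w" for n s t w
  proof -
    obtain u v where uv: "along_curve w u v" "n \<le> 2 * degree v + 1"
      using reduced_word_growth[OF assms(1) w(2)] plus other by (fastforce split: if_splits)
    obtain v' where "degree v' \<le> m" "\<And>t. snd (w (t\<^sup>2, t ^ 3)) = poly v' t" using m[OF w(1)] by blast
    moreover from this have "v' = v"
      using uv(1) unfolding along_curve_def poly_eq_poly_eq_iff[symmetric] by (auto simp: fun_eq_iff)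
    ultimately show ?thesis using uv(2) by simp
  qed
  then show ?thesis by (rule bounded_subgroup_conjugate_into_factor[OF K(1,2)])
qed

lemma low_degree_poly: "degree f < 2 \<Longrightarrow> poly f y = coeff f 0 + coeff f 1 * y"
proof -
  assume "degree f < 2"
  then have "f = [:coeff f 0, coeff f 1:]"
    by (intro poly_eqI) (auto simp: coeff_pCons coeff_eq_0 split: nat.splits)
  then have "poly f y = poly [:coeff f 0, coeff f 1:] y" by simp
  then show ?thesis by (simp add: mult.commute)
qed

section \<open>The linear group, the monomial group and the torus\<close>

lemma GL2_Aut:
  assumes "a * s - b * c \<noteq> 0"
  shows "(\<lambda>(x, y). (a * x + b * y, c * x + s * y)) \<in> carrier Aut_plane" (is "?h \<in> _")
    "m_inv Aut_plane (\<lambda>(x, y). (a * x + b * y, c * x + s * y)) =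
      (\<lambda>(x, y). (s / (a * s - b * c) * x + (- b / (a * s - b * c)) * y,
        (- c / (a * s - b * c)) * x + a / (a * s - b * c) * y))" (is "_ = ?k")
proof -
  have pb: "pulls_back (\<lambda>(x, y). (a * x + b * y, c * x + s * y))" for a b c s
    by (rule pulls_backI[of _ "bconst a * X + bconst b * Y" "bconst c * X + bconst s * Y"])
      (auto split: prod.splits simp del: mult_pCons_left mult_pCons_right)
  define D where "D = a * s - b * c"
  have D: "D \<noteq> 0" using assms by (simp add: D_def)
  have "a * (s / D * x + - b / D * y) + b * (- c / D * x + a / D * y) = x"
     "c * (s / D * x + - b / D * y) + s * (- c / D * x + a / D * y) = y"
     "s / D * (a * x + b * y) + - b / D * (c * x + s * y) = x"
     "- c / D * (a * x + b * y) + a / D * (c * x + s * y) = y" for x y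
    using D by (simp_all add: divide_simps) (simp_all add: D_def algebra_simps)
  then have "?h (?k z) = z" "?k (?h z) = z" for z
    by (cases z; simp add: D_def)+
  then show "?h \<in> carrier Aut_plane" "m_inv Aut_plane ?h = ?k"
    using Aut_planeI[of ?h ?k] pb by blast+
qed

lemma GL2_subset: "GL2 \<subseteq> carrier Aut_plane"
  unfolding GL2_def using GL2_Aut by blast

lemma subgroup_GL2: "subgroup GL2 Aut_plane"
proof
  show "GL2 \<subseteq> carrier Aut_plane" by (rule GL2_subset)
  have "id \<in> GL2"
    unfolding GL2_def
    by (rule CollectI, rule exI[of _ 1], rule exI[of _ 0], rule exI[of _ 0], rule exI[of _ 1]) auto
  then show "\<one>\<^bsub>Aut_plane\<^esub> \<in> GL2" by (simp add: Aut_plane_one)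
next
  fix g h assume gh: "g \<in> GL2" "h \<in> GL2"
  then obtain a b c s a' b' c' s' where g: "g = (\<lambda>(x, y). (a * x + b * y, c * x + s * y))" "a * s - b * c \<noteq> 0"
    and h: "h = (\<lambda>(x, y). (a' * x + b' * y, c' * x + s' * y))" "a' * s' - b' * c' \<noteq> 0"
    unfolding GL2_def by blast
  have e: "g \<circ> h = (\<lambda>(x, y). ((a * a' + b * c') * x + (a * b' + b * s') * y, (c * a' + s * c') * x + (c * b' + s * s') * y))"
    by (auto simp: g(1) h(1) algebra_simps)
  have "(a * a' + b * c') * (c * b' + s * s') - (a * b' + b * s') * (c * a' + s * c') =
    (a * s - b * c) * (a' * s' - b' * c')" by (simp add: algebra_simps)
  then have "(a * a' + b * c') * (c * b' + s * s') - (a * b' + b * s') * (c * a' + s * c') \<noteq> 0"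
    using g(2) h(2) by simp
  then have "g \<circ> h \<in> GL2" unfolding GL2_def e by blast
  then show "g \<otimes>\<^bsub>Aut_plane\<^esub> h \<in> GL2"
    using gh GL2_subset by (simp add: Aut_plane_mult subset_iff)
next
  fix g assume "g \<in> GL2"
  then obtain a b c s where g: "g = (\<lambda>(x, y). (a * x + b * y, c * x + s * y))" "a * s - b * c \<noteq> 0"
    unfolding GL2_def by blast
  let ?D = "a * s - b * c"
  have "s / ?D * (a / ?D) - (- b / ?D) * (- c / ?D) = 1 / ?D"
    using g(2) by (simp add: divide_simps)
  then have "s / ?D * (a / ?D) - (- b / ?D) * (- c / ?D) \<noteq> 0" using g(2) by simp
  then show "m_inv Aut_plane g \<in> GL2"
    unfolding g(1) GL2_Aut(2)[OF g(2)] unfolding GL2_def by blast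
qed

text \<open>The classical description of the normalizer of the torus by diagonal and antidiagonal
  matrices; the explicit shapes make degrees computable.\<close>

definition monomial_group :: "(plane \<Rightarrow> plane) set" where
  "monomial_group = torus \<union> (\<lambda>h. swap \<circ> h) ` torus"

lemma torus_memI: "a \<noteq> 0 \<Longrightarrow> s \<noteq> 0 \<Longrightarrow> (\<lambda>(x, y). (a * x, s * y)) \<in> torus"
  unfolding torus_def by blast

lemma monomial_group_cases:
  assumes "h \<in> monomial_group"
  obtains (diag) a s where "a \<noteq> 0" "s \<noteq> 0" "h = (\<lambda>(x, y). (a * x, s * y))"
  | (anti) a s where "a \<noteq> 0" "s \<noteq> 0" "h = (\<lambda>(x, y). (a * y, s * x))"
proof -
  from assms consider "h \<in> torus" | g where "g \<in> torus" "h = swap \<circ> g" unfolding monomial_group_def by blast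
  then show thesis
  proof cases
    case 1
    then show ?thesis using diag unfolding torus_def by blast
  next
    case 2
    then obtain a s where "a \<noteq> 0" "s \<noteq> 0" "g = (\<lambda>(x, y). (a * x, s * y))" unfolding torus_def by blast
    moreover from this have "h = (\<lambda>(x, y). (s * y, a * x))" using 2(2) by auto
    ultimately show ?thesis using anti by blast
  qed
qed

lemma monomial_diag: "a \<noteq> 0 \<Longrightarrow> s \<noteq> 0 \<Longrightarrow> (\<lambda>(x, y). (a * x, s * y)) \<in> monomial_group"
  unfolding monomial_group_def using torus_memI by blast

lemma monomial_anti: "a \<noteq> 0 \<Longrightarrow> s \<noteq> 0 \<Longrightarrow> (\<lambda>(x, y). (a * y, s * x)) \<in> monomial_group"
proof -
  assume "a \<noteq> 0" "s \<noteq> 0"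
  then have "(\<lambda>(x, y). (s * x, a * y)) \<in> torus" by (intro torus_memI)
  moreover have "(\<lambda>(x, y). (a * y, s * x)) = swap \<circ> (\<lambda>(x, y). (s * x, a * y))" by auto
  ultimately show ?thesis unfolding monomial_group_def by blast
qed

lemma diag_GL2: "a \<noteq> 0 \<Longrightarrow> s \<noteq> 0 \<Longrightarrow> (\<lambda>(x, y). (a * x, s * y)) \<in> GL2"
  unfolding GL2_def
  by (rule CollectI, rule exI[of _ a], rule exI[of _ 0], rule exI[of _ 0], rule exI[of _ s]) simp

lemma anti_GL2: "a \<noteq> 0 \<Longrightarrow> s \<noteq> 0 \<Longrightarrow> (\<lambda>(x, y). (a * y, s * x)) \<in> GL2"
  unfolding GL2_def
  by (rule CollectI, rule exI[of _ 0], rule exI[of _ a], rule exI[of _ s], rule exI[of _ 0]) simp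

lemma monomial_group_GL2: "monomial_group \<subseteq> GL2"
proof
  fix h assume "h \<in> monomial_group"
  then show "h \<in> GL2" by (cases rule: monomial_group_cases) (simp_all add: diag_GL2 anti_GL2)
qed

lemma diag_inv: "a \<noteq> 0 \<Longrightarrow> s \<noteq> 0 \<Longrightarrow> m_inv Aut_plane (\<lambda>(x, y). (a * x, s * y)) = (\<lambda>(x, y). (1 / a * x, 1 / s * y))"
  using GL2_Aut(2)[of a s 0 0] by simp

lemma anti_inv: "a \<noteq> 0 \<Longrightarrow> s \<noteq> 0 \<Longrightarrow> m_inv Aut_plane (\<lambda>(x, y). (a * y, s * x)) = (\<lambda>(x, y). (1 / s * y, 1 / a * x))"
  using GL2_Aut(2)[of 0 0 a s] by (simp add: mult.commute)

lemma subgroup_monomial_group: "subgroup monomial_group Aut_plane"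
proof
  show sub: "monomial_group \<subseteq> carrier Aut_plane" using monomial_group_GL2 GL2_subset by blast
  have "id = (\<lambda>(x, y). (1 * x :: complex, 1 * y :: complex))" by auto
  then show "\<one>\<^bsub>Aut_plane\<^esub> \<in> monomial_group"
    unfolding Aut_plane_one using monomial_diag[of 1 1] by simp
  fix g assume g: "g \<in> monomial_group"
  then show "m_inv Aut_plane g \<in> monomial_group"
  proof (cases rule: monomial_group_cases)
    case (diag a s)
    then show ?thesis using diag_inv[of a s] monomial_diag[of "1 / a" "1 / s"] by simp
  next
    case (anti a s)
    then show ?thesis using anti_inv[of a s] monomial_anti[of "1 / s" "1 / a"] by simp
  qed
  fix h assume h: "h \<in> monomial_group"
  have "g \<circ> h \<in> monomial_group"
    using g
  proof (cases rule: monomial_group_cases)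
    case (diag a s)
    from h show ?thesis
    proof (cases rule: monomial_group_cases)
      case d: (diag b t)
      have "g \<circ> h = (\<lambda>(x, y). ((a * b) * x, (s * t) * y))" by (auto simp: diag d)
      then show ?thesis using monomial_diag[of "a * b" "s * t"] diag d by simp
    next
      case d: (anti b t)
      have "g \<circ> h = (\<lambda>(x, y). ((a * b) * y, (s * t) * x))" by (auto simp: diag d)
      then show ?thesis using monomial_anti[of "a * b" "s * t"] diag d by simp
    qed
  next
    case (anti a s)
    from h show ?thesis
    proof (cases rule: monomial_group_cases)
      case d: (diag b t)
      have "g \<circ> h = (\<lambda>(x, y). ((a * t) * y, (s * b) * x))" by (auto simp: anti d)
      then show ?thesis using monomial_anti[of "a * t" "s * b"] anti d by simp
    next
      case d: (anti b t)
      have "g \<circ> h = (\<lambda>(x, y). ((a * t) * x, (s * b) * y))" by (auto simp: anti d)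
      then show ?thesis using monomial_diag[of "a * t" "s * b"] anti d by simp
    qed
  qed
  then show "g \<otimes>\<^bsub>Aut_plane\<^esub> h \<in> monomial_group"
    using g h sub by (simp add: Aut_plane_mult subset_iff)
qed

text \<open>Conjugation fixes or exchanges the two diagonal entries.\<close>

lemma monomial_group_normalizes_torus:
  assumes b: "b \<in> monomial_group" and t: "t \<in> torus"
  shows "b \<otimes>\<^bsub>Aut_plane\<^esub> t \<otimes>\<^bsub>Aut_plane\<^esub> inv\<^bsub>Aut_plane\<^esub> b \<in> torus"
proof -
  obtain p q where t': "p \<noteq> 0" "q \<noteq> 0" "t = (\<lambda>(x, y). (p * x, q * y))" using t unfolding torus_def by blast
  have c: "b \<in> carrier Aut_plane" "t \<in> carrier Aut_plane"
    using b t' monomial_group_GL2 GL2_subset diag_GL2[OF t'(1,2)] by auto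
  then have "b \<otimes>\<^bsub>Aut_plane\<^esub> t \<otimes>\<^bsub>Aut_plane\<^esub> inv\<^bsub>Aut_plane\<^esub> b = b \<circ> t \<circ> inv\<^bsub>Aut_plane\<^esub> b"
    by (metis Aut_plane_mult plane.inv_closed plane.m_closed)
  also have "\<dots> \<in> torus"
    using b
  proof (cases rule: monomial_group_cases)
    case (diag a s)
    then have "b \<circ> t \<circ> inv\<^bsub>Aut_plane\<^esub> b = (\<lambda>(x, y). (p * x, q * y))"
      by (auto simp: diag_inv t'(3))
    then show ?thesis using t' torus_memI by simp
  next
    case (anti a s)
    then have "b \<circ> t \<circ> inv\<^bsub>Aut_plane\<^esub> b = (\<lambda>(x, y). (q * x, p * y))"
      by (auto simp: anti_inv t'(3))
    then show ?thesis using t' torus_memI by simp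
  qed
  finally show ?thesis .
qed

lemma monomial_group_normalizer_torus: "monomial_group \<subseteq> normalizer_torus"
proof
  fix b assume b: "b \<in> monomial_group"
  let ?G = "Aut_plane\<lparr>carrier := GL2\<rparr>"
  have bG: "b \<in> GL2" using b monomial_group_GL2 by blast
  have bA: "b \<in> carrier Aut_plane" using bG GL2_subset by blast
  have tG: "torus \<subseteq> GL2" using monomial_group_GL2 unfolding monomial_group_def by blast
  have inv: "inv\<^bsub>?G\<^esub> b = inv\<^bsub>Aut_plane\<^esub> b"
    by (rule plane.m_inv_consistent[OF subgroup_GL2 bG])
  have ib: "inv\<^bsub>Aut_plane\<^esub> b \<in> monomial_group"
    by (rule subgroup.m_inv_closed[OF subgroup_monomial_group b])
  have "b <#\<^bsub>?G\<^esub> torus #>\<^bsub>?G\<^esub> (inv\<^bsub>?G\<^esub> b) = (\<lambda>t. b \<otimes>\<^bsub>Aut_plane\<^esub> t \<otimes>\<^bsub>Aut_plane\<^esub> inv\<^bsub>Aut_plane\<^esub> b) ` torus"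
    unfolding inv l_coset_def r_coset_def by auto
  also have "\<dots> = torus"
  proof (intro equalityI subsetI)
    fix t assume t: "t \<in> torus"
    have tA: "t \<in> carrier Aut_plane" using t tG GL2_subset by blast
    let ?t = "inv\<^bsub>Aut_plane\<^esub> b \<otimes>\<^bsub>Aut_plane\<^esub> t \<otimes>\<^bsub>Aut_plane\<^esub> b"
    have m: "?t \<in> torus" using monomial_group_normalizes_torus[OF ib t] bA by simp
    have "t = b \<otimes>\<^bsub>Aut_plane\<^esub> ?t \<otimes>\<^bsub>Aut_plane\<^esub> inv\<^bsub>Aut_plane\<^esub> b"
      using tA bA by (simp add: plane.m_assoc) (simp add: plane.m_assoc[symmetric])
    then show "t \<in> (\<lambda>t. b \<otimes>\<^bsub>Aut_plane\<^esub> t \<otimes>\<^bsub>Aut_plane\<^esub> inv\<^bsub>Aut_plane\<^esub> b) ` torus" by (rule image_eqI[OF _ m])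
  qed (use monomial_group_normalizes_torus[OF b] in blast)
  finally show "b \<in> normalizer_torus"
    unfolding normalizer_torus_def normalizer_def stabilizer_def using bG tG by simp
qed

section \<open>Letters of the factors and the three cases\<close>

context toric_surface
begin

lemma subgroup_N_plus: "subgroup (N_plus d e) Aut_plane"
  unfolding N_plus_def by (intro plane.subgroups_Inter_pair subgroup_N_full subgroup_Jonq_plus)

lemma subgroup_N_minus: "subgroup (N_minus d e) Aut_plane"
  unfolding N_minus_def by (intro plane.subgroups_Inter_pair subgroup_N_full subgroup_Jonq_minus)

lemma diag_N_full: "a \<noteq> 0 \<Longrightarrow> s \<noteq> 0 \<Longrightarrow> (\<lambda>(x, y). (a * x, s * y)) \<in> N_full d e"
proof (rule N_full_commute)
  assume "a \<noteq> 0" "s \<noteq> 0"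
  then show "(\<lambda>(x, y). (a * x, s * y)) \<in> carrier Aut_plane" using diag_GL2 GL2_subset by blast
  show "(\<lambda>(x, y). (a * x, s * y)) \<circ> rot 1 = rot 1 \<circ> (\<lambda>(x, y). (a * x, s * y))"
    unfolding rot_1 by auto
qed

text \<open>Commuting with the generator confines \<open>f\<close> to exponents congruent to
  \<open>e\<close> modulo \<open>d\<close>. Exponent 0 is impossible and exponent 1 requires
  \<open>e = 1\<close>, which leaves little room below degree 2.\<close>

lemma N_plus_cases:
  assumes "h \<in> N_plus d e"
  obtains (letter) "plus_letter h"
  | (diag) a s where "a \<noteq> 0" "s \<noteq> 0" "h = (\<lambda>(x, y). (a * x, s * y))"
  | (linear) a b s where "e = 1" "a \<noteq> 0" "s \<noteq> 0" "h = (\<lambda>(x, y). (a * x + b * y, s * y))"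
proof -
  obtain \<alpha> \<beta> f where h: "\<alpha> \<noteq> 0" "\<beta> \<noteq> 0" "h = (\<lambda>(x, y). (\<alpha> * x + poly f y, \<beta> * y))"
    using assms unfolding N_plus_def Jonq_plus_def by blast
  obtain k where k: "h \<circ> rot 1 = rot k \<circ> h" using N_fullD(2) assms unfolding N_plus_def by blast
  have k': "h (\<zeta> ^ e * x, \<zeta> * y) = (\<zeta> ^ (e * k) * fst (h (x, y)), \<zeta> ^ k * snd (h (x, y)))" for x y
    using fun_cong[OF k, of "(x, y)"] by (simp add: rot_def split: prod.splits)
  \<comment> \<open>The second component is a multiple of \<open>y\<close>, so the normalizing
    relation forces \<open>\<zeta> ^ k = \<zeta>\<close>: \<open>h\<close> commutes with the
    generator.\<close>
  have "\<beta> * \<zeta> = \<zeta> ^ k * \<beta>" using k'[of 0 1] h by simp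
  then have zk: "\<zeta> ^ k = \<zeta>" using h by simp
  then have "\<zeta> ^ (e * k) = \<zeta> ^ e" by (metis mult.commute power_mult)
  then have f: "poly f (\<zeta> * y) = \<zeta> ^ e * poly f y" for y
    using k'[of 0 y] h by simp
  have semi: "ev [:f:] (rot 1 z) = \<zeta> ^ e * ev [:f:] z" for z
    by (cases z) (simp add: rot_1 ev_const_poly f del: One_nat_def)
  have co: "[j = e] (mod d)" if "coeff f j \<noteq> 0" for j
    using semi_invariant_supp[OF semi, of 0 j] that zeta_eq_iff[of j e] by (simp add: in_supp cf_def)
  show thesis
  proof (cases "2 \<le> degree f")
    case True
    then show ?thesis using letter h unfolding plus_letter_def by blast
  next
    case False
    have "coeff f 0 = 0" using co[of 0] e_not_0 by (metis cong_sym)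
    then have f: "poly f y = coeff f 1 * y" for y using low_degree_poly[of f y] False by simp
    show ?thesis
    proof (cases "coeff f 1 = 0")
      case True
      then have "h = (\<lambda>(x, y). (\<alpha> * x, \<beta> * y))" using h f by simp
      then show ?thesis using diag h by blast
    next
      case False
      then have "[1 = e] (mod d)" using co by blast
      then have "e = 1" using e_less d_pos by (simp add: cong_def)
      moreover have "h = (\<lambda>(x, y). (\<alpha> * x + coeff f 1 * y, \<beta> * y))" using h f by simp
      ultimately show ?thesis using linear h by blast
    qed
  qed
qed

text \<open>For every exponent \<open>j\<close> of \<open>f\<close> the product \<open>e * j\<close>
  is congruent to 1, which excludes 0 and, as \<open>e \<noteq> 1\<close>, also 1.\<close>

lemma N_minus_cases:
  assumes "h \<in> N_minus d e" "e \<noteq> 1"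
  obtains (letter) "other_letter h"
  | (diag) a s where "a \<noteq> 0" "s \<noteq> 0" "h = (\<lambda>(x, y). (a * x, s * y))"
proof -
  obtain \<alpha> \<beta> f where h: "\<alpha> \<noteq> 0" "\<beta> \<noteq> 0" "h = (\<lambda>(x, y). (\<alpha> * x, \<beta> * y + poly f x))"
    using assms unfolding N_minus_def Jonq_minus_def by blast
  obtain k where k: "h \<circ> rot 1 = rot k \<circ> h" using N_fullD(2) assms unfolding N_minus_def by blast
  have k': "h (\<zeta> ^ e * x, \<zeta> * y) = (\<zeta> ^ (e * k) * fst (h (x, y)), \<zeta> ^ k * snd (h (x, y)))" for x y
    using fun_cong[OF k, of "(x, y)"] by (simp add: rot_def split: prod.splits)
  have "\<alpha> * \<zeta> ^ e = \<zeta> ^ (e * k) * \<alpha>" using k'[of 1 0] h by simp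
  then have "\<zeta> ^ (e * 1) = \<zeta> ^ (e * k)" using h by simp
  then have "[e * 1 = e * k] (mod d)" unfolding zeta_eq_iff .
  then have "[1 = k] (mod d)" using cong_mult_lcancel_nat[of e d 1 k] coprime by (simp add: coprime_commute)
  then have zk: "\<zeta> ^ k = \<zeta>" using zeta_eq_iff[of 1 k] by simp
  then have f: "poly f (\<zeta> ^ e * x) = \<zeta> * poly f x" for x
    using k'[of x 0] h by simp
  define g where "g = map_poly (\<lambda>c. [:c:]) f"
  have g: "ev g (x, y) = poly f x" for x y
  proof -
    have "poly (map_poly (\<lambda>c. [:c:]) f) [:x:] = [:poly f x:]"
      by (induction f) (auto simp: map_poly_pCons)
    then show ?thesis by (simp add: ev_def g_def)
  qed
  have semi: "ev g (rot 1 z) = \<zeta> * ev g z" for z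
    by (cases z) (simp add: rot_1 g f del: One_nat_def)
  have co: "[e * j = 1] (mod d)" if "coeff f j \<noteq> 0" for j
    using semi_invariant_supp[OF semi, of j 0] that zeta_eq_iff[of "e * j" 1]
    by (simp add: in_supp cf_def g_def coeff_map_poly)
  show thesis
  proof (cases "2 \<le> degree f")
    case True
    \<comment> \<open>The assumption says that \<open>pcompose f u\<close> dominates the other
      summand. It holds on the curve itself because 3 < 2 * 2, and after a letter of
      \<open>N_plus\<close> because then \<open>degree v < degree u\<close>.\<close>
    have step: "before_plus (smult \<alpha> u) (smult \<beta> v + pcompose f u) \<and> degree u \<le> degree (smult \<beta> v + pcompose f u)"
      if "degree v < degree f * degree u" for u v
    proof -
      have "degree (smult \<beta> v) < degree (pcompose f u)"
        using that degree_smult_le[of \<beta> v] by (simp add: degree_pcompose)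
      then have "degree (smult \<beta> v + pcompose f u) = degree f * degree u"
        by (simp add: degree_add_eq_right degree_pcompose)
      moreover have "0 < degree u" using that by (cases "degree u") auto
      moreover have "2 * degree u \<le> degree f * degree u" using True by simp
      ultimately show ?thesis using h unfolding before_plus_def by simp
    qed
    have curve: "along_curve (h \<circ> w) (smult \<alpha> u) (smult \<beta> v + pcompose f u)" if "along_curve w u v" for w u v
      using that by (simp add: along_curve_def h(3) poly_pcompose)
    have "other_letter h"
      unfolding other_letter_def
    proof (intro conjI allI impI)
      show "\<exists>u v. along_curve h u v \<and> before_plus u v"
        using curve[OF along_curve_id(1)] step[of "monom 1 3" "monom 1 2"] True
        by (auto simp: degree_monom_eq)
      fix w u v assume "along_curve w u v \<and> after_plus u v"
      moreover from this have "degree v < degree f * degree u"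
      proof -
        assume a: "along_curve w u v \<and> after_plus u v"
        have "2 * degree u \<le> degree f * degree u" using True by simp
        then show ?thesis using a unfolding after_plus_def by linarith
      qed
      ultimately show "\<exists>u' v'. along_curve (h \<circ> w) u' v' \<and> before_plus u' v' \<and> degree u \<le> degree v'"
        using curve step by blast
    qed
    then show ?thesis by (rule letter)
  next
    case False
    have "\<not> [e * 0 = 1] (mod d)" using d_pos by (simp add: cong_def)
    then have "coeff f 0 = 0" using co by blast
    moreover have "\<not> [e * 1 = 1] (mod d)" using e_less e_pos assms(2) by (simp add: cong_def)
    then have "coeff f 1 = 0" using co by blast
    ultimately have "poly f y = 0" for y using low_degree_poly[of f y] False by simp
    then have "h = (\<lambda>(x, y). (\<alpha> * x, \<beta> * y))" using h by simp
    then show ?thesis using diag h by blast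
  qed
qed

lemma diag_N_plus: "a \<noteq> 0 \<Longrightarrow> s \<noteq> 0 \<Longrightarrow> (\<lambda>(x, y). (a * x, s * y)) \<in> N_plus d e"
  and diag_N_minus: "a \<noteq> 0 \<Longrightarrow> s \<noteq> 0 \<Longrightarrow> (\<lambda>(x, y). (a * x, s * y)) \<in> N_minus d e"
proof -
  assume as: "a \<noteq> 0" "s \<noteq> 0"
  have "(\<lambda>(x, y). (a * x, s * y)) \<in> Jonq_plus"
    unfolding Jonq_plus_def
    by (rule CollectI, rule exI[of _ a], rule exI[of _ s], rule exI[of _ 0]) (simp add: as)
  then show "(\<lambda>(x, y). (a * x, s * y)) \<in> N_plus d e" unfolding N_plus_def using diag_N_full[OF as] by blast
  have "(\<lambda>(x, y). (a * x, s * y)) \<in> Jonq_minus"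
    unfolding Jonq_minus_def
    by (rule CollectI, rule exI[of _ a], rule exI[of _ s], rule exI[of _ 0]) (simp add: as)
  then show "(\<lambda>(x, y). (a * x, s * y)) \<in> N_minus d e" unfolding N_minus_def using diag_N_full[OF as] by blast
qed

text \<open>The three cases share the first factor and differ only in \<open>B\<close>. The
  conjugating element stays in the normalizer because both factors do.\<close>

lemma conjugate_into_factor:
  assumes B: "subgroup B Aut_plane" "B \<subseteq> N_full d e"
    and plus: "\<And>a. a \<in> N_plus d e - B \<Longrightarrow> plus_letter a"
    and other: "\<And>b. b \<in> B - N_plus d e \<Longrightarrow> other_letter b"
    and gen: "N_full d e \<subseteq> generate Aut_plane (N_plus d e \<union> B)"
    and K: "subgroup K Aut_plane" "K \<subseteq> N_full d e" "bounded_degree K"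
  obtains a where "a \<in> N_full d e"
    "(\<forall>x\<in>K. inv\<^bsub>Aut_plane\<^esub> a \<otimes>\<^bsub>Aut_plane\<^esub> x \<otimes>\<^bsub>Aut_plane\<^esub> a \<in> N_plus d e) \<or>
     (\<forall>x\<in>K. inv\<^bsub>Aut_plane\<^esub> a \<otimes>\<^bsub>Aut_plane\<^esub> x \<otimes>\<^bsub>Aut_plane\<^esub> a \<in> B)"
proof -
  define F where "F = (\<lambda>s. if s then N_plus d e else B)"
  have F: "F True = N_plus d e" "F False = B" by (simp_all add: F_def)
  have "two_subgroups Aut_plane F"
    using B(1) subgroup_N_plus
    by (intro two_subgroups.intro two_subgroups_axioms.intro group_Aut_plane) (simp add: F_def)
  then have "\<exists>a\<in>generate Aut_plane (F True \<union> F False). \<exists>s. \<forall>x\<in>K.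
      inv\<^bsub>Aut_plane\<^esub> a \<otimes>\<^bsub>Aut_plane\<^esub> x \<otimes>\<^bsub>Aut_plane\<^esub> a \<in> F s"
    by (rule bounded_degree_conjugate) (use plus other gen K in \<open>auto simp: F\<close>)
  then obtain a s where a: "a \<in> generate Aut_plane (N_plus d e \<union> B)"
    "\<forall>x\<in>K. inv\<^bsub>Aut_plane\<^esub> a \<otimes>\<^bsub>Aut_plane\<^esub> x \<otimes>\<^bsub>Aut_plane\<^esub> a \<in> F s" unfolding F by blast
  have "N_plus d e \<union> B \<subseteq> N_full d e" using B(2) unfolding N_plus_def by blast
  then have "generate Aut_plane (N_plus d e \<union> B) \<subseteq> N_full d e"
    by (rule plane.generate_subgroup_incl[OF _ subgroup_N_full])
  then show thesis using that[of a] a by (cases s) (auto simp: F)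
qed

text \<open>Conjugation by the swap, which here normalizes the cyclic group, carries
  \<open>N_minus\<close> into \<open>N_plus\<close>.\<close>

lemma N_minus_generated_by_swap:
  assumes H: "subgroup H Aut_plane" "N_plus d e \<subseteq> H" "swap \<in> H" and e2: "[e\<^sup>2 = 1] (mod d)"
  shows "N_minus d e \<subseteq> H"
proof
  fix h assume h: "h \<in> N_minus d e"
  have hN: "h \<in> N_full d e" "h \<in> Jonq_minus" using h unfolding N_minus_def by auto
  note swN = swap_N_full[OF e2]
  have c: "swap \<circ> g \<circ> swap = swap \<otimes>\<^bsub>Aut_plane\<^esub> g \<otimes>\<^bsub>Aut_plane\<^esub> swap" if "g \<in> carrier Aut_plane" for g
    using that swap_Aut(1) by (simp add: Aut_plane_mult[symmetric])
  have "swap \<circ> h \<circ> swap \<in> N_full d e"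
    unfolding c[OF N_fullD(1)[OF hN(1)]] by (intro subgroup.m_closed[OF subgroup_N_full] swN hN)
  then have p: "swap \<circ> h \<circ> swap \<in> N_plus d e" using hN(2) swap_conj_Jonq unfolding N_plus_def by blast
  have pA: "swap \<circ> h \<circ> swap \<in> carrier Aut_plane" using p subgroup.mem_carrier[OF subgroup_N_plus] by blast
  have "swap \<circ> (swap \<circ> h \<circ> swap) \<circ> swap \<in> H"
    unfolding c[OF pA] by (intro subgroup.m_closed[OF H(1)] H(3) subsetD[OF H(2) p])
  moreover have "swap \<circ> (swap \<circ> h \<circ> swap) \<circ> swap = h" by (auto simp: fun_eq_iff split: prod.splits)
  ultimately show "h \<in> H" by simp
qed

lemma N_full_subset_generate:
  assumes "B \<subseteq> carrier Aut_plane" "N_minus d e \<subseteq> generate Aut_plane (N_plus d e \<union> B)"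
    "[e\<^sup>2 = 1] (mod d) \<Longrightarrow> swap \<in> B"
  shows "N_full d e \<subseteq> generate Aut_plane (N_plus d e \<union> B)"
proof
  fix h assume h: "h \<in> N_full d e"
  show "h \<in> generate Aut_plane (N_plus d e \<union> B)"
  proof (rule N_full_generated[OF _ _ assms(2) _ h])
    show "subgroup (generate Aut_plane (N_plus d e \<union> B)) Aut_plane"
      using assms(1) subgroup.subset[OF subgroup_N_plus] by (intro plane.generate_is_subgroup) auto
  qed (use assms(3) in \<open>auto intro: generate.incl\<close>)
qed

lemma N_minus_subset_generate:
  assumes "B \<subseteq> carrier Aut_plane" "swap \<in> B" "[e\<^sup>2 = 1] (mod d)"
  shows "N_minus d e \<subseteq> generate Aut_plane (N_plus d e \<union> B)"
proof (rule N_minus_generated_by_swap[OF _ _ _ assms(3)])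
  show "subgroup (generate Aut_plane (N_plus d e \<union> B)) Aut_plane"
    using assms(1) subgroup.subset[OF subgroup_N_plus] by (intro plane.generate_is_subgroup) auto
qed (use assms(2) in \<open>auto intro: generate.incl\<close>)

lemma swap_monomial: "swap \<in> monomial_group"
  using monomial_anti[of 1 1] by simp

theorem conjugate_generic:
  assumes e2: "\<not> [e\<^sup>2 = 1] (mod d)"
    and K: "subgroup K Aut_plane" "K \<subseteq> N_full d e" "bounded_degree K"
  obtains a where "a \<in> N_full d e"
    "(\<forall>x\<in>K. inv\<^bsub>Aut_plane\<^esub> a \<otimes>\<^bsub>Aut_plane\<^esub> x \<otimes>\<^bsub>Aut_plane\<^esub> a \<in> N_plus d e) \<or>
     (\<forall>x\<in>K. inv\<^bsub>Aut_plane\<^esub> a \<otimes>\<^bsub>Aut_plane\<^esub> x \<otimes>\<^bsub>Aut_plane\<^esub> a \<in> N_minus d e)"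
proof (rule conjugate_into_factor[OF subgroup_N_minus _ _ _ _ K])
  have e1: "e \<noteq> 1" using e2 by auto
  show "N_minus d e \<subseteq> N_full d e" unfolding N_minus_def by blast
  show "plus_letter a" if "a \<in> N_plus d e - N_minus d e" for a
    using DiffD1[OF that]
  proof (cases rule: N_plus_cases)
    case (diag p s)
    then show ?thesis using that diag_N_minus by simp
  qed (use e1 in auto)
  show "other_letter b" if "b \<in> N_minus d e - N_plus d e" for b
    using DiffD1[OF that] e1
  proof (cases rule: N_minus_cases)
    case (diag p s)
    then show ?thesis using that diag_N_plus by simp
  qed
  show "N_full d e \<subseteq> generate Aut_plane (N_plus d e \<union> N_minus d e)"
    using e2 by (intro N_full_subset_generate subgroup.subset[OF subgroup_N_minus]) (auto intro: generate.incl)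
qed (use that in blast)

text \<open>The swap lies in the normalizer and conjugates \<open>N_plus\<close> to
  \<open>N_minus\<close>, so the second factor can shrink to diagonal and antidiagonal maps.\<close>

theorem conjugate_involutive:
  assumes e2: "[e\<^sup>2 = 1] (mod d)" and e1: "e \<noteq> 1"
    and K: "subgroup K Aut_plane" "K \<subseteq> N_full d e" "bounded_degree K"
  obtains a where "a \<in> N_full d e"
    "(\<forall>x\<in>K. inv\<^bsub>Aut_plane\<^esub> a \<otimes>\<^bsub>Aut_plane\<^esub> x \<otimes>\<^bsub>Aut_plane\<^esub> a \<in> N_plus d e) \<or>
     (\<forall>x\<in>K. inv\<^bsub>Aut_plane\<^esub> a \<otimes>\<^bsub>Aut_plane\<^esub> x \<otimes>\<^bsub>Aut_plane\<^esub> a \<in> monomial_group)"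
proof (rule conjugate_into_factor[OF subgroup_monomial_group _ _ _ _ K])
  show "monomial_group \<subseteq> N_full d e"
  proof
    fix h assume "h \<in> monomial_group"
    then show "h \<in> N_full d e"
    proof (cases rule: monomial_group_cases)
      case (anti a s)
      have "swap \<otimes>\<^bsub>Aut_plane\<^esub> (\<lambda>(x, y). (s * x, a * y)) \<in> N_full d e"
        using anti by (intro subgroup.m_closed[OF subgroup_N_full] swap_N_full[OF e2] diag_N_full)
      moreover have "swap \<otimes>\<^bsub>Aut_plane\<^esub> (\<lambda>(x, y). (s * x, a * y)) = h"
        using Aut_plane_mult[OF swap_Aut(1) N_fullD(1)[OF diag_N_full[of s a]]] anti by auto
      ultimately show ?thesis by simp
    qed (simp add: diag_N_full)
  qed
  show "plus_letter a" if "a \<in> N_plus d e - monomial_group" for a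
    using DiffD1[OF that]
  proof (cases rule: N_plus_cases)
    case (diag p s)
    then show ?thesis using that monomial_diag by simp
  qed (use e1 in auto)
  show "other_letter b" if "b \<in> monomial_group - N_plus d e" for b
    using DiffD1[OF that]
  proof (cases rule: monomial_group_cases)
    case (diag p s)
    then show ?thesis using that diag_N_plus by simp
  next
    case (anti p s)
    have curve: "along_curve (b \<circ> h) (smult p v) (smult s u)" if "along_curve h u v" for h u v
      using that by (simp add: along_curve_def anti)
    show ?thesis
      unfolding other_letter_def
    proof (intro conjI allI impI)
      \<comment> \<open>An antidiagonal letter turns the exponents (2, 3) of the curve into (3, 2),
        and still 3 < 2 * 2.\<close>
      have "before_plus (smult p (monom 1 3)) (smult s (monom 1 2))"
        using anti by (simp add: before_plus_def degree_monom_eq)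
      then show "\<exists>u v. along_curve b u v \<and> before_plus u v"
        using curve[OF along_curve_id(1)] by auto
      fix h u v assume a: "along_curve h u v \<and> after_plus u v"
      then have "before_plus (smult p v) (smult s u) \<and> degree u \<le> degree (smult s u)"
        using anti by (auto simp: before_plus_def after_plus_def)
      then show "\<exists>u' v'. along_curve (b \<circ> h) u' v' \<and> before_plus u' v' \<and> degree u \<le> degree v'"
        using curve a by blast
    qed
  qed
  have sub: "monomial_group \<subseteq> carrier Aut_plane" by (rule subgroup.subset[OF subgroup_monomial_group])
  show "N_full d e \<subseteq> generate Aut_plane (N_plus d e \<union> monomial_group)"
    by (intro N_full_subset_generate N_minus_subset_generate sub swap_monomial e2)
qed (use that in blast)

text \<open>For \<open>e = 1\<close> the cyclic group consists of scalars, so every linear map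
  commutes with it; the triangular ones form the common part of the two factors.\<close>

theorem conjugate_linear:
  assumes e1: "e = 1"
    and K: "subgroup K Aut_plane" "K \<subseteq> N_full d e" "bounded_degree K"
  obtains a where "a \<in> N_full d e"
    "(\<forall>x\<in>K. inv\<^bsub>Aut_plane\<^esub> a \<otimes>\<^bsub>Aut_plane\<^esub> x \<otimes>\<^bsub>Aut_plane\<^esub> a \<in> N_plus d e) \<or>
     (\<forall>x\<in>K. inv\<^bsub>Aut_plane\<^esub> a \<otimes>\<^bsub>Aut_plane\<^esub> x \<otimes>\<^bsub>Aut_plane\<^esub> a \<in> GL2)"
proof (rule conjugate_into_factor[OF subgroup_GL2 _ _ _ _ K])
  have e2: "[e\<^sup>2 = 1] (mod d)" using e1 by simp
  show GL2_N: "GL2 \<subseteq> N_full d e"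
  proof
    fix h assume h: "h \<in> GL2"
    then obtain a b c s where "h = (\<lambda>(x, y). (a * x + b * y, c * x + s * y))" unfolding GL2_def by blast
    then have "h \<circ> rot 1 = rot 1 \<circ> h" unfolding rot_1 by (auto simp: e1 algebra_simps)
    then show "h \<in> N_full d e" using h GL2_subset N_full_commute by blast
  qed
  show "plus_letter a" if "a \<in> N_plus d e - GL2" for a
    using DiffD1[OF that]
  proof (cases rule: N_plus_cases)
    case (diag p s)
    then show ?thesis using that diag_GL2 by simp
  next
    case (linear p q s)
    have "a \<in> GL2"
      unfolding GL2_def
      by (rule CollectI, rule exI[of _ p], rule exI[of _ q], rule exI[of _ 0], rule exI[of _ s]) (simp add: linear)
    then show ?thesis using that by blast
  qed
  show "other_letter h" if h: "h \<in> GL2 - N_plus d e" for h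
  proof -
    obtain a b c s where abcs: "h = (\<lambda>(x, y). (a * x + b * y, c * x + s * y))" "a * s - b * c \<noteq> 0"
      using h unfolding GL2_def by blast
    have c: "c \<noteq> 0"
    proof
      assume c: "c = 0"
      have "h \<in> Jonq_plus"
        unfolding Jonq_plus_def
        by (rule CollectI, rule exI[of _ a], rule exI[of _ s], rule exI[of _ "[:0, b:]"])
          (use abcs c in \<open>auto simp: mult.commute\<close>)
      then show False using h GL2_N unfolding N_plus_def by blast
    qed
    have curve: "along_curve (h \<circ> w) (smult a u + smult b v) (smult c u + smult s v)" if "along_curve w u v" for w u v
      using that by (simp add: along_curve_def abcs)
    show ?thesis
      unfolding other_letter_def
    proof (intro conjI allI impI)
      \<comment> \<open>The entry \<open>s\<close> may vanish, so the second degree is only known to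
        be at least 2; the first is at most 3, below 2 * 2.\<close>
      have "2 \<le> degree (smult c (monom 1 2) + smult s (monom 1 3))"
        using c by (intro le_degree) simp
      moreover have "degree (smult a (monom 1 2) + smult b (monom (1 :: complex) 3)) \<le> 3"
        by (intro degree_add_le order_trans[OF degree_smult_le] order_trans[OF degree_monom_le]) auto
      ultimately show "\<exists>u v. along_curve h u v \<and> before_plus u v"
        using curve[OF along_curve_id(1)] unfolding before_plus_def
        by (intro exI[of _ "smult a (monom 1 2) + smult b (monom 1 3)"] exI[of _ "smult c (monom 1 2) + smult s (monom 1 3)"]) simp
      fix w u v assume w: "along_curve w u v \<and> after_plus u v"
      then have deg: "degree v < degree u" unfolding after_plus_def by simp
      then have "degree (smult s v) < degree (smult c u)" using c degree_smult_le[of s v] by simp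
      then have v': "degree (smult c u + smult s v) = degree u" using c by (simp add: degree_add_eq_left)
      have "degree (smult a u + smult b v) \<le> degree u"
        using deg by (intro degree_add_le order_trans[OF degree_smult_le]) auto
      then have "before_plus (smult a u + smult b v) (smult c u + smult s v)"
        unfolding before_plus_def v' using deg by simp
      then show "\<exists>u' v'. along_curve (h \<circ> w) u' v' \<and> before_plus u' v' \<and> degree u \<le> degree v'"
        using curve w v' by (metis order_refl)
    qed
  qed
  have "swap \<in> GL2" using swap_monomial monomial_group_GL2 by blast
  then show "N_full d e \<subseteq> generate Aut_plane (N_plus d e \<union> GL2)"
    by (intro N_full_subset_generate N_minus_subset_generate GL2_subset e2)
qed (use that in blast)

end

section \<open>Lifting automorphisms of the surface\<close>

lemma unit_bpoly: "(w :: complex poly poly) dvd 1 \<Longrightarrow> \<exists>c. c \<noteq> 0 \<and> w = bconst c"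
  by (auto simp: is_unit_poly_iff)

text \<open>The root is \<open>gcd f k\<close> up to a constant: \<open>gcd f k ^ n\<close> is the
  gcd of \<open>f ^ n\<close> and \<open>f * g\<close>, which is \<open>f\<close> up to a unit as
  \<open>f ^ (n - 1)\<close> and \<open>g\<close> are coprime. The unit is a complex constant and
  has an \<open>n\<close>-th root.\<close>

lemma coprime_factor_power:
  fixes f g k :: "complex poly poly"
  assumes "coprime f g" "f * g = k ^ n" "0 < n"
  shows "\<exists>u. f = u ^ n"
proof (cases "f = 0")
  case True
  then show ?thesis using assms(3) by (intro exI[of _ 0]) simp
next
  case False
  have cop: "coprime (f ^ (n - 1)) g" using assms(1) by simp
  have "gcd f k ^ n = gcd (f ^ n) (f * g)" unfolding assms(2) by (rule gcd_exp[symmetric])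
  also have "f ^ n = f * f ^ (n - 1)" using assms(3) by (cases n) auto
  also have "gcd (f * f ^ (n - 1)) (f * g) = normalize f"
    unfolding gcd_mult_left coprime_imp_gcd_eq_1[OF cop] by simp
  finally have "gcd f k ^ n = normalize f" .
  then have "f = gcd f k ^ n * unit_factor f" by (metis mult.commute unit_factor_mult_normalize)
  then obtain w where w: "f = gcd f k ^ n * w" "w dvd 1"
    using unit_factor_is_unit[OF False] by blast
  obtain c where "w = bconst c" using unit_bpoly[OF w(2)] by blast
  moreover obtain c0 where "c0 ^ n = c" using nth_root_exists[OF assms(3)] by blast
  ultimately have "f = (bconst c0 * gcd f k) ^ n"
    using w(1) by (simp add: power_mult_distrib poly_const_pow mult.commute smult_power)
  then show ?thesis by blast
qed

text \<open>Divisibility of powers gives divisibility of the bases, and the quotient is a unit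
  because its \<open>n\<close>-th power is 1.\<close>

lemma equal_powers:
  fixes a b :: "complex poly poly"
  assumes "a ^ n = b ^ n" "0 < n"
  shows "\<exists>c. c ^ n = 1 \<and> a = bconst c * b"
proof (cases "b = 0")
  case True
  then have "a = 0" using assms by (simp add: power_0_left)
  then show ?thesis using True by (intro exI[of _ 1]) simp
next
  case False
  have "b dvd a" using assms by (metis dvd_refl pow_divides_pow_iff)
  then obtain w where w: "a = b * w" by blast
  then have "b ^ n * w ^ n = b ^ n * 1" using assms(1) by (simp add: power_mult_distrib)
  then have wn: "w ^ n = 1" using False by simp
  then have "w dvd 1" using assms(2) by (metis dvd_power dvd_trans dvd_refl)
  then obtain c where c: "w = bconst c" using unit_bpoly by blast
  then have "bconst (c ^ n) = bconst 1" using wn by (simp add: poly_const_pow one_pCons)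
  then have "c ^ n = 1" by simp
  then show ?thesis using w c by (intro exI[of _ c]) (simp add: mult.commute)
qed

lemma ev_map_poly: "ev p (x, y) = poly (map_poly (\<lambda>c. poly c y) p) x"
  by (induction p) (auto simp: ev_def map_poly_pCons)

text \<open>As a polynomial in \<open>x\<close>, \<open>q\<close> has a root for every
  \<open>y\<close> outside the finitely many zeros of its leading coefficient; if \<open>x\<close>
  is absent, a root in \<open>y\<close> gives a whole line.\<close>

lemma infinite_zeros:
  fixes q :: "complex poly poly"
  assumes "q \<noteq> 0" "\<not> q dvd 1"
  shows "infinite {z. ev q z = 0}"
proof (cases "degree q = 0")
  case True
  then obtain c where q: "q = [:c:]" by (rule degree_eq_zeroE)
  have "degree c \<noteq> 0"
  proof
    assume "degree c = 0"
    then obtain a where "c = [:a:]" by (rule degree_eq_zeroE)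
    then show False using assms q by (auto simp: is_unit_poly_iff dvd_field_iff)
  qed
  then obtain y where "poly c y = 0"
    using fundamental_theorem_of_algebra constant_degree by metis
  then have "range (\<lambda>x. (x, y)) \<subseteq> {z. ev q z = 0}" by (auto simp: q ev_const_poly)
  moreover have "infinite (range (\<lambda>x::complex. (x, y)))"
    by (subst finite_image_iff) (auto simp: inj_on_def infinite_UNIV_char_0)
  ultimately show ?thesis using finite_subset by blast
next
  case False
  let ?S = "{y. poly (lead_coeff q) y = 0}"
  have "finite ?S" using assms(1) by (intro poly_roots_finite) simp
  then have inf: "infinite (- ?S)" using infinite_UNIV_char_0[where 'a = complex] by (simp add: finite_compl)
  have "- ?S \<subseteq> snd ` {z. ev q z = 0}"
  proof
    fix y assume "y \<in> - ?S"
    then have "poly (lead_coeff q) y \<noteq> 0" by simp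
    then have "coeff (map_poly (\<lambda>c. poly c y) q) (degree q) \<noteq> 0" by (simp add: coeff_map_poly)
    then have "degree q \<le> degree (map_poly (\<lambda>c. poly c y) q)" by (rule le_degree)
    then have "degree (map_poly (\<lambda>c. poly c y) q) \<noteq> 0" using False by simp
    then obtain x where "poly (map_poly (\<lambda>c. poly c y) q) x = 0"
      using fundamental_theorem_of_algebra constant_degree by metis
    then have "(x, y) \<in> {z. ev q z = 0}" by (simp add: ev_map_poly)
    then show "y \<in> snd ` {z. ev q z = 0}" by force
  qed
  then show ?thesis using inf finite_subset finite_imageI by blast
qed

lemma coprime_of_finite_zeros:
  fixes f g :: "complex poly poly"
  assumes "finite {z. ev f z = 0 \<and> ev g z = 0}"
  shows "coprime f g"
proof (rule coprimeI)
  fix q assume q: "q dvd f" "q dvd g"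
  show "q dvd 1"
  proof (rule ccontr)
    assume u: "\<not> q dvd 1"
    obtain r s where rs: "f = q * r" "g = q * s" using q by (auto elim!: dvdE)
    have sub: "{z. ev q z = 0} \<subseteq> {z. ev f z = 0 \<and> ev g z = 0}" unfolding rs by auto
    show False
    proof (cases "q = 0")
      case True
      then have "{z. ev f z = 0 \<and> ev g z = 0} = UNIV" by (simp add: rs)
      then show False using assms infinite_UNIV_char_0[where 'a = complex] by (simp add: finite_prod)
    next
      case False
      then show False using infinite_zeros[OF False u] sub assms finite_subset by blast
    qed
  qed
qed

section \<open>Points of the surface and descent of the normalizer\<close>

context toric_surface
begin

abbreviation \<A> :: "(plane \<Rightarrow> complex) set" where "\<A> \<equiv> invariant_ring d e"
abbreviation \<X> :: "((plane \<Rightarrow> complex) \<Rightarrow> complex) set" where "\<X> \<equiv> surface d e"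

lemma invariant_iff: "a \<in> \<A> \<longleftrightarrow> a \<in> plane_ring \<and> (\<forall>k. a \<circ> rot k = a)"
  by (auto simp: invariant_ring_def cyclic_group_eq)

lemma invariantI:
  assumes "a \<in> plane_ring" "a \<circ> rot 1 = a"
  shows "a \<in> \<A>"
proof -
  have "a \<circ> rot k = a" for k
  proof (induction k)
    case (Suc k)
    have "a \<circ> rot (Suc k) = a \<circ> rot 1 \<circ> rot k" using rot_add[of 1 k] by (simp add: comp_assoc)
    then show ?case using assms(2) Suc by simp
  qed (simp add: rot_0)
  then show ?thesis using assms(1) invariant_iff by blast
qed

lemma invariant_rot: "a \<in> \<A> \<Longrightarrow> a (rot k z) = a z"
  unfolding invariant_iff by (metis comp_apply)

lemma invariant_const: "(\<lambda>_. c) \<in> \<A>"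
  unfolding invariant_iff plane_ring_def by (auto intro: function_algebra.const)

lemma invariant_add: "a \<in> \<A> \<Longrightarrow> b \<in> \<A> \<Longrightarrow> (\<lambda>z. a z + b z) \<in> \<A>"
  unfolding invariant_iff plane_ring_def by (auto intro: function_algebra.add simp: fun_eq_iff)

lemma invariant_mult: "a \<in> \<A> \<Longrightarrow> b \<in> \<A> \<Longrightarrow> (\<lambda>z. a z * b z) \<in> \<A>"
  unfolding invariant_iff plane_ring_def by (auto intro: function_algebra.mult simp: fun_eq_iff)

lemma surface_hom:
  assumes "\<xi> \<in> \<X>"
  shows "\<xi> (\<lambda>_. c) = c" "a \<in> \<A> \<Longrightarrow> b \<in> \<A> \<Longrightarrow> \<xi> (\<lambda>z. a z + b z) = \<xi> a + \<xi> b"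
    "a \<in> \<A> \<Longrightarrow> b \<in> \<A> \<Longrightarrow> \<xi> (\<lambda>z. a z * b z) = \<xi> a * \<xi> b" "\<xi> \<in> extensional \<A>"
  using assms unfolding surface_def spec_def by blast+

lemma surfaceI:
  assumes "\<xi> \<in> extensional \<A>" "\<And>c. \<xi> (\<lambda>_. c) = c"
    "\<And>a b. a \<in> \<A> \<Longrightarrow> b \<in> \<A> \<Longrightarrow> \<xi> (\<lambda>z. a z + b z) = \<xi> a + \<xi> b"
    "\<And>a b. a \<in> \<A> \<Longrightarrow> b \<in> \<A> \<Longrightarrow> \<xi> (\<lambda>z. a z * b z) = \<xi> a * \<xi> b"
  shows "\<xi> \<in> \<X>"
  using assms unfolding surface_def spec_def by blast

lemma surface_eqI: "\<xi> \<in> \<X> \<Longrightarrow> \<eta> \<in> \<X> \<Longrightarrow> (\<And>a. a \<in> \<A> \<Longrightarrow> \<xi> a = \<eta> a) \<Longrightarrow> \<xi> = \<eta>"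
  using extensionalityI surface_hom(4) by metis

text \<open>The quotient map from the plane to the surface.\<close>

definition point :: "plane \<Rightarrow> (plane \<Rightarrow> complex) \<Rightarrow> complex" where
  "point z = (\<lambda>a\<in>\<A>. a z)"

lemma point_apply [simp]: "a \<in> \<A> \<Longrightarrow> point z a = a z" by (simp add: point_def)

lemma point_surface: "point z \<in> \<X>"
  by (rule surfaceI) (auto simp: point_def invariant_const invariant_add invariant_mult)

lemma invariant_pow: "a \<in> \<A> \<Longrightarrow> (\<lambda>z. a z ^ n) \<in> \<A>"
proof (induction n)
  case 0
  then show ?case using invariant_const[of 1] by simp
next
  case (Suc n)
  then show ?case using invariant_mult[of a "\<lambda>z. a z ^ n"] by simp
qed

lemma surface_pow: "\<xi> \<in> \<X> \<Longrightarrow> a \<in> \<A> \<Longrightarrow> \<xi> (\<lambda>z. a z ^ n) = \<xi> a ^ n"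
proof (induction n)
  case 0
  then show ?case using surface_hom(1)[of \<xi> 1] by simp
next
  case (Suc n)
  then show ?case using surface_hom(3)[of \<xi> a "\<lambda>z. a z ^ n"] invariant_pow[of a n] by simp
qed

lemma surface_sum:
  assumes "\<xi> \<in> \<X>" "finite I" "\<And>i. i \<in> I \<Longrightarrow> a i \<in> \<A>"
  shows "(\<lambda>z. \<Sum>i\<in>I. a i z) \<in> \<A> \<and> \<xi> (\<lambda>z. \<Sum>i\<in>I. a i z) = (\<Sum>i\<in>I. \<xi> (a i))"
  using assms(2,3)
proof (induction I rule: finite_induct)
  case empty
  then show ?case using invariant_const[of 0] surface_hom(1)[OF assms(1), of 0] by simp
next
  case (insert i I)
  then show ?case
    using invariant_add[of "a i" "\<lambda>z. \<Sum>i\<in>I. a i z"] surface_hom(2)[OF assms(1), of "a i" "\<lambda>z. \<Sum>i\<in>I. a i z"]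
    by simp
qed

definition mon :: "nat \<Rightarrow> nat \<Rightarrow> plane \<Rightarrow> complex" where
  "mon i j = (\<lambda>z. fst z ^ i * snd z ^ j)"

lemma ev_mono: "ev (X ^ i * Y ^ j) = mon i j"
  by (rule ext) (simp add: mon_def)

lemma mono_invariant:
  assumes "[e * i + j = 0] (mod d)" shows "mon i j \<in> \<A>"
proof (rule invariantI)
  show "mon i j \<in> plane_ring" unfolding ev_mono[symmetric] by (rule ev_in_plane_ring)
  have "\<zeta> ^ (e * i + j) = \<zeta> ^ 0" using assms unfolding zeta_eq_iff .
  then have "(\<zeta> ^ e) ^ i * \<zeta> ^ j = 1" by (simp add: power_add power_mult)
  then have z: "(\<zeta> ^ e * x) ^ i * (\<zeta> * y) ^ j = x ^ i * y ^ j" for x y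
    by (simp add: power_mult_distrib)
  show "mon i j \<circ> rot 1 = mon i j"
    unfolding rot_1 mon_def by (rule ext) (auto simp: z split: prod.splits)
qed

text \<open>An invariant is semi-invariant with trivial character, so each of its monomials is
  invariant; a point of the surface is thus determined by its values on invariant monomials.\<close>

lemma invariant_expand:
  assumes "a \<in> \<A>"
  obtains p where "a = ev p" "\<forall>i j. (i, j) \<in> supp p \<longrightarrow> [e * i + j = 0] (mod d)"
    "a = (\<lambda>z. \<Sum>q\<in>supp p. cf p (fst q) (snd q) * mon (fst q) (snd q) z)"
proof -
  obtain p where p: "a = ev p" using assms unfolding invariant_iff plane_ring_ev by blast
  have "ev p (rot 1 z) = 1 * ev p z" for z using invariant_rot[OF assms, of 1 z] p by simp
  from semi_invariant_supp[OF this] have "[e * i + j = 0] (mod d)" if "(i, j) \<in> supp p" for i j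
    using that zeta_eq_iff[of "e * i + j" 0] by simp
  moreover have "a = (\<lambda>z. \<Sum>q\<in>supp p. cf p (fst q) (snd q) * mon (fst q) (snd q) z)"
    unfolding p by (rule ext) (auto simp: ev_expand mon_def case_prod_beta mult.assoc split: prod.splits)
  ultimately show thesis using that p by blast
qed

lemma surface_expand:
  assumes "\<xi> \<in> \<X>" "a = (\<lambda>z. \<Sum>q\<in>supp p. cf p (fst q) (snd q) * mon (fst q) (snd q) z)"
    "\<forall>i j. (i, j) \<in> supp p \<longrightarrow> [e * i + j = 0] (mod d)"
  shows "\<xi> a = (\<Sum>q\<in>supp p. cf p (fst q) (snd q) * \<xi> (mon (fst q) (snd q)))"
proof -
  have m: "mon (fst q) (snd q) \<in> \<A>" if "q \<in> supp p" for q
    using assms(3)[rule_format, of "fst q" "snd q"] that by (intro mono_invariant) simp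
  have m': "(\<lambda>z. c * mon (fst q) (snd q) z) \<in> \<A>" if "q \<in> supp p" for q c
    using invariant_mult[OF invariant_const[of c] m[OF that]] .
  have "\<xi> a = (\<Sum>q\<in>supp p. \<xi> (\<lambda>z. cf p (fst q) (snd q) * mon (fst q) (snd q) z))"
    unfolding assms(2) using surface_sum[OF assms(1) finite_supp[of p], of "\<lambda>q z. cf p (fst q) (snd q) * mon (fst q) (snd q) z"] m'
    by blast
  also have "\<dots> = (\<Sum>q\<in>supp p. cf p (fst q) (snd q) * \<xi> (mon (fst q) (snd q)))"
  proof (rule sum.cong)
    fix q assume q: "q \<in> supp p"
    show "\<xi> (\<lambda>z. cf p (fst q) (snd q) * mon (fst q) (snd q) z) = cf p (fst q) (snd q) * \<xi> (mon (fst q) (snd q))"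
      unfolding surface_hom(3)[OF assms(1) invariant_const m[OF q]] surface_hom(1)[OF assms(1)] ..
  qed simp
  finally show ?thesis .
qed

lemma invariant_comp_N_full:
  assumes "h \<in> N_full d e" "a \<in> \<A>" shows "a \<circ> h \<in> \<A>"
proof (rule invariantI)
  show "a \<circ> h \<in> plane_ring"
    using N_fullD(1)[OF assms(1)] assms(2) unfolding Aut_plane_carrier pulls_back_def invariant_iff by blast
  obtain l where l: "h \<circ> rot 1 = rot l \<circ> h" using N_fullD(2)[OF assms(1)] by blast
  show "a \<circ> h \<circ> rot 1 = a \<circ> h"
  proof
    fix z
    have "h (rot 1 z) = rot l (h z)" using fun_cong[OF l, of z] by (simp only: comp_apply)
    then show "(a \<circ> h \<circ> rot 1) z = (a \<circ> h) z" using invariant_rot[OF assms(2)] by (simp only: comp_apply)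
  qed
qed

lemma pullback_surface:
  assumes "\<And>a. a \<in> \<A> \<Longrightarrow> a \<circ> h \<in> \<A>" "\<xi> \<in> \<X>"
  shows "(\<lambda>a\<in>\<A>. \<xi> (a \<circ> h)) \<in> \<X>"
proof (rule surfaceI)
  fix a b assume ab: "a \<in> \<A>" "b \<in> \<A>"
  show "(\<lambda>a\<in>\<A>. \<xi> (a \<circ> h)) (\<lambda>z. a z + b z) = (\<lambda>a\<in>\<A>. \<xi> (a \<circ> h)) a + (\<lambda>a\<in>\<A>. \<xi> (a \<circ> h)) b"
    using surface_hom(2)[OF assms(2) assms(1)[OF ab(1)] assms(1)[OF ab(2)]] ab
    by (simp add: invariant_add comp_def)
  show "(\<lambda>a\<in>\<A>. \<xi> (a \<circ> h)) (\<lambda>z. a z * b z) = (\<lambda>a\<in>\<A>. \<xi> (a \<circ> h)) a * (\<lambda>a\<in>\<A>. \<xi> (a \<circ> h)) b"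
    using surface_hom(3)[OF assms(2) assms(1)[OF ab(1)] assms(1)[OF ab(2)]] ab
    by (simp add: invariant_mult comp_def)
next
  fix c :: complex
  have "(\<lambda>_. c) \<circ> h = (\<lambda>_. c)" by auto
  then show "(\<lambda>a\<in>\<A>. \<xi> (a \<circ> h)) (\<lambda>_. c) = c"
    using surface_hom(1)[OF assms(2)] by (simp add: invariant_const)
qed auto

lemma descend_surface: "h \<in> N_full d e \<Longrightarrow> \<xi> \<in> \<X> \<Longrightarrow> descend d e h \<xi> \<in> \<X>"
  unfolding descend_def using pullback_surface[OF invariant_comp_N_full] by simp

lemma descend_apply: "\<xi> \<in> \<X> \<Longrightarrow> a \<in> \<A> \<Longrightarrow> descend d e h \<xi> a = \<xi> (a \<circ> h)"
  by (simp add: descend_def)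

text \<open>The order of composition is kept: pulling functions back reverses it, and passing from
  functions to points reverses it again.\<close>

lemma descend_comp:
  assumes "g \<in> N_full d e" "h \<in> N_full d e"
  shows "descend d e (g \<circ> h) = compose \<X> (descend d e g) (descend d e h)"
proof
  fix \<xi>
  show "descend d e (g \<circ> h) \<xi> = compose \<X> (descend d e g) (descend d e h) \<xi>"
  proof (cases "\<xi> \<in> \<X>")
    case True
    have "descend d e (g \<circ> h) \<xi> = (\<lambda>a\<in>\<A>. \<xi> (a \<circ> g \<circ> h))" using True by (simp add: descend_def comp_assoc)
    also have "\<dots> = (\<lambda>a\<in>\<A>. descend d e h \<xi> (a \<circ> g))"
      using True invariant_comp_N_full[OF assms(1)] by (intro restrict_ext) (simp add: descend_apply)
    also have "\<dots> = compose \<X> (descend d e g) (descend d e h) \<xi>"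
      using True descend_surface[OF assms(2) True] by (simp add: compose_def descend_def[of d e g])
    finally show ?thesis .
  qed (simp add: descend_def compose_def)
qed

lemma descend_id: "descend d e id = (\<lambda>\<xi>\<in>\<X>. \<xi>)"
proof
  fix \<xi>
  show "descend d e id \<xi> = (\<lambda>\<xi>\<in>\<X>. \<xi>) \<xi>"
    using surface_hom(4)[of \<xi>] by (cases "\<xi> \<in> \<X>") (auto simp: descend_def intro!: extensionalityI[of _ \<A>])
qed

lemma surface_ring_iff: "b \<in> surface_ring d e \<longleftrightarrow> (\<exists>a\<in>\<A>. b = (\<lambda>\<xi>. \<xi> a))"
  unfolding surface_ring_def spec_ring_def by blast

lemma descend_morphism:
  assumes "h \<in> N_full d e"
  shows "morphism \<X> (surface_ring d e) \<X> (surface_ring d e) (descend d e h)"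
  unfolding morphism_def
proof (intro conjI ballI)
  show "descend d e h \<in> \<X> \<rightarrow> \<X>" using descend_surface[OF assms] by blast
  fix b assume "b \<in> surface_ring d e"
  then obtain a where a: "a \<in> \<A>" "b = (\<lambda>\<xi>. \<xi> a)" unfolding surface_ring_iff by blast
  have "(\<lambda>\<xi>. \<xi> (a \<circ> h)) \<in> surface_ring d e"
    unfolding surface_ring_iff using invariant_comp_N_full[OF assms a(1)] by blast
  then show "\<exists>c\<in>surface_ring d e. \<forall>\<xi>\<in>\<X>. b (descend d e h \<xi>) = c \<xi>"
    using descend_apply[OF _ a(1)] a(2) by auto
qed

lemma descend_carrier:
  assumes h: "h \<in> N_full d e" shows "descend d e h \<in> carrier (Aut_surface d e)"
proof -
  let ?k = "inv\<^bsub>Aut_plane\<^esub> h"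
  have k: "?k \<in> N_full d e" by (rule subgroup.m_inv_closed[OF subgroup_N_full h])
  note hA = N_fullD(1)[OF h] and kA = N_fullD(1)[OF k]
  have "h \<circ> ?k = id" "?k \<circ> h = id"
    using hA kA by (simp_all add: Aut_plane_mult[symmetric] Aut_plane_one[symmetric])
  then have c: "compose \<X> (descend d e h) (descend d e ?k) = (\<lambda>\<xi>\<in>\<X>. \<xi>)"
    "compose \<X> (descend d e ?k) (descend d e h) = (\<lambda>\<xi>\<in>\<X>. \<xi>)"
    using descend_comp[OF h k] descend_comp[OF k h] descend_id by simp_all
  have hk: "descend d e h (descend d e ?k \<xi>) = \<xi>" "descend d e ?k (descend d e h \<xi>) = \<xi>" if "\<xi> \<in> \<X>" for \<xi>
    using fun_cong[OF c(1), of \<xi>] fun_cong[OF c(2), of \<xi>] that by (simp_all add: compose_def)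
  have bij: "bij_betw (descend d e h) \<X> \<X>"
    using hk descend_surface h k by (intro bij_betw_byWitness[of _ "descend d e ?k"]) auto
  have "inv_into \<X> (descend d e h) \<xi> = descend d e ?k \<xi>" if "\<xi> \<in> \<X>" for \<xi>
    using that hk bij descend_surface[OF k that] by (intro inv_into_f_eq) (auto simp: bij_betw_def)
  then have "morphism \<X> (surface_ring d e) \<X> (surface_ring d e) (inv_into \<X> (descend d e h))"
    by (intro morphism_cong[OF _ descend_morphism[OF k]]) simp
  then show ?thesis
    unfolding variety_aut_carrier using bij descend_morphism[OF h] by (auto simp: Bij_def descend_def)
qed

lemma descend_mult:
  assumes "g \<in> N_full d e" "h \<in> N_full d e"
  shows "descend d e (g \<otimes>\<^bsub>Aut_plane\<^esub> h) = descend d e g \<otimes>\<^bsub>Aut_surface d e\<^esub> descend d e h"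
  using descend_comp[OF assms] Aut_plane_mult[OF N_fullD(1)[OF assms(1)] N_fullD(1)[OF assms(2)]]
    descend_carrier[OF assms(1)] descend_carrier[OF assms(2)]
  by (simp add: variety_aut_mult variety_aut_carrier)

lemma descend_inv:
  assumes "h \<in> N_full d e"
  shows "descend d e (inv\<^bsub>Aut_plane\<^esub> h) = inv\<^bsub>Aut_surface d e\<^esub> descend d e h"
proof -
  interpret S: group "Aut_surface d e" by (rule group_variety_aut)
  have k: "inv\<^bsub>Aut_plane\<^esub> h \<in> N_full d e" by (rule subgroup.m_inv_closed[OF subgroup_N_full assms])
  have "descend d e (inv\<^bsub>Aut_plane\<^esub> h) \<otimes>\<^bsub>Aut_surface d e\<^esub> descend d e h = \<one>\<^bsub>Aut_surface d e\<^esub>"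
    unfolding descend_mult[OF k assms, symmetric] using N_fullD(1)[OF assms]
    by (simp add: Aut_plane_one descend_id variety_aut_one)
  then show ?thesis
    using S.inv_equality[OF _ descend_carrier[OF assms] descend_carrier[OF k]] by simp
qed

end

section \<open>Lifts and deck transformations\<close>

context toric_surface
begin

text \<open>The relation that \<open>descend\<close> expresses, for a map not yet known to normalize
  the cyclic group; this is derived once a lift of the inverse is at hand.\<close>

definition lift_of :: "(((plane \<Rightarrow> complex) \<Rightarrow> complex) \<Rightarrow> ((plane \<Rightarrow> complex) \<Rightarrow> complex)) \<Rightarrow> (plane \<Rightarrow> plane) \<Rightarrow> bool" where
  "lift_of \<phi> h \<longleftrightarrow> (\<forall>a\<in>\<A>. a \<circ> h \<in> \<A> \<and> (\<forall>\<xi>\<in>\<X>. \<phi> \<xi> a = \<xi> (a \<circ> h)))"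

lemma e_inverse: obtains e' where "e' < d" "[e * e' = 1] (mod d)"
proof -
  obtain x where "[e * x = 1] (mod d)" using cong_solve_coprime_nat[of e d] coprime by (auto simp: coprime_commute)
  then have "[e * (x mod d) = 1] (mod d)" by (simp add: cong_def mod_mult_right_eq)
  then show thesis using that[of "x mod d"] d_pos by simp
qed

text \<open>The \<open>d\<close>-th power of \<open>x * y ^ (d - e)\<close> is
  \<open>x ^ d * (y ^ d) ^ (d - e)\<close>, with \<open>x ^ d\<close> to the first power;
  \<open>x ^ (d - e') * y\<close> does the same for \<open>y ^ d\<close>, where \<open>e'\<close>
  inverts \<open>e\<close> modulo \<open>d\<close>. This is what lets \<open>d\<close>-th roots be
  extracted.\<close>

lemma mono_generators:
  obtains e' where "e' < d" "mon d 0 \<in> \<A>" "mon 0 d \<in> \<A>" "mon 1 (d - e) \<in> \<A>" "mon (d - e') 1 \<in> \<A>"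
proof -
  obtain e' where e': "e' < d" "[e * e' = 1] (mod d)" by (rule e_inverse)
  have "e * (d - e') + 1 + e * e' = e * d + 1" using e'(1)
    by (simp add: distrib_left[symmetric])
  then have "[e * (d - e') + 1 + e * e' = 0 + e * e'] (mod d)" using e'(2)
    by (metis (no_types, lifting) add.commute add_0 cong_sym cong_trans cong_add_rcancel_0_nat cong_mult_self_right)
  then have 1: "[e * (d - e') + 1 = 0] (mod d)" by (simp only: cong_add_rcancel_nat)
  have "[e * 1 + (d - e) = 0] (mod d)" "[e * d + 0 = 0] (mod d)" "[e * 0 + d = 0] (mod d)"
    using e_less by (simp_all add: cong_def)
  then show thesis using that[OF e'(1)] 1 mono_invariant by blast
qed

text \<open>The \<open>d\<close>-th power of an invariant monomial is a product of powers of
  \<open>x ^ d\<close> and \<open>y ^ d\<close>, so all nonconstant ones vanish at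
  \<open>\<xi>\<close>.\<close>

lemma surface_zero_unique:
  assumes "\<xi> \<in> \<X>" "\<xi> (mon d 0) = 0" "\<xi> (mon 0 d) = 0"
  shows "\<xi> = point (0, 0)"
proof (rule surface_eqI[OF assms(1) point_surface])
  fix a assume a: "a \<in> \<A>"
  obtain p where p: "a = ev p" "\<forall>i j. (i, j) \<in> supp p \<longrightarrow> [e * i + j = 0] (mod d)"
    "a = (\<lambda>z. \<Sum>q\<in>supp p. cf p (fst q) (snd q) * mon (fst q) (snd q) z)" by (rule invariant_expand[OF a], rule that)
  have gens: "mon d 0 \<in> \<A>" "mon 0 d \<in> \<A>" using mono_generators by blast+
  have "\<xi> (mon i j) = mon i j (0, 0)" if ij: "[e * i + j = 0] (mod d)" for i j
  proof (cases "i = 0 \<and> j = 0")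
    case True
    then show ?thesis using surface_hom(1)[OF assms(1), of 1] by (simp add: mon_def)
  next
    case False
    have "(\<lambda>z. mon i j z ^ d) = (\<lambda>z. (mon d 0 z ^ i) * (mon 0 d z ^ j))"
      by (auto simp: mon_def power_mult_distrib power_mult[symmetric] mult.commute)
    then have "\<xi> (mon i j) ^ d = \<xi> (\<lambda>z. (mon d 0 z ^ i) * (mon 0 d z ^ j))"
      using surface_pow[OF assms(1) mono_invariant[OF ij], of d] by simp
    also have "\<dots> = 0 ^ i * 0 ^ j"
      by (simp only: surface_hom(3)[OF assms(1) invariant_pow[OF gens(1)] invariant_pow[OF gens(2)]]
        surface_pow[OF assms(1) gens(1)] surface_pow[OF assms(1) gens(2)] assms(2,3))
    also have "\<dots> = 0" using False by auto
    finally have "\<xi> (mon i j) = 0" using d_pos by simp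
    then show ?thesis using False by (auto simp: mon_def)
  qed
  then have "\<xi> (mon (fst q) (snd q)) = point (0, 0) (mon (fst q) (snd q))" if "q \<in> supp p" for q
    using p(2)[rule_format, of "fst q" "snd q"] that mono_invariant by simp
  then show "\<xi> a = point (0, 0) a"
    unfolding surface_expand[OF assms(1) p(3,2)] surface_expand[OF point_surface p(3,2)]
    by (intro sum.cong) simp_all
qed

text \<open>The values of \<open>x ^ d\<close> and \<open>y ^ d\<close> leave finitely many choices
  for each coordinate.\<close>

lemma finite_fibre: "finite {z. point z = \<eta>}"
proof (cases "\<exists>z0. point z0 = \<eta>")
  case True
  then obtain z0 where z0: "point z0 = \<eta>" by blast
  have gens: "mon d 0 \<in> \<A>" "mon 0 d \<in> \<A>" using mono_generators by blast+
  have fin: "finite {x::complex. x ^ d = c}" for c using d_pos by (intro finite_nth_roots) simp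
  have "{z. point z = \<eta>} \<subseteq> {x. x ^ d = fst z0 ^ d} \<times> {y. y ^ d = snd z0 ^ d}"
  proof
    fix z assume "z \<in> {z. point z = \<eta>}"
    then have "point z (mon d 0) = point z0 (mon d 0)" "point z (mon 0 d) = point z0 (mon 0 d)"
      using z0 by simp_all
    then have "fst z ^ d = fst z0 ^ d" "snd z ^ d = snd z0 ^ d" using gens by (simp_all add: mon_def)
    then show "z \<in> {x. x ^ d = fst z0 ^ d} \<times> {y. y ^ d = snd z0 ^ d}" by (cases z) simp
  qed
  then show ?thesis using fin finite_subset by blast
next
  case False
  then have empty: "{z. point z = \<eta>} = {}" by blast
  show ?thesis unfolding empty by (rule finite.emptyI)
qed

text \<open>The components are \<open>d\<close>-th roots of the pullbacks of \<open>x ^ d\<close>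
  and \<open>y ^ d\<close>. Once the pullback of \<open>x * y ^ (d - e)\<close> has fixed the first
  root relative to the second, all invariant monomials are pulled back correctly, and these span the
  invariants.\<close>

lemma lift_exists:
  assumes \<phi>: "\<phi> \<in> carrier (Aut_surface d e)"
  shows "\<exists>h. pulls_back h \<and> lift_of \<phi> h"
proof -
  have bij: "bij_betw \<phi> \<X> \<X>" and mor: "morphism \<X> (surface_ring d e) \<X> (surface_ring d e) \<phi>"
    using \<phi> unfolding variety_aut_carrier Bij_def by auto
  have \<phi>X: "\<phi> \<xi> \<in> \<X>" if "\<xi> \<in> \<X>" for \<xi> using mor that unfolding morphism_def by blast
  \<comment> \<open>The comorphism, read off at points of the plane; regularity of
    \<open>\<phi>\<close> shows that its values are invariants and that it describes
    \<open>\<phi>\<close> on the whole surface.\<close>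
  define pb where "pb a = (\<lambda>z. \<phi> (point z) a)" for a
  have pb: "pb a \<in> \<A>" "\<xi> \<in> \<X> \<Longrightarrow> \<phi> \<xi> a = \<xi> (pb a)" if a: "a \<in> \<A>" for a \<xi>
  proof -
    have "(\<lambda>\<xi>. \<xi> a) \<in> surface_ring d e" using a surface_ring_iff by blast
    then obtain c where "c \<in> surface_ring d e" "\<forall>\<xi>\<in>\<X>. \<phi> \<xi> a = c \<xi>"
      using mor unfolding morphism_def by fastforce
    then obtain a' where a': "a' \<in> \<A>" "\<forall>\<xi>\<in>\<X>. \<phi> \<xi> a = \<xi> a'" unfolding surface_ring_iff by blast
    have "pb a = a'" unfolding pb_def using a' point_surface by (intro ext) simp
    then show "pb a \<in> \<A>" "\<xi> \<in> \<X> \<Longrightarrow> \<phi> \<xi> a = \<xi> (pb a)" using a' by simp_all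
  qed
  have pb_hom: "pb (\<lambda>z. a z * b z) = (\<lambda>z. pb a z * pb b z)" if "a \<in> \<A>" "b \<in> \<A>" for a b
    unfolding pb_def using surface_hom(3)[OF \<phi>X[OF point_surface] that] by (intro ext)
  have pb_pow: "pb (\<lambda>z. a z ^ n) = (\<lambda>z. pb a z ^ n)" if "a \<in> \<A>" for a n
    unfolding pb_def using surface_pow[OF \<phi>X[OF point_surface] that] by (intro ext)
  obtain e' where gens: "e' < d" "mon d 0 \<in> \<A>" "mon 0 d \<in> \<A>" "mon 1 (d - e) \<in> \<A>" "mon (d - e') 1 \<in> \<A>"
    by (rule mono_generators)
  have poly: "\<exists>p. pb a = ev p" if "a \<in> \<A>" for a
    using pb(1)[OF that] unfolding invariant_iff plane_ring_ev by blast
  obtain f g k l where fgkl: "pb (mon d 0) = ev f" "pb (mon 0 d) = ev g"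
    "pb (mon 1 (d - e)) = ev k" "pb (mon (d - e') 1) = ev l"
    using poly gens by metis
  have coprime_fg: "Rings.coprime f g"
  proof (rule coprime_of_finite_zeros)
    have "{z. ev f z = 0 \<and> ev g z = 0} \<subseteq> {z. point z = inv_into \<X> \<phi> (point (0, 0))}"
    proof clarsimp
      fix x y assume z: "ev f (x, y) = 0" "ev g (x, y) = 0"
      have "\<phi> (point (x, y)) = point (0, 0)"
        using z fun_cong[OF fgkl(1), of "(x, y)"] fun_cong[OF fgkl(2), of "(x, y)"]
        by (intro surface_zero_unique \<phi>X point_surface) (simp_all add: pb_def)
      then show "point (x, y) = inv_into \<X> \<phi> (point (0, 0))"
        using bij point_surface by (metis bij_betw_inv_into_left)
    qed
    then show "finite {z. ev f z = 0 \<and> ev g z = 0}" using finite_fibre finite_subset by blast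
  qed
  have "f * g ^ (d - e) = k ^ d"
  proof -
    have "(\<lambda>z. mon 1 (d - e) z ^ d) = (\<lambda>z. mon d 0 z * mon 0 d z ^ (d - e))"
      by (auto simp: mon_def power_mult_distrib power_mult[symmetric] mult.commute)
    then have "pb (\<lambda>z. mon 1 (d - e) z ^ d) = pb (\<lambda>z. mon d 0 z * mon 0 d z ^ (d - e))" by simp
    then have "(\<lambda>z. ev k z ^ d) = (\<lambda>z. ev f z * ev g z ^ (d - e))"
      using gens invariant_pow by (simp only: pb_pow pb_hom fgkl)
    then have "ev (k ^ d) = ev (f * g ^ (d - e))" by (simp add: fun_eq_iff)
    then show ?thesis unfolding ev_inject by simp
  qed
  then obtain u where u: "f = u ^ d"
    using coprime_factor_power[of f "g ^ (d - e)" k d] coprime_fg d_pos by auto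
  have "g * f ^ (d - e') = l ^ d"
  proof -
    have "(\<lambda>z. mon (d - e') 1 z ^ d) = (\<lambda>z. mon 0 d z * mon d 0 z ^ (d - e'))"
      by (auto simp: mon_def power_mult_distrib power_mult[symmetric] mult.commute)
    then have "pb (\<lambda>z. mon (d - e') 1 z ^ d) = pb (\<lambda>z. mon 0 d z * mon d 0 z ^ (d - e'))" by simp
    then have "(\<lambda>z. ev l z ^ d) = (\<lambda>z. ev g z * ev f z ^ (d - e'))"
      using gens invariant_pow by (simp only: pb_pow pb_hom fgkl)
    then have "ev (l ^ d) = ev (g * f ^ (d - e'))" by (simp add: fun_eq_iff)
    then show ?thesis unfolding ev_inject by simp
  qed
  then obtain v where v: "g = v ^ d"
    using coprime_factor_power[of g "f ^ (d - e')" l d] coprime_fg d_pos by (auto simp: coprime_commute)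
  have "k ^ d = (u * v ^ (d - e)) ^ d"
    using \<open>f * g ^ (d - e) = k ^ d\<close> unfolding u v
    by (simp add: power_mult_distrib power_mult[symmetric] mult.commute)
  \<comment> \<open>\<open>k\<close> and \<open>u * v ^ (d - e)\<close> have the same
    \<open>d\<close>-th power; the constant \<open>\<omega>\<close> between them is moved into
    \<open>u\<close>, which leaves \<open>u ^ d\<close> unchanged.\<close>
  then obtain \<omega> where \<omega>: "\<omega> ^ d = 1" "k = bconst \<omega> * (u * v ^ (d - e))"
    using equal_powers d_pos by (metis less_trans zero_less_one)
  define u' where "u' = bconst \<omega> * u"
  have fu: "f = u' ^ d" unfolding u'_def u using \<omega>(1)
    by (simp only: power_mult_distrib poly_const_pow) (simp add: one_pCons[symmetric])
  have ku: "k = u' * v ^ (d - e)" unfolding u'_def \<omega>(2) by (simp only: mult.assoc)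
  \<comment> \<open>Otherwise \<open>y ^ d\<close> would vanish on the image of
    \<open>\<phi>\<close>, but \<open>\<phi>\<close> is onto and \<open>y ^ d\<close> is 1 at the
    image of \<open>(0, 1)\<close>.\<close>
  have v_nz: "v \<noteq> 0"
  proof
    assume "v = 0"
    then have "ev g = (\<lambda>_. 0)" using v d_pos by (auto simp: power_0_left)
    then have "pb (mon 0 d) = (\<lambda>_. 0)" using fgkl by simp
    then have z: "\<phi> \<xi> (mon 0 d) = 0" if "\<xi> \<in> \<X>" for \<xi>
      using pb(2)[OF gens(3) that] surface_hom(1)[OF that, of 0] by simp
    obtain \<xi> where "\<xi> \<in> \<X>" "\<phi> \<xi> = point (0, 1)"
      using bij point_surface by (metis bij_betw_imp_surj_on imageE)
    then have "point (0, 1) (mon 0 d) = 0" using z by metis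
    then show False using gens by (simp add: mon_def)
  qed
  define h where "h = (\<lambda>z. (ev u' z, ev v z))"
  \<comment> \<open>Invariance makes \<open>j\<close> congruent to \<open>i * (d - e)\<close>, so up
    to powers of \<open>y ^ d\<close> on both sides the monomial is the \<open>i\<close>-th power of
    \<open>x * y ^ (d - e)\<close>. Those powers cancel because \<open>v\<close> is nonzero.\<close>
  have mono_h: "pb (mon i j) = mon i j \<circ> h" if ij: "[e * i + j = 0] (mod d)" for i j
  proof -
    obtain p where p: "pb (mon i j) = ev p" using poly[OF mono_invariant[OF ij]] by blast
    have ie: "i * (d - e) + e * i = d * i"
      using e_less by (simp add: mult.commute[of i] distrib_right[symmetric])
    have "[j + e * i = i * (d - e) + e * i] (mod d)"
      using ij unfolding ie by (simp add: cong_def add.commute)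
    then have "[j = i * (d - e)] (mod d)" by (simp only: cong_add_rcancel_nat)
    then obtain s t where st: "j + d * t = i * (d - e) + d * s"
      using cong_iff_lin_nat by (metis add.commute mult.commute)
    have "(\<lambda>z. mon i j z * mon 0 d z ^ t) = (\<lambda>z. mon 1 (d - e) z ^ i * mon 0 d z ^ s)"
    proof (rule ext)
      fix z
      have "mon i j z * mon 0 d z ^ t = fst z ^ i * snd z ^ (j + d * t)"
        by (simp add: mon_def power_add power_mult[symmetric])
      also have "\<dots> = mon 1 (d - e) z ^ i * mon 0 d z ^ s"
        unfolding st by (simp add: mon_def power_add power_mult[symmetric] power_mult_distrib mult.commute)
      finally show "mon i j z * mon 0 d z ^ t = mon 1 (d - e) z ^ i * mon 0 d z ^ s" .
    qed
    then have "pb (\<lambda>z. mon i j z * mon 0 d z ^ t) = pb (\<lambda>z. mon 1 (d - e) z ^ i * mon 0 d z ^ s)" by simp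
    then have "(\<lambda>z. ev p z * ev g z ^ t) = (\<lambda>z. ev k z ^ i * ev g z ^ s)"
      using gens invariant_pow mono_invariant[OF ij] by (simp only: pb_pow pb_hom fgkl p)
    then have "ev (p * g ^ t) = ev (k ^ i * g ^ s)" by (simp add: fun_eq_iff)
    then have "p * g ^ t = k ^ i * g ^ s" unfolding ev_inject .
    also have "\<dots> = u' ^ i * v ^ (i * (d - e) + d * s)"
      unfolding ku v by (simp add: power_mult_distrib power_mult[symmetric] power_add mult.commute mult.left_commute)
    also have "\<dots> = (u' ^ i * v ^ j) * g ^ t"
      unfolding st[symmetric] v by (simp add: power_add power_mult[symmetric] mult.assoc)
    finally have "p = u' ^ i * v ^ j" using v v_nz by simp
    then show ?thesis unfolding p by (auto simp: h_def mon_def)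
  qed
  have "pb a = a \<circ> h" if a: "a \<in> \<A>" for a
  proof
    fix z
    obtain p where p: "a = ev p" "\<forall>i j. (i, j) \<in> supp p \<longrightarrow> [e * i + j = 0] (mod d)"
      "a = (\<lambda>z. \<Sum>q\<in>supp p. cf p (fst q) (snd q) * mon (fst q) (snd q) z)" by (rule invariant_expand[OF a], rule that)
    have "pb a z = (\<Sum>q\<in>supp p. cf p (fst q) (snd q) * pb (mon (fst q) (snd q)) z)"
      unfolding pb_def by (rule surface_expand[OF \<phi>X[OF point_surface] p(3,2)])
    also have "\<dots> = (\<Sum>q\<in>supp p. cf p (fst q) (snd q) * mon (fst q) (snd q) (h z))"
      using p(2) mono_h by (intro sum.cong) auto
    also have "\<dots> = a (h z)" using fun_cong[OF p(3), of "h z"] by simp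
    finally show "pb a z = (a \<circ> h) z" by simp
  qed
  then have "lift_of \<phi> h" unfolding lift_of_def using pb by metis
  moreover have "pulls_back h" by (rule pulls_backI[of _ u' v]) (simp_all add: h_def)
  ultimately show ?thesis by blast
qed

text \<open>Invariance of \<open>x ^ d\<close> and \<open>y ^ d\<close> makes \<open>g\<close>
  diagonal with roots of unity as entries; invariance of \<open>x * y ^ (d - e)\<close> links the
  entries as in a power of the generator.\<close>

lemma deck_transformation:
  assumes "pulls_back g" "\<And>a. a \<in> \<A> \<Longrightarrow> a \<circ> g = a"
  shows "g \<in> range rot"
proof -
  have "fst \<in> plane_ring" "snd \<in> plane_ring"
    unfolding plane_ring_def by (simp_all add: function_algebra.gen)
  then have "fst \<circ> g \<in> plane_ring" "snd \<circ> g \<in> plane_ring"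
    using assms(1) unfolding pulls_back_def by blast+
  then obtain P Q where PQ: "fst \<circ> g = ev P" "snd \<circ> g = ev Q" unfolding plane_ring_ev by blast
  obtain e' where gens: "mon d 0 \<in> \<A>" "mon 0 d \<in> \<A>" "mon 1 (d - e) \<in> \<A>"
    using mono_generators by blast
  have gz: "g z = (ev P z, ev Q z)" for z
    using fun_cong[OF PQ(1), of z] fun_cong[OF PQ(2), of z] by (simp add: prod_eq_iff)
  have "ev (P ^ d) = ev (X ^ d)" using fun_cong[OF assms(2)[OF gens(1)]] by (simp add: fun_eq_iff mon_def gz)
  then obtain c where c: "c ^ d = 1" "P = bconst c * X"
    using equal_powers[of P d X] d_pos unfolding ev_inject by auto
  have "ev (Q ^ d) = ev (Y ^ d)" using fun_cong[OF assms(2)[OF gens(2)]] by (simp add: fun_eq_iff mon_def gz)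
  then obtain b where b: "b ^ d = 1" "Q = bconst b * Y"
    using equal_powers[of Q d Y] d_pos unfolding ev_inject by auto
  have g: "g (x, y) = (c * x, b * y)" for x y
    unfolding gz c(2) b(2) by (simp del: mult_pCons_left mult_pCons_right)
  have "c * b ^ (d - e) = 1"
    using fun_cong[OF assms(2)[OF gens(3)], of "(1, 1)"] by (simp add: mon_def g)
  moreover have "b ^ e * b ^ (d - e) = 1" using b(1) e_less by (simp add: power_add[symmetric])
  ultimately have cb: "c = b ^ e" by (metis mult_right_cancel mult_zero_right zero_neq_one)
  obtain k where "b = \<zeta> ^ k" using root_of_unity[OF b(1)] by blast
  then have "g = rot k" using g cb by (auto simp: rot_def fun_eq_iff power_mult[symmetric] mult.commute)
  then show ?thesis by blast
qed

text \<open>Lifts of \<open>\<phi>\<close> and of its inverse compose, in either order, to maps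
  fixing all invariants, that is to rotations. Correcting by a rotation gives a genuine inverse, and
  conjugates of rotations fix the invariants again, so the lift normalizes the cyclic group.\<close>

theorem descend_surjective:
  assumes \<phi>: "\<phi> \<in> carrier (Aut_surface d e)"
  shows "\<exists>h\<in>N_full d e. descend d e h = \<phi>"
proof -
  interpret S: group "Aut_surface d e" by (rule group_variety_aut)
  define \<psi> where "\<psi> = inv\<^bsub>Aut_surface d e\<^esub> \<phi>"
  have \<psi>: "\<psi> \<in> carrier (Aut_surface d e)" unfolding \<psi>_def using \<phi> by simp
  have B: "\<phi> \<in> Bij \<X>" "\<psi> \<in> Bij \<X>" using \<phi> \<psi> unfolding variety_aut_carrier by auto
  then have \<phi>X: "\<phi> \<xi> \<in> \<X>" "\<psi> \<xi> \<in> \<X>" if "\<xi> \<in> \<X>" for \<xi>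
    using that Bij_imp_funcset by blast+
  have "\<phi> \<otimes>\<^bsub>Aut_surface d e\<^esub> \<psi> = \<one>\<^bsub>Aut_surface d e\<^esub>" "\<psi> \<otimes>\<^bsub>Aut_surface d e\<^esub> \<phi> = \<one>\<^bsub>Aut_surface d e\<^esub>"
    unfolding \<psi>_def using \<phi> by (rule S.r_inv, rule S.l_inv)
  then have c: "compose \<X> \<phi> \<psi> = (\<lambda>\<xi>\<in>\<X>. \<xi>)" "compose \<X> \<psi> \<phi> = (\<lambda>\<xi>\<in>\<X>. \<xi>)"
    unfolding variety_aut_mult[OF B] variety_aut_mult[OF B(2,1)] variety_aut_one .
  have inverse: "\<phi> (\<psi> \<xi>) = \<xi>" "\<psi> (\<phi> \<xi>) = \<xi>" if "\<xi> \<in> \<X>" for \<xi>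
    using fun_cong[OF c(1), of \<xi>] fun_cong[OF c(2), of \<xi>] that by (simp_all add: compose_def)
  obtain h where h: "pulls_back h" "lift_of \<phi> h" using lift_exists[OF \<phi>] by blast
  obtain k where k: "pulls_back k" "lift_of \<psi> k" using lift_exists[OF \<psi>] by blast
  have lh: "a \<circ> h \<in> \<A>" "\<xi> \<in> \<X> \<Longrightarrow> \<phi> \<xi> a = \<xi> (a \<circ> h)" if "a \<in> \<A>" for a \<xi>
    using h(2) that unfolding lift_of_def by blast+
  have lk: "a \<circ> k \<in> \<A>" "\<xi> \<in> \<X> \<Longrightarrow> \<psi> \<xi> a = \<xi> (a \<circ> k)" if "a \<in> \<A>" for a \<xi>
    using k(2) that unfolding lift_of_def by blast+
  have pb: "pulls_back (p \<circ> q)" if "pulls_back p" "pulls_back q" for p q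
    using that unfolding pulls_back_def by (auto simp: comp_assoc[symmetric])
  have hk: "a \<circ> (h \<circ> k) = a" if a: "a \<in> \<A>" for a
  proof
    fix z
    have "a z = \<phi> (\<psi> (point z)) a" using inverse(1)[OF point_surface, of z] a by simp
    also have "\<dots> = \<psi> (point z) (a \<circ> h)" by (rule lh(2)[OF a \<phi>X(2)[OF point_surface]])
    also have "\<dots> = point z (a \<circ> h \<circ> k)" by (rule lk(2)[OF lh(1)[OF a] point_surface])
    also have "\<dots> = (a \<circ> h \<circ> k) z" by (rule point_apply[OF lk(1)[OF lh(1)[OF a]]])
    finally show "(a \<circ> (h \<circ> k)) z = a z" by (simp only: comp_assoc)
  qed
  have kh: "a \<circ> (k \<circ> h) = a" if a: "a \<in> \<A>" for a
  proof
    fix z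
    have "a z = \<psi> (\<phi> (point z)) a" using inverse(2)[OF point_surface, of z] a by simp
    also have "\<dots> = \<phi> (point z) (a \<circ> k)" by (rule lk(2)[OF a \<phi>X(1)[OF point_surface]])
    also have "\<dots> = point z (a \<circ> k \<circ> h)" by (rule lh(2)[OF lk(1)[OF a] point_surface])
    also have "\<dots> = (a \<circ> k \<circ> h) z" by (rule point_apply[OF lh(1)[OF lk(1)[OF a]]])
    finally show "(a \<circ> (k \<circ> h)) z = a z" by (simp only: comp_assoc)
  qed
  obtain i where i: "h \<circ> k = rot i" using deck_transformation[OF pb[OF h(1) k(1)] hk] by blast
  obtain j where j: "k \<circ> h = rot j" using deck_transformation[OF pb[OF k(1) h(1)] kh] by blast
  \<comment> \<open>Cancelling the rotation \<open>h \<circ> k\<close> on the right makes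
    \<open>m\<close> a right inverse of \<open>h\<close>; a left inverse arises from
    \<open>k \<circ> h\<close> in the same way, and the two coincide.\<close>
  define m where "m = k \<circ> rot (d * i - i)"
  have hm: "h \<circ> m = id" unfolding m_def comp_assoc[symmetric] i by (rule rot_inverse(1))
  have "rot (d * j - j) \<circ> k \<circ> h = id" unfolding comp_assoc j by (rule rot_inverse(2))
  then have "rot (d * j - j) \<circ> k = m" using hm by (metis comp_assoc comp_id id_comp)
  then have mh: "m \<circ> h = id" using \<open>rot (d * j - j) \<circ> k \<circ> h = id\<close> by simp
  have "h (m z) = z" "m (h z) = z" for z
    using fun_cong[OF hm, of z] fun_cong[OF mh, of z] by simp_all
  moreover have "pulls_back m" unfolding m_def by (rule pb[OF k(1) pulls_back_rot])
  ultimately have hA: "h \<in> carrier Aut_plane" using Aut_planeI(1)[of h m] h(1) by blast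
  have lm: "a \<circ> m \<in> \<A>" if "a \<in> \<A>" for a
    using lk(1)[OF that] unfolding m_def comp_assoc[symmetric] by (simp add: invariant_iff comp_assoc[symmetric])
  have inv: "a \<circ> rot l = a" if "a \<in> \<A>" for a l using that unfolding invariant_iff by blast
  have "\<exists>l. h \<circ> rot n = rot l \<circ> h" for n
  proof -
    have "a \<circ> (h \<circ> rot n \<circ> m) = a" if a: "a \<in> \<A>" for a
    proof -
      have "a \<circ> (h \<circ> rot n \<circ> m) = a \<circ> h \<circ> rot n \<circ> m" by (simp only: comp_assoc)
      also have "\<dots> = a \<circ> (h \<circ> m)" unfolding inv[OF lh(1)[OF a]] by (simp only: comp_assoc)
      finally show ?thesis unfolding hm by simp
    qed
    then obtain l where l: "h \<circ> rot n \<circ> m = rot l"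
      using deck_transformation[OF pb[OF pb[OF h(1) pulls_back_rot] \<open>pulls_back m\<close>]] by blast
    have "h \<circ> rot n = h \<circ> rot n \<circ> m \<circ> h" using mh by (simp add: comp_assoc)
    then show ?thesis unfolding l by blast
  qed
  moreover have "\<exists>n. h \<circ> rot n = rot l \<circ> h" for l
  proof -
    have "a \<circ> (m \<circ> rot l \<circ> h) = a" if a: "a \<in> \<A>" for a
    proof -
      have "a \<circ> (m \<circ> rot l \<circ> h) = a \<circ> m \<circ> rot l \<circ> h" by (simp only: comp_assoc)
      also have "\<dots> = a \<circ> (m \<circ> h)" unfolding inv[OF lm[OF a]] by (simp only: comp_assoc)
      finally show ?thesis unfolding mh by simp
    qed
    then obtain n where n: "m \<circ> rot l \<circ> h = rot n"
      using deck_transformation[OF pb[OF pb[OF \<open>pulls_back m\<close> pulls_back_rot] h(1)]] by blast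
    have "rot l \<circ> h = (h \<circ> m) \<circ> (rot l \<circ> h)" unfolding hm by simp
    also have "\<dots> = h \<circ> rot n" unfolding n[symmetric] by (simp only: comp_assoc)
    finally show ?thesis by metis
  qed
  ultimately have hN: "h \<in> N_full d e" by (rule N_fullI[OF hA])
  have "descend d e h = \<phi>"
  proof
    fix \<xi>
    show "descend d e h \<xi> = \<phi> \<xi>"
    proof (cases "\<xi> \<in> \<X>")
      case True
      show ?thesis
        by (rule surface_eqI[OF descend_surface[OF hN True] \<phi>X(1)[OF True]])
          (use True lh(2) descend_apply in simp)
    next
      case False
      then show ?thesis using B(1) by (simp add: descend_def Bij_def extensional_def)
    qed
  qed
  then show ?thesis using hN by blast
qed

end

section \<open>Algebraic groups have bounded degree\<close>

context toric_surface
begin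

lemma ev_curve: "\<exists>v. \<forall>t. ev p (t\<^sup>2, t ^ 3) = poly v t"
proof (induction p rule: bpoly_induct)
  case (1 a)
  show ?case by (rule exI[of _ "[:a:]"]) simp
next
  case 2
  show ?case by (rule exI[of _ "monom 1 2"]) (simp add: poly_monom)
next
  case 3
  show ?case by (rule exI[of _ "monom 1 3"]) (simp add: poly_monom)
next
  case (4 p q)
  then obtain v w where "\<forall>t. ev p (t\<^sup>2, t ^ 3) = poly v t" "\<forall>t. ev q (t\<^sup>2, t ^ 3) = poly w t" by blast
  then show ?case by (intro exI[of _ "v + w"]) simp
next
  case (5 p q)
  then obtain v w where "\<forall>t. ev p (t\<^sup>2, t ^ 3) = poly v t" "\<forall>t. ev q (t\<^sup>2, t ^ 3) = poly w t" by blast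
  then show ?case by (intro exI[of _ "v * w"]) simp
qed

text \<open>An element of the product ring involves finitely many functions on the surface, and
  fixing \<open>M\<close> only turns the matrix functions into constants. Hence \<open>m\<close> can
  be chosen before \<open>M\<close>.\<close>

lemma product_ring_uniform_degree:
  assumes "a \<in> product_ring S (surface_ring d e)"
  shows "\<exists>m. \<forall>M. \<exists>r\<in>\<A>. (\<forall>\<xi>\<in>\<X>. a (M, \<xi>) = \<xi> r) \<and> (\<exists>v. degree v \<le> m \<and> (\<forall>t. r (t\<^sup>2, t ^ 3) = poly v t))"
    (is "\<exists>m. \<forall>M. \<exists>r\<in>\<A>. ?P a m M r")
  using assms unfolding product_ring_def
proof (induction rule: function_algebra.induct)
  case (gen a)
  then consider b where "a = (\<lambda>z. b (fst z))" | b where "b \<in> surface_ring d e" "a = (\<lambda>z. b (snd z))" by blast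
  then show ?case
  proof cases
    case 1
    have "?P a 0 M (\<lambda>_. b M)" for M
    proof (intro conjI ballI)
      show "a (M, \<xi>) = \<xi> (\<lambda>_. b M)" if "\<xi> \<in> \<X>" for \<xi>
        unfolding 1 fst_conv by (rule surface_hom(1)[OF that, symmetric])
      show "\<exists>v. degree v \<le> 0 \<and> (\<forall>t :: complex. b M = poly v t)" by (rule exI[of _ "[:b M:]"]) simp
    qed
    then show ?thesis using invariant_const by blast
  next
    case 2
    then obtain r where r: "r \<in> \<A>" "b = (\<lambda>\<xi>. \<xi> r)" unfolding surface_ring_iff by blast
    obtain p where "r = ev p" using r(1) unfolding invariant_iff plane_ring_ev by blast
    then obtain v where "\<forall>t. r (t\<^sup>2, t ^ 3) = poly v t" using ev_curve by blast
    then have "?P a (degree v) M r" for M using 2 r by auto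
    then show ?thesis using r(1) by blast
  qed
next
  case (const c)
  have "?P (\<lambda>_. c) 0 M (\<lambda>_. c)" for M
  proof (intro conjI ballI)
    show "c = \<xi> (\<lambda>_. c)" if "\<xi> \<in> \<X>" for \<xi>
      by (rule surface_hom(1)[OF that, symmetric])
    show "\<exists>v. degree v \<le> 0 \<and> (\<forall>t :: complex. c = poly v t)" by (rule exI[of _ "[:c:]"]) simp
  qed
  then show ?case using invariant_const by blast
next
  case (add a b)
  then obtain m n where m: "\<And>M. \<exists>r\<in>\<A>. ?P a m M r" and n: "\<And>M. \<exists>r\<in>\<A>. ?P b n M r" by blast
  have "\<exists>r\<in>\<A>. ?P (\<lambda>x. a x + b x) (max m n) M r" for M
  proof -
    obtain r v where r: "r \<in> \<A>" "\<forall>\<xi>\<in>\<X>. a (M, \<xi>) = \<xi> r" "degree v \<le> m" "\<forall>t. r (t\<^sup>2, t ^ 3) = poly v t"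
      using m[of M] by blast
    obtain s w where s: "s \<in> \<A>" "\<forall>\<xi>\<in>\<X>. b (M, \<xi>) = \<xi> s" "degree w \<le> n" "\<forall>t. s (t\<^sup>2, t ^ 3) = poly w t"
      using n[of M] by blast
    have "degree (v + w) \<le> max m n" using r(3) s(3) by (intro degree_add_le) auto
    then have "?P (\<lambda>x. a x + b x) (max m n) M (\<lambda>z. r z + s z)"
      using r s surface_hom(2) by (auto intro!: exI[of _ "v + w"])
    then show ?thesis using invariant_add[OF r(1) s(1)] by blast
  qed
  then show ?case by blast
next
  case (mult a b)
  then obtain m n where m: "\<And>M. \<exists>r\<in>\<A>. ?P a m M r" and n: "\<And>M. \<exists>r\<in>\<A>. ?P b n M r" by blast
  have "\<exists>r\<in>\<A>. ?P (\<lambda>x. a x * b x) (m + n) M r" for M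
  proof -
    obtain r v where r: "r \<in> \<A>" "\<forall>\<xi>\<in>\<X>. a (M, \<xi>) = \<xi> r" "degree v \<le> m" "\<forall>t. r (t\<^sup>2, t ^ 3) = poly v t"
      using m[of M] by blast
    obtain s w where s: "s \<in> \<A>" "\<forall>\<xi>\<in>\<X>. b (M, \<xi>) = \<xi> s" "degree w \<le> n" "\<forall>t. s (t\<^sup>2, t ^ 3) = poly w t"
      using n[of M] by blast
    have "degree (v * w) \<le> m + n" using r(3) s(3) degree_mult_le[of v w] by linarith
    then have "?P (\<lambda>x. a x * b x) (m + n) M (\<lambda>z. r z * s z)"
      using r s surface_hom(3) by (auto intro!: exI[of _ "v * w"])
    then show ?thesis using invariant_mult[OF r(1) s(1)] by blast
  qed
  then show ?case by blast
qed

text \<open>The full preimage of \<open>G\<close> in the normalizer, so that it is a subgroup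
  whenever \<open>G\<close> is one.\<close>

definition lifted_group :: "(((plane \<Rightarrow> complex) \<Rightarrow> complex) \<Rightarrow> ((plane \<Rightarrow> complex) \<Rightarrow> complex)) set \<Rightarrow> (plane \<Rightarrow> plane) set" where
  "lifted_group G = {h \<in> N_full d e. descend d e h \<in> G}"

lemma subgroup_lifted_group:
  assumes "subgroup G (Aut_surface d e)"
  shows "subgroup (lifted_group G) Aut_plane"
proof
  show "lifted_group G \<subseteq> carrier Aut_plane" using N_fullD(1) unfolding lifted_group_def by blast
  have "descend d e \<one>\<^bsub>Aut_plane\<^esub> \<in> G"
    unfolding Aut_plane_one descend_id using subgroup.one_closed[OF assms] by (simp add: variety_aut_one)
  then show "\<one>\<^bsub>Aut_plane\<^esub> \<in> lifted_group G"
    unfolding lifted_group_def using subgroup.one_closed[OF subgroup_N_full] by blast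
  show "g \<otimes>\<^bsub>Aut_plane\<^esub> h \<in> lifted_group G" if "g \<in> lifted_group G" "h \<in> lifted_group G" for g h
    using that subgroup.m_closed[OF assms] subgroup.m_closed[OF subgroup_N_full]
    by (simp add: lifted_group_def descend_mult)
  show "inv\<^bsub>Aut_plane\<^esub> g \<in> lifted_group G" if "g \<in> lifted_group G" for g
    using that subgroup.m_inv_closed[OF assms] subgroup.m_inv_closed[OF subgroup_N_full]
    by (simp add: lifted_group_def descend_inv)
qed

lemma conjugate_into_quotient:
  assumes G: "G \<subseteq> carrier (Aut_surface d e)" and a: "a \<in> N_full d e"
    and Z: "\<forall>x\<in>lifted_group G. inv\<^bsub>Aut_plane\<^esub> a \<otimes>\<^bsub>Aut_plane\<^esub> x \<otimes>\<^bsub>Aut_plane\<^esub> a \<in> Z"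
  shows "conjugate_into (Aut_surface d e) G (quotient_in_Aut d e Z)"
proof -
  interpret S: group "Aut_surface d e" by (rule group_variety_aut)
  \<comment> \<open>\<open>conjugate_into\<close> puts the inverse on the right, the word argument
    puts it on the left; hence it is the inverse of \<open>a\<close> that descends to the
    conjugating element.\<close>
  define \<psi> where "\<psi> = descend d e (inv\<^bsub>Aut_plane\<^esub> a)"
  have ia: "inv\<^bsub>Aut_plane\<^esub> a \<in> N_full d e" by (rule subgroup.m_inv_closed[OF subgroup_N_full a])
  have \<psi>: "\<psi> \<in> carrier (Aut_surface d e)" unfolding \<psi>_def by (rule descend_carrier[OF ia])
  have i\<psi>: "inv\<^bsub>Aut_surface d e\<^esub> \<psi> = descend d e a"
    unfolding \<psi>_def descend_inv[OF a] using descend_carrier[OF a] by simp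
  have "\<psi> \<otimes>\<^bsub>Aut_surface d e\<^esub> g \<otimes>\<^bsub>Aut_surface d e\<^esub> inv\<^bsub>Aut_surface d e\<^esub> \<psi> \<in> quotient_in_Aut d e Z" if g: "g \<in> G" for g
  proof -
    obtain x where x: "x \<in> N_full d e" "descend d e x = g" using descend_surjective G g by blast
    then have xG: "x \<in> lifted_group G" using g unfolding lifted_group_def by blast
    have "inv\<^bsub>Aut_plane\<^esub> a \<otimes>\<^bsub>Aut_plane\<^esub> x \<in> N_full d e" by (rule subgroup.m_closed[OF subgroup_N_full ia x(1)])
    then have "\<psi> \<otimes>\<^bsub>Aut_surface d e\<^esub> g \<otimes>\<^bsub>Aut_surface d e\<^esub> inv\<^bsub>Aut_surface d e\<^esub> \<psi> =
        descend d e (inv\<^bsub>Aut_plane\<^esub> a \<otimes>\<^bsub>Aut_plane\<^esub> x \<otimes>\<^bsub>Aut_plane\<^esub> a)"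
      unfolding i\<psi> unfolding \<psi>_def x(2)[symmetric] by (simp add: descend_mult ia x(1) a)
    then show ?thesis unfolding quotient_in_Aut_def using Z xG by simp
  qed
  then show ?thesis
    unfolding conjugate_into_def l_coset_def r_coset_def using \<psi> by (intro bexI[of _ \<psi>]) auto
qed

text \<open>Joint regularity in the matrix and the point bounds degrees uniformly over
  \<open>L\<close>. For a fixed matrix it makes \<open>\<rho> M\<close> regular, and the inverse of
  \<open>\<rho> M\<close> is regular as the image of the inverse matrix.\<close>

lemma regular_action_group:
  assumes "regular_effective_action L \<X> (surface_ring d e) \<rho>" and L: "subgroup L GL"
  shows "subgroup (\<rho> ` L) (Aut_surface d e)" "bounded_degree (lifted_group (\<rho> ` L))"
proof -
  let ?R = "surface_ring d e"
  have mor: "morphism (L \<times> \<X>) (product_ring GL_ring ?R) \<X> ?R (\<lambda>(M, x). \<rho> M x)"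
    and "faithful_action (GL\<lparr>carrier := L\<rparr>) \<X> \<rho>"
    using assms(1) unfolding regular_effective_action_def by blast+
  then interpret \<rho>: group_hom "GL\<lparr>carrier := L\<rparr>" "BijGroup \<X>" \<rho>
    unfolding faithful_action_def group_action_def by blast
  have carrier: "carrier (GL\<lparr>carrier := L\<rparr>) = L" by simp
  have pull: "\<exists>m. \<forall>M\<in>L. \<exists>r\<in>\<A>. (\<forall>\<xi>\<in>\<X>. \<rho> M \<xi> a = \<xi> r) \<and> (\<exists>v. degree v \<le> m \<and> (\<forall>t. r (t\<^sup>2, t ^ 3) = poly v t))"
    if a: "a \<in> \<A>" for a
  proof -
    have "(\<lambda>\<xi>. \<xi> a) \<in> ?R" using a surface_ring_iff by blast
    then obtain c where c: "c \<in> product_ring GL_ring ?R" "\<forall>q\<in>L \<times> \<X>. (case q of (M, x) \<Rightarrow> \<rho> M x) a = c q"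
      using mor unfolding morphism_def by fastforce
    obtain m where m: "\<forall>M. \<exists>r\<in>\<A>. (\<forall>\<xi>\<in>\<X>. c (M, \<xi>) = \<xi> r) \<and> (\<exists>v. degree v \<le> m \<and> (\<forall>t. r (t\<^sup>2, t ^ 3) = poly v t))"
      using product_ring_uniform_degree[OF c(1)] by blast
    have "\<exists>r\<in>\<A>. (\<forall>\<xi>\<in>\<X>. \<rho> M \<xi> a = \<xi> r) \<and> (\<exists>v. degree v \<le> m \<and> (\<forall>t. r (t\<^sup>2, t ^ 3) = poly v t))" if M: "M \<in> L" for M
    proof -
      obtain r where r: "r \<in> \<A>" "\<forall>\<xi>\<in>\<X>. c (M, \<xi>) = \<xi> r" "\<exists>v. degree v \<le> m \<and> (\<forall>t. r (t\<^sup>2, t ^ 3) = poly v t)"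
        using m by blast
      have "\<rho> M \<xi> a = \<xi> r" if "\<xi> \<in> \<X>" for \<xi>
        using bspec[OF c(2), of "(M, \<xi>)"] r(2) M that by simp
      then show ?thesis using r(1,3) by blast
    qed
    then show ?thesis by blast
  qed
  have Bij: "\<rho> M \<in> Bij \<X>" if "M \<in> L" for M
    using \<rho>.hom_closed[of M] that by (simp add: BijGroup_def)
  have mor\<rho>: "morphism \<X> ?R \<X> ?R (\<rho> M)" if M: "M \<in> L" for M
    unfolding morphism_def
  proof (intro conjI ballI)
    show "\<rho> M \<in> \<X> \<rightarrow> \<X>" by (rule Bij_imp_funcset[OF Bij[OF M]])
    fix b assume "b \<in> ?R"
    then obtain a where a: "a \<in> \<A>" "b = (\<lambda>\<xi>. \<xi> a)" unfolding surface_ring_iff by blast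
    obtain r where "r \<in> \<A>" "\<forall>\<xi>\<in>\<X>. \<rho> M \<xi> a = \<xi> r" using pull[OF a(1)] M by blast
    then show "\<exists>c\<in>?R. \<forall>\<xi>\<in>\<X>. b (\<rho> M \<xi>) = c \<xi>"
      unfolding a(2) using surface_ring_iff by (intro bexI[of _ "\<lambda>\<xi>. \<xi> r"]) auto
  qed
  have sub: "\<rho> ` L \<subseteq> carrier (Aut_surface d e)"
  proof clarify
    fix M assume M: "M \<in> L"
    let ?N = "inv\<^bsub>GL\<lparr>carrier := L\<rparr>\<^esub> M"
    have N: "?N \<in> L" using \<rho>.G.inv_closed[of M] M by simp
    have "\<rho> ?N = (\<lambda>\<xi>\<in>\<X>. inv_into \<X> (\<rho> M) \<xi>)"
      using \<rho>.hom_inv[of M] M inv_BijGroup[OF Bij[OF M]] by simp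
    then have "\<rho> ?N \<xi> = inv_into \<X> (\<rho> M) \<xi>" if "\<xi> \<in> \<X>" for \<xi> using that by simp
    then have "morphism \<X> ?R \<X> ?R (inv_into \<X> (\<rho> M))" by (rule morphism_cong[OF _ mor\<rho>[OF N]])
    then show "\<rho> M \<in> carrier (Aut_surface d e)"
      unfolding variety_aut_carrier using Bij[OF M] mor\<rho>[OF M] by blast
  qed
  have img: "subgroup (\<rho> ` L) (BijGroup \<X>)" using \<rho>.img_is_subgroup by simp
  show "subgroup (\<rho> ` L) (Aut_surface d e)"
    using group.subgroup_incl[OF group_BijGroup img subgroup_variety_aut[of \<X> ?R]] sub
    unfolding variety_aut_def by simp
  \<comment> \<open>\<open>y ^ d\<close> pulls back along a lift \<open>h\<close> to the
    \<open>d\<close>-th power of the second component of \<open>h\<close>, the one that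
    \<open>bounded_degree\<close> measures.\<close>
  obtain e' where "mon 0 d \<in> \<A>" by (rule mono_generators)
  note mon = this
  obtain m where m: "\<And>M. M \<in> L \<Longrightarrow> \<exists>r\<in>\<A>. (\<forall>\<xi>\<in>\<X>. \<rho> M \<xi> (mon 0 d) = \<xi> r) \<and> (\<exists>v. degree v \<le> m \<and> (\<forall>t. r (t\<^sup>2, t ^ 3) = poly v t))"
    using pull[OF mon] by blast
  show "bounded_degree (lifted_group (\<rho> ` L))"
    unfolding bounded_degree_def
  proof (intro exI[of _ m] ballI)
    fix h assume "h \<in> lifted_group (\<rho> ` L)"
    then obtain M where h: "h \<in> N_full d e" "M \<in> L" "descend d e h = \<rho> M" unfolding lifted_group_def by blast
    obtain r v where r: "r \<in> \<A>" "\<forall>\<xi>\<in>\<X>. \<rho> M \<xi> (mon 0 d) = \<xi> r" "degree v \<le> m" "\<forall>t. r (t\<^sup>2, t ^ 3) = poly v t"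
      using m[OF h(2)] by blast
    have hr: "snd (h z) ^ d = r z" for z
    proof -
      have "snd (h z) ^ d = point z (mon 0 d \<circ> h)"
        using invariant_comp_N_full[OF h(1) mon] by (simp add: mon_def)
      also have "\<dots> = descend d e h (point z) (mon 0 d)" by (rule descend_apply[OF point_surface mon, symmetric])
      also have "\<dots> = r z" unfolding h(3) using r(1,2) point_surface by simp
      finally show ?thesis .
    qed
    obtain P Q where Q: "h = (\<lambda>z. (ev P z, ev Q z))" using Aut_plane_components[OF N_fullD(1)[OF h(1)]] .
    obtain w where w: "\<forall>t. ev Q (t\<^sup>2, t ^ 3) = poly w t" using ev_curve by blast
    have "poly w t ^ d = poly v t" for t
      using hr[of "(t\<^sup>2, t ^ 3)"] r(4) w by (simp add: Q)
    then have "poly (w ^ d) = poly v" by (intro ext) (simp add: poly_power)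
    then have "w ^ d = v" unfolding poly_eq_poly_eq_iff .
    then have "degree v = d * degree w" using degree_power_eq[of w d] d_pos by (cases "w = 0") (auto simp: power_0_left)
    moreover have "1 * degree w \<le> d * degree w" using d_pos by (intro mult_le_mono1) simp
    ultimately have "degree w \<le> m" using r(3) by linarith
    then show "\<exists>v. degree v \<le> m \<and> (\<forall>t. snd (h (t\<^sup>2, t ^ 3)) = poly v t)"
      using w by (intro exI[of _ w]) (simp add: Q)
  qed
qed

lemma quotient_mono: "Z \<subseteq> Z' \<Longrightarrow> conjugate_into A G (quotient_in_Aut d e Z) \<Longrightarrow> conjugate_into A G (quotient_in_Aut d e Z')"
  unfolding conjugate_into_def quotient_in_Aut_def by (meson image_mono order_trans)

theorem algebraic_group_conjugate:
  assumes "regular_effective_action L \<X> (surface_ring d e) \<rho>" "subgroup L GL" "G = \<rho> ` L"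
  shows "\<not> [e\<^sup>2 = 1] (mod d) \<Longrightarrow>
        conjugate_into (Aut_surface d e) G (quotient_in_Aut d e (N_plus d e)) \<or>
        conjugate_into (Aut_surface d e) G (quotient_in_Aut d e (N_minus d e))"
    and "[e\<^sup>2 = 1] (mod d) \<Longrightarrow> 1 < e \<Longrightarrow>
        conjugate_into (Aut_surface d e) G (quotient_in_Aut d e (N_plus d e)) \<or>
        conjugate_into (Aut_surface d e) G (quotient_in_Aut d e normalizer_torus)"
    and "e = 1 \<Longrightarrow>
        conjugate_into (Aut_surface d e) G (quotient_in_Aut d e (N_plus d e)) \<or>
        conjugate_into (Aut_surface d e) G (quotient_in_Aut d e GL2)"
proof -
  have sub: "subgroup G (Aut_surface d e)" and bd: "bounded_degree (lifted_group G)"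
    using regular_action_group[OF assms(1,2)] assms(3) by simp_all
  note GA = subgroup.subset[OF sub]
  have K: "subgroup (lifted_group G) Aut_plane" "lifted_group G \<subseteq> N_full d e"
    using subgroup_lifted_group[OF sub] unfolding lifted_group_def by auto
  note conj = conjugate_into_quotient[OF GA]
  show "conjugate_into (Aut_surface d e) G (quotient_in_Aut d e (N_plus d e)) \<or>
      conjugate_into (Aut_surface d e) G (quotient_in_Aut d e (N_minus d e))" if "\<not> [e\<^sup>2 = 1] (mod d)"
    using conjugate_generic[OF that K bd] conj by metis
  show "conjugate_into (Aut_surface d e) G (quotient_in_Aut d e (N_plus d e)) \<or>
      conjugate_into (Aut_surface d e) G (quotient_in_Aut d e normalizer_torus)" if "[e\<^sup>2 = 1] (mod d)" "1 < e"
  proof -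
    have "e \<noteq> 1" using that by simp
    then show ?thesis
      using conjugate_involutive[OF that(1) _ K bd] conj quotient_mono[OF monomial_group_normalizer_torus] by metis
  qed
  show "conjugate_into (Aut_surface d e) G (quotient_in_Aut d e (N_plus d e)) \<or>
      conjugate_into (Aut_surface d e) G (quotient_in_Aut d e GL2)" if "e = 1"
    using conjugate_linear[OF that K bd] conj by metis
qed

end

theorem theorem4p15:
  fixes d e :: nat
    and L :: "(complex^'n^'n) set"
    and \<rho> :: "complex^'n^'n
      \<Rightarrow> ((complex \<times> complex \<Rightarrow> complex) \<Rightarrow> complex) \<Rightarrow> ((complex \<times> complex \<Rightarrow> complex) \<Rightarrow> complex)"
    and G :: "(((complex \<times> complex \<Rightarrow> complex) \<Rightarrow> complex)
      \<Rightarrow> ((complex \<times> complex \<Rightarrow> complex) \<Rightarrow> complex)) set"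
  assumes "coprime d e" and "1 \<le> e" and "e < d"
    and "linear_algebraic_group L"
    and "regular_effective_action L (surface d e) (surface_ring d e) \<rho>"
    and "G = \<rho> ` L"
  shows
    "(\<not> [e^2 = 1] (mod d) \<longrightarrow>
        conjugate_into (Aut_surface d e) G (quotient_in_Aut d e (N_plus d e)) \<or>
        conjugate_into (Aut_surface d e) G (quotient_in_Aut d e (N_minus d e))) \<and>
     ([e^2 = 1] (mod d) \<and> e > 1 \<longrightarrow>
        conjugate_into (Aut_surface d e) G (quotient_in_Aut d e (N_plus d e)) \<or>
        conjugate_into (Aut_surface d e) G (quotient_in_Aut d e normalizer_torus)) \<and>
     (e = 1 \<longrightarrow>
        conjugate_into (Aut_surface d e) G (quotient_in_Aut d e (N_plus d e)) \<or>
        conjugate_into (Aut_surface d e) G (quotient_in_Aut d e GL2))"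
proof -
  interpret toric_surface d e using assms(1-3) by unfold_locales
  have "subgroup L GL" using assms(4) unfolding linear_algebraic_group_def by blast
  from algebraic_group_conjugate[OF assms(5) this assms(6)] show ?thesis by blast
qed

end
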